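(* Let $K$ be a subfield of $\overline{\mathbb{Q}}$, and let $\alpha \in \overline{\mathbb{Q}}^{\times}$. Assume that for every $\varepsilon > 0$ there is an integer $m \neq 0$ and an element $\beta \in K^{\times}$ such that $$h(\alpha^m/\beta) < \varepsilon |m|.$$ Then there is an integer $n \neq 0$ such that $\alpha^n$ belongs to $K^{\times}$.
   Context: $\overline{\mathbb{Q}}$ is a fixed algebraic closure of $\mathbb{Q}$ and $h : \overline{\mathbb{Q}}^{\times} \to [0,\infty)$ is the absolute logarithmic Weil height. *)

theory Defs
  imports "HOL-Analysis.Analysis" "HOL-Computational_Algebra.Computational_Algebra"
begin

text \<open>The algebraic closure of the rationals is taken inside the complex numbers.\<close>

definition Qbar :: "complex set" where
  "Qbar = {x. algebraic x}"

definition is_subfield :: "'a::field set \<Rightarrow> bool" where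
  "is_subfield F \<longleftrightarrow> 1 \<in> F \<and>
     (\<forall>x\<in>F. \<forall>y\<in>F. x - y \<in> F \<and> x * y \<in> F) \<and> (\<forall>x\<in>F. inverse x \<in> F)"

definition adjoin_rat :: "complex \<Rightarrow> complex set" where
  "adjoin_rat a = \<Inter>{F. is_subfield F \<and> a \<in> F}"

definition degree_over_rat :: "complex set \<Rightarrow> nat" where
  "degree_over_rat F = vector_space.dim (\<lambda>(q::rat) x. of_rat q * x) F"

definition embeddings :: "complex set \<Rightarrow> (complex \<Rightarrow> complex) set" where
  "embeddings F = {\<sigma> \<in> extensional F. \<sigma> 1 = 1 \<and>
     (\<forall>x\<in>F. \<forall>y\<in>F. \<sigma> (x + y) = \<sigma> x + \<sigma> y \<and> \<sigma> (x * y) = \<sigma> x * \<sigma> y)}"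

text \<open>
  The non-archimedean places of a number field F correspond to the surjective discrete valuations
  from the nonzero elements of F onto the integers. Valuations are made extensional so that each
  place is counted once; the convention that 0 has valuation infinity is spelled out below wherever
  it matters.
\<close>

definition finite_places :: "complex set \<Rightarrow> (complex \<Rightarrow> int) set" where
  "finite_places F = {v \<in> extensional (F - {0}). v ` (F - {0}) = UNIV \<and>
     (\<forall>x\<in>F - {0}. \<forall>y\<in>F - {0}. v (x * y) = v x + v y \<and>
        (x + y \<noteq> 0 \<longrightarrow> min (v x) (v y) \<le> v (x + y)))}"

definition valuation_ring :: "complex set \<Rightarrow> (complex \<Rightarrow> int) \<Rightarrow> complex set" where
  "valuation_ring F v = {x \<in> F. x = 0 \<or> 0 \<le> v x}"

definition valuation_ideal :: "complex set \<Rightarrow> (complex \<Rightarrow> int) \<Rightarrow> complex set" where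
  "valuation_ideal F v = {x \<in> F. x = 0 \<or> 0 < v x}"

definition residue_field :: "complex set \<Rightarrow> (complex \<Rightarrow> int) \<Rightarrow> complex set set" where
  "residue_field F v = valuation_ring F v //
     {(x, y) \<in> valuation_ring F v \<times> valuation_ring F v. x - y \<in> valuation_ideal F v}"

definition place_abs :: "complex set \<Rightarrow> (complex \<Rightarrow> int) \<Rightarrow> complex \<Rightarrow> real" where
  "place_abs F v x = (if x = 0 then 0 else real (card (residue_field F v)) powi (- v x))"

definition log_plus :: "real \<Rightarrow> real" where
  "log_plus t = ln (max 1 t)"

text \<open>
  Sum of the local terms over all places of F = Q(a), divided by [F : Q]. The normalised absolute
  value at a finite place v is the power of the residue cardinality in \<^const>\<open>place_abs\<close>, that is, the
  [F_v : Q_v]-th power of the absolute value extending the usual p-adic one. At the archimedean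
  places, summing over all embeddings into the complex numbers counts a real place once and a
  complex place twice, again according to its local degree. Only finitely many finite places
  contribute a nonzero term.
\<close>

definition weil_height :: "complex \<Rightarrow> real" where
  "weil_height a = (let F = adjoin_rat a in
     ((\<Sum>\<sigma>\<in>embeddings F. log_plus (norm (\<sigma> a)))
        + (\<Sum>\<^sub>\<infinity>v\<in>finite_places F. log_plus (place_abs F v a)))
     / real (degree_over_rat F))"

end

theory Submission
  imports Defs
begin

text \<open>
  Let \<open>\<alpha>'\<close> be a conjugate of \<open>\<alpha>\<close> over \<open>K\<close> and put \<open>x = \<alpha>' / \<alpha>\<close>. If \<open>\<gamma> = \<alpha>\<^sup>m / \<beta>\<close> has height less
  than \<open>\<epsilon> |m|\<close>, then \<open>\<gamma>' = \<alpha>'\<^sup>m / \<beta>\<close> is a conjugate of \<open>\<gamma>\<close> and \<open>x\<^sup>m = \<gamma>' / \<gamma>\<close>, so that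
  \<open>|m| h(x) \<le> 2 h(\<gamma>) < 2 \<epsilon> |m|\<close>. Hence \<open>h(x) = 0\<close> and \<open>x\<close> is a root of unity by Kronecker's
  theorem. Some power of \<open>\<alpha>\<close> therefore agrees with the same power of all conjugates, and the norm of
  \<open>\<alpha>\<close> to \<open>K\<close> shows that a further power lies in \<open>K\<close>.

  The inequality \<open>|m| h(x) \<le> 2 h(\<gamma>)\<close> is proved for Mahler heights, that is, for
  \<open>(ln a + \<Sum> log\<^sup>+ |z|) / d\<close>, where \<open>a\<close> and \<open>d\<close> are the leading coefficient and the degree of the
  primitive minimal polynomial and \<open>z\<close> runs over its roots: one averages over the orbit of
  \<open>(x, \<gamma>, \<gamma>')\<close> under the homomorphisms from the algebraic numbers to themselves, and compares
  leading coefficients by Gauss's lemma in all valuation rings of the complex numbers. Between the two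
  heights one needs a single inequality, namely \<open>a \<le> \<Prod> max 1 |\<gamma>|\<^sub>v\<close> over the finite places of
  \<open>\<rat>(\<gamma>)\<close>. For this one counts the combinations of \<open>\<gamma>\<^sup>d, \<dots>, \<gamma>\<^bsup>d+N-1\<^esup>\<close> with coefficients in
  \<open>{0..<a}\<close> modulo the elements that are integral at all finite places: there are \<open>a\<^sup>N\<close> of them,
  the number of classes is at most a constant times the \<open>N\<close>-th power of the product, and each class
  has boundedly many members.
\<close>

section \<open>Subrings and subfields\<close>

text \<open>The Weil height is defined through the field generated by its argument, so a triangle
  inequality for it would have to compare the places of different number fields. The valuation rings
  of the complex numbers get around this: Zorn's lemma supplies one above each prime, the rationals
  common to all of them are the integers, and they apply to \<gamma>, \<gamma>' and \<open>x\<close>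
  alike. The hypothesis makes a Weil height small, so the Mahler height has to be bounded above by
  it, and this fixes the direction of the one comparison. In the counting argument the powers start
  at exponent \<open>d\<close> because an element integral at all finite places is, up to a common
  denominator, an integer combination of the powers below \<open>d\<close>. Two combinations that
  the count fails to distinguish therefore give an integer polynomial with root \<gamma> whose
  leading coefficient is smaller than \<open>a\<close> in absolute value, although the minimal
  polynomial divides it. The factors that spoil the count do not depend on \<open>N\<close> and
  disappear as \<open>N\<close> grows.\<close>

definition is_subring :: "'a::comm_ring_1 set \<Rightarrow> bool" where
  "is_subring R \<longleftrightarrow> 1 \<in> R \<and> (\<forall>x\<in>R. \<forall>y\<in>R. x - y \<in> R \<and> x * y \<in> R)"

lemma subring_closed:
  assumes "is_subring R"
  shows subring_one: "1 \<in> R" and subring_zero: "0 \<in> R"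
    and subring_diff: "x \<in> R \<Longrightarrow> y \<in> R \<Longrightarrow> x - y \<in> R"
    and subring_mult: "x \<in> R \<Longrightarrow> y \<in> R \<Longrightarrow> x * y \<in> R"
    and subring_uminus: "x \<in> R \<Longrightarrow> - x \<in> R"
    and subring_add: "x \<in> R \<Longrightarrow> y \<in> R \<Longrightarrow> x + y \<in> R"
proof -
  show 1: "1 \<in> R" and d: "x \<in> R \<Longrightarrow> y \<in> R \<Longrightarrow> x - y \<in> R"
    and "x \<in> R \<Longrightarrow> y \<in> R \<Longrightarrow> x * y \<in> R" for x y
    using assms by (auto simp: is_subring_def)
  show 0: "0 \<in> R" using d[OF 1 1] by simp
  show m: "x \<in> R \<Longrightarrow> - x \<in> R" for x using d[OF 0, of x] by simp
  show "x \<in> R \<Longrightarrow> y \<in> R \<Longrightarrow> x + y \<in> R" for x y using d[OF _ m, of x y] by simp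
qed

lemma subring_power: "is_subring R \<Longrightarrow> x \<in> R \<Longrightarrow> x ^ n \<in> R"
  by (induction n) (auto intro: subring_closed)

lemma subring_sum: "is_subring R \<Longrightarrow> (\<And>i. i \<in> I \<Longrightarrow> f i \<in> R) \<Longrightarrow> sum f I \<in> R"
  by (induction I rule: infinite_finite_induct) (auto intro: subring_closed)

lemma subring_prod: "is_subring R \<Longrightarrow> (\<And>i. i \<in> I \<Longrightarrow> f i \<in> R) \<Longrightarrow> prod f I \<in> R"
  by (induction I rule: infinite_finite_induct) (auto intro: subring_closed)

lemma subring_of_nat: "is_subring R \<Longrightarrow> of_nat n \<in> R"
  by (induction n) (auto intro: subring_closed)

lemma subring_of_int: "is_subring R \<Longrightarrow> of_int n \<in> R"
  by (cases n) (auto intro: subring_closed subring_of_nat simp del: of_nat_Suc)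

lemma subring_poly:
  "is_subring R \<Longrightarrow> (\<And>i. coeff p i \<in> R) \<Longrightarrow> x \<in> R \<Longrightarrow> poly p x \<in> R"
  by (auto simp: poly_altdef intro!: subring_sum subring_mult subring_power)

lemma subring_Union_chain:
  assumes "C \<noteq> {}" and sub: "\<And>X. X \<in> C \<Longrightarrow> is_subring X"
    and ch: "\<And>X Y. X \<in> C \<Longrightarrow> Y \<in> C \<Longrightarrow> X \<subseteq> Y \<or> Y \<subseteq> X"
  shows "is_subring (\<Union>C)"
  unfolding is_subring_def
proof (intro conjI ballI)
  show "1 \<in> \<Union>C" using assms(1) sub by (auto simp: subring_one)
next
  fix x y assume "x \<in> \<Union>C" "y \<in> \<Union>C"
  then obtain X Y where "X \<in> C" "Y \<in> C" "x \<in> X" "y \<in> Y" by auto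
  then obtain Z where Z: "Z \<in> C" "x \<in> Z" "y \<in> Z" using ch[of X Y] by auto
  show "x - y \<in> \<Union>C" "x * y \<in> \<Union>C"
    using Z sub by (auto intro: subring_diff subring_mult)
qed

lemma is_subfield_iff: "is_subfield F \<longleftrightarrow> is_subring F \<and> (\<forall>x\<in>F. inverse x \<in> F)"
  by (auto simp: is_subfield_def is_subring_def)

lemma subfield_subring: "is_subfield F \<Longrightarrow> is_subring F"
  by (simp add: is_subfield_iff)

lemma subfield_inverse: "is_subfield F \<Longrightarrow> x \<in> F \<Longrightarrow> inverse x \<in> F"
  by (simp add: is_subfield_iff)

lemma subfield_divide: "is_subfield F \<Longrightarrow> x \<in> F \<Longrightarrow> y \<in> F \<Longrightarrow> x / y \<in> F"
  unfolding divide_inverse by (auto simp: is_subfield_iff intro: subring_mult)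

lemma subfield_powi: "is_subfield F \<Longrightarrow> x \<in> F \<Longrightarrow> x powi n \<in> F"
  by (auto simp: power_int_def subfield_subring intro!: subring_power subfield_inverse)

lemma subfield_of_rat:
  assumes "is_subfield (F :: 'a::field_char_0 set)" shows "of_rat q \<in> F"
proof -
  obtain a b where "q = of_int a / of_int b" by (metis Rat.of_int_def quotient_of_div surj_pair)
  thus ?thesis
    by (auto simp: of_rat_divide intro!: subfield_divide assms subring_of_int subfield_subring)
qed

lemma is_subfield_UNIV [simp]: "is_subfield UNIV"
  by (simp add: is_subfield_def)

section \<open>Valuation rings\<close>

text \<open>Valuation rings in the general sense, given by the dichotomy alone: the complex numbers
  contain all roots of their elements, so a nontrivial valuation on them is never discrete. The
  trivial case \<open>W = F\<close> is allowed.\<close>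

definition valring :: "'a::field set \<Rightarrow> 'a set \<Rightarrow> bool" where
  "valring F W \<longleftrightarrow> is_subfield F \<and> is_subring W \<and> W \<subseteq> F \<and> (\<forall>x\<in>F. x \<in> W \<or> inverse x \<in> W)"

definition valmax :: "'a::field set \<Rightarrow> 'a set" where
  "valmax W = {x \<in> W. x = 0 \<or> inverse x \<notin> W}"

lemma valringD:
  assumes "valring F W"
  shows valring_subfield: "is_subfield F" and valring_subring: "is_subring W"
    and valring_subset: "x \<in> W \<Longrightarrow> x \<in> F"
  using assms by (auto simp: valring_def)

lemma one_notin_valmax: "is_subring W \<Longrightarrow> 1 \<notin> valmax W"
  by (simp add: valmax_def subring_one)

lemma valmax_mult:
  assumes "is_subring W" "x \<in> valmax W" "r \<in> W"
  shows "r * x \<in> valmax W"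
proof -
  have "inverse x \<in> W" if "inverse (r * x) \<in> W" "r \<noteq> 0"
    using subring_mult[OF assms(1,3) that(1)] that(2) by (simp add: field_simps)
  thus ?thesis using assms by (auto simp: valmax_def subring_mult)
qed

text \<open>One of \<open>x / y\<close> and \<open>y / x\<close> lies in \<open>W\<close>, so the
  sum is a multiple in \<open>W\<close> of one of the summands.\<close>

lemma valmax_add:
  assumes W: "valring F W" and x: "x \<in> valmax W" and y: "y \<in> valmax W"
  shows "x + y \<in> valmax W"
proof -
  note sub = valring_subring[OF W]
  have *: "x + y \<in> valmax W"
    if x: "x \<in> valmax W" and y: "y \<in> valmax W" and q: "x / y \<in> W" and "y \<noteq> 0" for x y
  proof -
    have "(1 + x / y) * y \<in> valmax W"
      using sub q y by (intro valmax_mult subring_add subring_one)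
    moreover have "(1 + x / y) * y = x + y" using \<open>y \<noteq> 0\<close> by (simp add: field_simps)
    ultimately show ?thesis by simp
  qed
  show ?thesis
  proof (cases "x = 0 \<or> y = 0")
    case False
    have "x / y \<in> F" using x y W by (auto simp: valmax_def valring_def intro: subfield_divide)
    hence "x / y \<in> W \<or> y / x \<in> W" using W by (force simp: valring_def)
    thus ?thesis using *[OF x y] *[OF y x] False by (auto simp: add.commute)
  qed (use x y in auto)
qed

lemma valmax_uminus: "is_subring W \<Longrightarrow> x \<in> valmax W \<Longrightarrow> - x \<in> valmax W"
  using valmax_mult[of W x "-1"] subring_uminus[OF _ subring_one, of W] by simp

lemma zero_in_valmax: "is_subring W \<Longrightarrow> 0 \<in> valmax W"
  by (simp add: valmax_def subring_zero)

lemma valmax_sum: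
  "valring F W \<Longrightarrow> (\<And>i. i \<in> I \<Longrightarrow> f i \<in> valmax W) \<Longrightarrow> sum f I \<in> valmax W"
  by (induction I rule: infinite_finite_induct)
     (auto intro: valmax_add zero_in_valmax valring_subring)

text \<open>Divisibility by elements of \<open>W\<close> is a total preorder, so a finite family of
  nonzero elements has a member \<open>s k\<close> of largest absolute value.\<close>

lemma valring_maximal_element:
  assumes W: "valring F W" and "finite I" "I \<noteq> {}" "\<And>i. i \<in> I \<Longrightarrow> s i \<in> F - {0}"
  shows "\<exists>k\<in>I. \<forall>i\<in>I. s i / s k \<in> W"
  using assms(2-)
proof (induction I rule: finite_ne_induct)
  case (singleton x)
  thus ?case using valring_subring[OF W] by (auto simp: subring_one)
next
  case (insert x I)
  then obtain k where k: "k \<in> I" "\<And>i. i \<in> I \<Longrightarrow> s i / s k \<in> W" by auto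
  have nz: "s k \<noteq> 0" "s x \<noteq> 0" using insert.prems k(1) by auto
  have "s x / s k \<in> F"
    using insert.prems k(1) valring_subfield[OF W] by (intro subfield_divide) auto
  then consider "s x / s k \<in> W" | "s k / s x \<in> W" using W by (force simp: valring_def)
  thus ?case
  proof cases
    case 1
    thus ?thesis using k by auto
  next
    case 2
    have "s i / s x \<in> W" if "i \<in> I" for i
      using subring_mult[OF valring_subring[OF W] k(2)[OF that] 2] nz by simp
    moreover have "s x / s x \<in> W" using nz valring_subring[OF W] by (simp add: subring_one)
    ultimately show ?thesis by auto
  qed
qed

text \<open>The ultrametric principle that a vanishing sum has no isolated largest term: otherwise
  division by that term would exhibit -1 as a sum of elements of the maximal ideal.\<close>

lemma valring_tie:
  assumes W: "valring F W" and fin: "finite I" and s: "\<And>i. i \<in> I \<Longrightarrow> s i \<in> F"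
    and sum: "sum s I = 0" and ex: "j \<in> I" "s j \<noteq> 0"
  shows "\<exists>i\<in>I. \<exists>k\<in>I. i \<noteq> k \<and> s i \<noteq> 0 \<and> s k \<noteq> 0 \<and> s i / s k \<in> W \<and> s k / s i \<in> W"
proof -
  define J where "J = {i \<in> I. s i \<noteq> 0}"
  have J: "finite J" "J \<noteq> {}" "\<And>i. i \<in> J \<Longrightarrow> s i \<in> F - {0}"
    using fin s ex by (auto simp: J_def)
  obtain k where k: "k \<in> J" "\<And>i. i \<in> J \<Longrightarrow> s i / s k \<in> W"
    using valring_maximal_element[OF W J(1,2), of s] J(3) by blast
  have "\<exists>i\<in>J - {k}. s i / s k \<notin> valmax W"
  proof (rule ccontr)
    assume "\<not> ?thesis"
    hence m: "(\<Sum>i\<in>J-{k}. s i / s k) \<in> valmax W"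
      by (intro valmax_sum[OF W]) auto
    have "sum s J = sum s I" using fin by (intro sum.mono_neutral_left) (auto simp: J_def)
    hence "sum s J = 0" using sum by simp
    moreover have "sum s J = s k + sum s (J - {k})" using J k by (simp add: sum.remove)
    ultimately have "(\<Sum>i\<in>J-{k}. s i / s k) = - 1"
      using k(1) J(3)[of k] by (simp add: sum_divide_distrib[symmetric] field_simps add_eq_0_iff)
    hence "- (- 1) \<in> valmax W" using m valmax_uminus[OF valring_subring[OF W]] by metis
    thus False using one_notin_valmax[OF valring_subring[OF W]] by simp
  qed
  thus ?thesis using k by (force simp: J_def valmax_def)
qed

text \<open>If \<open>x\<close> is not in \<open>W\<close>, then \<open>inverse x\<close> is, and
  multiplying the equation by \<open>inverse x ^ (n - 1)\<close> leaves only nonnegative powers of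
  \<open>inverse x\<close> beside the leading term. The leading coefficient is thus a denominator
  for \<open>x\<close> in all valuation rings simultaneously.\<close>

lemma valring_lead_mult:
  assumes W: "valring F W" and x: "x \<in> F" and p: "\<And>i. coeff p i \<in> W" "poly p x = 0"
  shows "lead_coeff p * x \<in> W"
proof (cases "x \<in> W")
  case True
  thus ?thesis using p W by (auto intro: subring_mult valring_subring)
next
  case False
  note sub = valring_subring[OF W]
  define n where "n = degree p"
  have xi: "inverse x \<in> W" using False W x by (auto simp: valring_def)
  have x0: "x \<noteq> 0" using False subring_zero[OF sub] by auto
  show ?thesis
  proof (cases "n = 0")
    case True
    then obtain c where "p = [:c:]" by (auto simp: n_def elim: degree_eq_zeroE)
    thus ?thesis using sub p(2) by (simp add: subring_zero)
  next
    case n: False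
    have "0 = (\<Sum>i\<le>n. coeff p i * x ^ i)" using p(2) by (simp add: poly_altdef n_def)
    also have "\<dots> = coeff p n * x ^ n + (\<Sum>i<n. coeff p i * x ^ i)"
      by (simp add: lessThan_Suc_atMost[symmetric])
    finally have e: "coeff p n * x ^ n = - (\<Sum>i<n. coeff p i * x ^ i)" by (simp add: eq_neg_iff_add_eq_0)
    have "coeff p n * x = coeff p n * x ^ n * inverse x ^ (n - 1)"
      using x0 n by (cases n) (auto simp: field_simps)
    also have "\<dots> = - (\<Sum>i<n. coeff p i * (x ^ i * inverse x ^ (n - 1)))"
      by (simp add: e sum_distrib_right mult.assoc)
    also have "\<dots> = - (\<Sum>i<n. coeff p i * inverse x ^ (n - 1 - i))"
    proof -
      have "x ^ i * inverse x ^ (n - 1) = inverse x ^ (n - 1 - i)" if "i < n" for i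
      proof -
        have "inverse x ^ (n - 1) = inverse x ^ i * inverse x ^ (n - 1 - i)"
          using that by (simp flip: power_add)
        thus ?thesis using x0 by (simp add: field_simps)
      qed
      thus ?thesis by (intro arg_cong[of _ _ uminus] sum.cong) auto
    qed
    also have "\<dots> \<in> W"
      by (intro subring_uminus[OF sub] subring_sum[OF sub] subring_mult[OF sub] subring_power[OF sub] xi p)
    finally show ?thesis by (simp add: n_def)
  qed
qed

text \<open>A case of integral closedness: \<open>x\<close> is the product of \<open>x ^ n\<close>
  and \<open>inverse x ^ (n - 1)\<close>.\<close>

lemma valring_power_iff:
  assumes W: "valring F W" and x: "x \<in> F" and n: "n > 0"
  shows "x ^ n \<in> W \<longleftrightarrow> x \<in> W"
proof
  assume h: "x ^ n \<in> W"
  show "x \<in> W"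
  proof (rule ccontr)
    assume "x \<notin> W"
    hence i: "inverse x \<in> W" and "x \<noteq> 0"
      using W x subring_zero[OF valring_subring[OF W]] by (auto simp: valring_def)
    have "x ^ n * inverse x ^ (n - 1) \<in> W"
      using h by (rule subring_mult[OF valring_subring[OF W]]) (intro subring_power valring_subring[OF W] i)
    moreover have "x ^ n * inverse x ^ (n - 1) = x"
    proof -
      obtain k where "n = Suc k" using n by (cases n) auto
      thus ?thesis using \<open>x \<noteq> 0\<close> by (simp add: power_inverse)
    qed
    ultimately show False using \<open>x \<notin> W\<close> by simp
  qed
qed (use W in \<open>auto intro: subring_power valring_subring\<close>)

section \<open>A valuation ring above every prime\<close>

text \<open>A form of Chevalley's extension theorem: a subring that contains \<open>R0\<close> and
  is maximal among those avoiding \<open>inverse p\<close> is a valuation ring.\<close>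

lemma valring_exists:
  fixes p :: "'a::field"
  assumes R0: "is_subring R0" and p: "p \<in> R0" "inverse p \<notin> R0"
  shows "\<exists>W. valring UNIV W \<and> R0 \<subseteq> W \<and> inverse p \<notin> W"
proof -
  define A where "A = {R. is_subring R \<and> R0 \<subseteq> R \<and> inverse p \<notin> R}"
  have "\<Union>C \<in> A" if "C \<noteq> {}" "subset.chain A C" for C
  proof -
    have CA: "C \<subseteq> A" and ch: "\<And>X Y. X \<in> C \<Longrightarrow> Y \<in> C \<Longrightarrow> X \<subseteq> Y \<or> Y \<subseteq> X"
      using that(2) unfolding subset_chain_def by blast+
    have "is_subring (\<Union>C)"
      using CA ch that(1) by (intro subring_Union_chain) (auto simp: A_def)
    thus ?thesis using that(1) CA by (auto simp: A_def)
  qed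
  moreover have "A \<noteq> {}" using R0 p by (auto simp: A_def)
  ultimately obtain W where W: "W \<in> A" and max: "\<And>X. X \<in> A \<Longrightarrow> W \<subseteq> X \<Longrightarrow> X = W"
    using subset_Zorn_nonempty[of A] by blast
  have sub: "is_subring W" and RW: "R0 \<subseteq> W" and ip: "inverse p \<notin> W" using W by (auto simp: A_def)
  have pW: "p \<in> W" using p RW by auto
  have p0: "p \<noteq> 0" using ip subring_zero[OF sub] by auto
  define ext where "ext x = {poly q x | q. \<forall>i. coeff q i \<in> W}" for x
  have ext: "is_subring (ext x)" "W \<subseteq> ext x" "x \<in> ext x" for x
  proof -
    have d: "poly q x - poly r x \<in> ext x \<and> poly q x * poly r x \<in> ext x"
      if "\<forall>i. coeff q i \<in> W" "\<forall>i. coeff r i \<in> W" for q r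
    proof -
      have "\<forall>i. coeff (q - r) i \<in> W" "\<forall>i. coeff (q * r) i \<in> W"
        using that sub by (auto simp: coeff_mult intro!: subring_sum subring_closed)
      thus ?thesis by (auto simp: ext_def simp flip: poly_diff poly_mult)
    qed
    have c: "c \<in> ext x" if "c \<in> W" for c
      using that sub by (auto simp: ext_def coeff_pCons subring_zero split: nat.splits intro!: exI[of _ "[:c:]"])
    show "is_subring (ext x)"
      using d c[of 1] sub by (auto simp: is_subring_def ext_def)
    show "W \<subseteq> ext x" using c by auto
    show "x \<in> ext x"
      using sub by (auto simp: ext_def coeff_pCons subring_zero subring_one split: nat.splits intro!: exI[of _ "[:0, 1:]"])
  qed
  have ext': "inverse p \<in> ext x" if "x \<notin> W" for x
    using max[of "ext x"] ext[of x] that RW by (auto simp: A_def)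
  \<comment> \<open>If \<open>u = 1 - p * b\<close> were not a unit, \<open>inverse p\<close> would
    be a polynomial in \<open>inverse u\<close> over \<open>W\<close>. Clearing denominators puts
    \<open>u ^ k * inverse p\<close> into \<open>W\<close>, and \<open>u ^ k\<close> is 1 modulo
    \<open>p\<close>, so \<open>inverse p\<close> itself would lie in \<open>W\<close>.\<close>
  have unit: "inverse (1 - p * b) \<in> W" if b: "b \<in> W" for b
  proof (rule ccontr)
    define u where "u = 1 - p * b"
    assume "inverse (1 - p * b) \<notin> W"
    hence iu: "inverse u \<notin> W" by (simp add: u_def)
    hence u0: "u \<noteq> 0" using subring_zero[OF sub] by auto
    have uW: "u \<in> W" using b pW sub by (auto simp: u_def intro: subring_closed)
    have "inverse p \<in> ext (inverse u)" using ext' iu by blast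
    then obtain q where q: "\<forall>i. coeff q i \<in> W" "inverse p = poly q (inverse u)" by (auto simp: ext_def)
    define k where "k = degree q"
    have "u ^ k * inverse p = (\<Sum>i\<le>k. coeff q i * (u ^ k * inverse u ^ i))"
      by (simp add: q(2) poly_altdef k_def sum_distrib_left mult_ac)
    also have "\<dots> = (\<Sum>i\<le>k. coeff q i * u ^ (k - i))"
    proof (intro sum.cong refl)
      fix i assume "i \<in> {..k}"
      hence "u ^ k = u ^ (k - i) * u ^ i" by (simp flip: power_add)
      thus "coeff q i * (u ^ k * inverse u ^ i) = coeff q i * u ^ (k - i)"
        using u0 by (simp add: field_simps)
    qed
    also have "\<dots> \<in> W" using sub q uW by (intro subring_sum subring_mult subring_power) auto
    finally have 1: "u ^ k * inverse p \<in> W" .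
    have "(u ^ k - 1) * inverse p \<in> W" for k
    proof (induction k)
      case (Suc k)
      have "(u ^ Suc k - 1) * inverse p = u * ((u ^ k - 1) * inverse p) - b"
        using p0 by (simp add: u_def field_simps)
      thus ?case using Suc sub uW b by (auto intro: subring_closed)
    qed (use sub in \<open>auto simp: subring_zero\<close>)
    hence "u ^ k * inverse p - (u ^ k - 1) * inverse p \<in> W" using sub 1 by (auto intro: subring_diff)
    thus False using ip by (simp add: algebra_simps)
  qed
  text \<open>If neither \<open>x\<close> nor \<open>inverse x\<close> is in \<open>W\<close>, then by maximality \<open>1\<close> is \<open>p\<close> times a polynomial in
    \<open>x\<close> over \<open>W\<close>, and also \<open>p\<close> times one in \<open>inverse x\<close>. The relation of smaller degree can be used
    to lower the degree of the other one, so that not both degrees can be minimal.\<close>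
  define rel where "rel x n \<longleftrightarrow> (\<exists>a. (\<forall>i. a i \<in> W) \<and> 1 = p * (\<Sum>i\<le>n. a i * x ^ i))" for x n
  have relI: "\<exists>n. rel x n" if x: "x \<notin> W" for x
  proof -
    obtain q where q: "\<forall>i. coeff q i \<in> W" "inverse p = poly q x" using ext'[OF x] by (auto simp: ext_def)
    have "1 = p * (\<Sum>i\<le>degree q. coeff q i * x ^ i)"
      using q(2) p0 by (simp add: poly_altdef[symmetric] field_simps)
    thus ?thesis using q(1) by (auto simp: rel_def)
  qed
  have lower: "\<exists>n'<n. rel x n'"
    if r: "rel x n" "rel (inverse x) m" and mn: "m \<le> n" and x: "x \<notin> W" for x n m
  proof -
    have x0: "x \<noteq> 0" using x subring_zero[OF sub] by auto
    obtain a where a: "\<And>i. a i \<in> W" "1 = p * (\<Sum>i\<le>n. a i * x ^ i)" using r(1) by (auto simp: rel_def)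
    obtain b where b: "\<And>i. b i \<in> W" "1 = p * (\<Sum>i\<le>m. b i * inverse x ^ i)" using r(2) by (auto simp: rel_def)
    have n0: "n > 0"
    proof (rule ccontr)
      assume "\<not> n > 0"
      hence "inverse p = a 0" using a(2) p0 by (simp add: field_simps)
      thus False using a(1) ip by metis
    qed
    \<comment> \<open>The constant term of the relation for \<open>inverse x\<close> moves to the
      left, where \<open>1 - p * b 0\<close> is invertible in \<open>W\<close>. Multiplied by
      \<open>w * x ^ n\<close>, the relation expresses \<open>x ^ n\<close> by lower powers of
      \<open>x\<close>, since \<open>m \<le> n\<close>.\<close>
    define w where "w = inverse (1 - p * b 0)"
    have w: "w \<in> W" using unit b by (simp add: w_def)
    have m0: "m > 0"
    proof (rule ccontr)
      assume "\<not> m > 0"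
      hence "inverse p = b 0" using b(2) p0 by (simp add: field_simps)
      thus False using b(1) ip by metis
    qed
    have split: "{..m} = insert 0 {1..m}" by auto
    have e1: "1 - p * b 0 = p * (\<Sum>i=1..m. b i * inverse x ^ i)"
      using b(2) by (simp add: split algebra_simps)
    have nz: "1 - p * b 0 \<noteq> 0"
    proof
      assume "1 - p * b 0 = 0"
      hence "inverse p = b 0" using p0 by (simp add: field_simps)
      thus False using b(1) ip by metis
    qed
    have xn: "x ^ n = p * (\<Sum>i=1..m. w * b i * x ^ (n - i))"
    proof -
      have "x ^ n = w * (1 - p * b 0) * x ^ n" using nz by (simp add: w_def)
      also have "\<dots> = p * (\<Sum>i=1..m. w * b i * (inverse x ^ i * x ^ n))"
        by (simp add: e1 sum_distrib_left sum_distrib_right mult_ac)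
      also have "(\<Sum>i=1..m. w * b i * (inverse x ^ i * x ^ n)) = (\<Sum>i=1..m. w * b i * x ^ (n - i))"
      proof (intro sum.cong refl)
        fix i assume "i \<in> {1..m}"
        hence "x ^ n = x ^ (n - i) * x ^ i" using mn by (simp flip: power_add)
        thus "w * b i * (inverse x ^ i * x ^ n) = w * b i * x ^ (n - i)"
          using x0 by (simp add: field_simps)
      qed
      finally show ?thesis .
    qed
    \<comment> \<open>Reindexing by \<open>j = n - i\<close>. The coefficients are zero below
      \<open>n - m\<close>, so the sum may run over all exponents below \<open>n\<close>.\<close>
    define c where "c j = (if n - j \<in> {1..m} \<and> j < n then w * b (n - j) else 0)" for j
    have cs: "(\<Sum>i=1..m. w * b i * x ^ (n - i)) = (\<Sum>j\<le>n-1. c j * x ^ j)"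
    proof -
      have "(\<Sum>i=1..m. w * b i * x ^ (n - i)) = (\<Sum>j\<in>{n-m..n-1}. w * b (n - j) * x ^ j)"
        using mn n0 m0
        by (intro sum.reindex_bij_witness[of _ "\<lambda>j. n - j" "\<lambda>j. n - j"]) auto
      also have "\<dots> = (\<Sum>j\<in>{n-m..n-1}. c j * x ^ j)"
        using mn n0 m0 by (intro sum.cong) (auto simp: c_def)
      also have "\<dots> = (\<Sum>j\<le>n-1. c j * x ^ j)"
        using mn by (intro sum.mono_neutral_left) (auto simp: c_def)
      finally show ?thesis .
    qed
    have xn': "x ^ n = p * (\<Sum>j\<le>n-1. c j * x ^ j)" using xn unfolding cs .
    have "1 = p * (a n * x ^ n + (\<Sum>i\<le>n-1. a i * x ^ i))"
      using a(2) n0 by (cases n) (auto simp: add.commute)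
    also have "\<dots> = p * (\<Sum>j\<le>n-1. (a n * p * c j + a j) * x ^ j)"
      by (simp add: xn' ring_distribs sum.distrib sum_distrib_left mult_ac)
    finally have "1 = p * (\<Sum>j\<le>n-1. (a n * p * c j + a j) * x ^ j)" .
    moreover have "a n * p * c j + a j \<in> W" for j
      using a(1) b(1) w pW sub by (auto simp: c_def intro!: subring_closed)
    ultimately have "rel x (n - 1)"
      unfolding rel_def by (intro exI[of _ "\<lambda>j. a n * p * c j + a j"] conjI allI)
    thus ?thesis using n0 by (intro exI[of _ "n-1"]) auto
  qed
  have "x \<in> W \<or> inverse x \<in> W" for x
  proof (rule ccontr)
    assume "\<not> ?thesis"
    hence x: "x \<notin> W" "inverse x \<notin> W" by auto
    define n where "n = (LEAST n. rel x n)"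
    define m where "m = (LEAST n. rel (inverse x) n)"
    have n: "rel x n" "\<And>k. rel x k \<Longrightarrow> n \<le> k"
      using relI[OF x(1)] by (auto simp: n_def intro: LeastI_ex Least_le)
    have m: "rel (inverse x) m" "\<And>k. rel (inverse x) k \<Longrightarrow> m \<le> k"
      using relI[OF x(2)] by (auto simp: m_def intro: LeastI_ex Least_le)
    show False
    proof (cases "m \<le> n")
      case True
      thus False using lower[OF n(1) m(1) True x(1)] n(2) by force
    next
      case False
      thus False using lower[of "inverse x" m n] n m x by force
    qed
  qed
  hence "valring UNIV W" using sub by (auto simp: valring_def)
  thus ?thesis using RW ip by auto
qed

lemma valring_above_prime:
  assumes "prime (p::int)"
  shows "\<exists>W. valring (UNIV :: complex set) W \<and> inverse (of_int p) \<notin> W"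
proof -
  have "is_subring (\<int> :: complex set)" by (auto simp: is_subring_def)
  moreover have "inverse (of_int p :: complex) \<notin> \<int>"
  proof
    assume "inverse (of_int p :: complex) \<in> \<int>"
    then obtain k where "inverse (of_int p :: complex) = of_int k" by (auto elim: Ints_cases)
    moreover have "p \<noteq> 0" using assms by auto
    ultimately have "of_int (p * k) = (1 :: complex)" by (simp add: field_simps)
    hence "p * k = 1" by (metis of_int_eq_1_iff)
    hence "is_unit p" by (metis dvd_triv_left)
    thus False using assms not_prime_unit by blast
  qed
  ultimately show ?thesis using valring_exists[of \<int> "of_int p"] by auto
qed

section \<open>Linear relations over the rationals\<close>

global_interpretation ratvs: vector_space "\<lambda>(q::rat) (x::complex). of_rat q * x"
  by unfold_locales (simp_all add: algebra_simps of_rat_add of_rat_mult)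

text \<open>Dependence is a notion for sets, so a repeated value in the sequence needs a relation of
  its own.\<close>

lemma rat_relation:
  fixes u :: "nat \<Rightarrow> complex"
  assumes B: "finite B" and u: "\<And>i. i \<le> card B \<Longrightarrow> u i \<in> ratvs.span B"
  shows "\<exists>c::nat \<Rightarrow> rat. (\<exists>i\<le>card B. c i \<noteq> 0) \<and> (\<Sum>i\<le>card B. of_rat (c i) * u i) = 0"
proof (cases "inj_on u {..card B}")
  case False
  then obtain i j where ij: "i \<le> card B" "j \<le> card B" "i \<noteq> j" "u i = u j"
    by (auto simp: inj_on_def)
  define c where "c k = (if k = i then 1 else if k = j then -1 else (0::rat))" for k
  have "(\<Sum>k\<le>card B. of_rat (c k) * u k) = (\<Sum>k\<in>{i,j}. of_rat (c k) * u k)"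
    using ij by (intro sum.mono_neutral_right) (auto simp: c_def)
  also have "\<dots> = 0" using ij by (simp add: c_def)
  finally show ?thesis using ij by (intro exI[of _ c]) (auto simp: c_def)
next
  case True
  have "ratvs.dependent (u ` {..card B})"
  proof (rule ccontr)
    assume "\<not> ?thesis"
    hence "card (u ` {..card B}) \<le> card B"
      using ratvs.independent_span_bound[OF B, of "u ` {..card B}"] u by auto
    thus False using card_image[OF True] by simp
  qed
  then obtain t r where t: "finite t" "t \<subseteq> u ` {..card B}" "(\<Sum>v\<in>t. of_rat (r v) * v) = 0" "\<exists>v\<in>t. r v \<noteq> 0"
    unfolding ratvs.dependent_explicit by auto
  define c where "c k = (if u k \<in> t then r (u k) else 0)" for k
  have "(\<Sum>k\<le>card B. of_rat (c k) * u k) = (\<Sum>v\<in>u ` {..card B}. of_rat (if v \<in> t then r v else 0) * v)"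
    unfolding c_def by (subst sum.reindex[OF True]) simp
  also have "\<dots> = (\<Sum>v\<in>t. of_rat (r v) * v)"
    using t(2) by (intro sum.mono_neutral_cong_right) auto
  also have "\<dots> = 0" by (rule t(3))
  finally show ?thesis using t(2,4) by (intro exI[of _ c]) (force simp: c_def)
qed

lemma rat_common_denominator:
  fixes c :: "'a \<Rightarrow> rat"
  assumes "finite I"
  shows "\<exists>D::int. D > 0 \<and> (\<forall>i\<in>I. of_int D * c i \<in> \<int>)"
  using assms
proof (induction I rule: finite_induct)
  case (insert x I)
  then obtain D :: int where D: "D > 0" "\<forall>i\<in>I. of_int D * c i \<in> \<int>" by auto
  obtain a b where ab: "c x = of_int a / of_int b" "b > 0"
    by (metis quotient_of_div quotient_of_denom_pos surj_pair)
  have "of_int (D * b) * c i \<in> \<int>" if "i \<in> I" for i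
  proof -
    have "of_int b * (of_int D * c i) \<in> \<int>" using D(2) that Ints_mult[OF Ints_of_int] by blast
    thus ?thesis by (simp add: mult_ac)
  qed
  moreover have "of_int (D * b) * c x = of_int (D * a)" using ab by simp
  hence "of_int (D * b) * c x \<in> \<int>" by (metis Ints_of_int)
  ultimately show ?case using D ab by (intro exI[of _ "D * b"]) auto
qed (auto intro: exI[of _ 1])

text \<open>Division by the gcd makes the relation primitive, so that it stays nontrivial modulo
  every prime.\<close>

lemma int_relation:
  fixes u :: "nat \<Rightarrow> complex"
  assumes B: "finite B" and u: "\<And>i. i \<le> card B \<Longrightarrow> u i \<in> ratvs.span B"
  shows "\<exists>c::nat \<Rightarrow> int. Gcd (c ` {..card B}) = 1 \<and> (\<Sum>i\<le>card B. of_int (c i) * u i) = 0"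
proof -
  obtain r where r: "\<exists>i\<le>card B. r i \<noteq> 0" "(\<Sum>i\<le>card B. of_rat (r i) * u i) = 0"
    using rat_relation[OF B, of u] u by blast
  obtain D :: int where D: "D > 0" "\<forall>i\<in>{..card B}. of_int D * r i \<in> \<int>"
    using rat_common_denominator[of "{..card B}" r] by auto
  define c where "c i = \<lfloor>of_int D * r i\<rfloor>" for i
  have c: "of_int (c i) = of_int D * r i" if "i \<le> card B" for i
    using D that by (auto simp: c_def elim: Ints_cases)
  define g where "g = Gcd (c ` {..card B})"
  have "\<exists>i\<le>card B. c i \<noteq> 0"
  proof -
    obtain i where i: "i \<le> card B" "r i \<noteq> 0" using r by auto
    hence "of_int (c i) \<noteq> (0::rat)" using D(1) by (simp add: c)
    thus ?thesis using i by auto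
  qed
  hence g0: "g \<noteq> 0" by (auto simp: g_def Gcd_0_iff)
  have gd: "g dvd c i" if "i \<le> card B" for i using that by (auto simp: g_def intro: Gcd_dvd)
  define e where "e i = c i div g" for i
  have ce: "c i = g * e i" if "i \<le> card B" for i using gd[OF that] by (simp add: e_def)
  have "g = Gcd ((\<lambda>x. g * x) ` (e ` {..card B}))"
    unfolding g_def by (subst image_image) (intro arg_cong[of _ _ Gcd] image_cong refl, use ce g_def in auto)
  also have "\<dots> = normalize (g * Gcd (e ` {..card B}))" by (rule Gcd_mult)
  finally have "g = \<bar>g\<bar> * Gcd (e ` {..card B})" by (simp add: abs_mult)
  moreover have "\<bar>g\<bar> = g" by (simp add: g_def)
  ultimately have 1: "Gcd (e ` {..card B}) = 1" using g0 by simp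
  have "of_int g * (\<Sum>i\<le>card B. of_int (e i) * u i) = (\<Sum>i\<le>card B. of_int (c i) * u i)"
    by (simp add: sum_distrib_left ce mult.assoc)
  also have "\<dots> = (\<Sum>i\<le>card B. of_rat (of_int (c i)) * u i)" by simp
  also have "\<dots> = (\<Sum>i\<le>card B. of_rat (of_int D) * (of_rat (r i) * u i))"
    by (intro sum.cong refl) (simp add: c of_rat_mult del: of_rat_of_int_eq)
  also have "\<dots> = 0" by (simp only: sum_distrib_left[symmetric] r(2) mult_zero_right)
  finally have "(\<Sum>i\<le>card B. of_int (e i) * u i) = 0" using g0 by simp
  thus ?thesis using 1 by blast
qed

lemma int_relation_prime:
  fixes u :: "nat \<Rightarrow> complex" and p :: int
  assumes B: "finite B" and u: "\<And>i. i \<le> card B \<Longrightarrow> u i \<in> ratvs.span B" and p: "prime p"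
  shows "\<exists>c::nat \<Rightarrow> int. (\<exists>i\<le>card B. \<not> p dvd c i) \<and> (\<Sum>i\<le>card B. of_int (c i) * u i) = 0"
proof -
  obtain c where c: "Gcd (c ` {..card B}) = 1" "(\<Sum>i\<le>card B. of_int (c i) * u i) = 0"
    using int_relation[OF B, of u] u by blast
  have "\<exists>i\<le>card B. \<not> p dvd c i"
  proof (rule ccontr)
    assume "\<not> ?thesis"
    hence "p dvd Gcd (c ` {..card B})" by (intro Gcd_greatest) auto
    thus False using c(1) p by (simp add: not_prime_unit)
  qed
  thus ?thesis using c by auto
qed

lemma algebraic_int_polyI:
  fixes c :: "nat \<Rightarrow> int"
  assumes "i \<le> n" "c i \<noteq> 0" "(\<Sum>i\<le>n. of_int (c i) * z ^ i) = (0::complex)"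
  shows "algebraic z"
proof (rule algebraicI[of "\<Sum>i\<le>n. monom (of_int (c i)) i"])
  define p :: "complex poly" where "p = (\<Sum>i\<le>n. monom (of_int (c i)) i)"
  have co: "coeff p k = (if k \<le> n then of_int (c k) else 0)" for k
    by (simp add: p_def coeff_sum)
  show "coeff p k \<in> \<int>" for k by (simp add: co)
  show "p \<noteq> 0" using co[of i] assms by auto
  show "poly p z = 0" using assms(3) by (simp add: p_def poly_sum poly_monom)
qed

text \<open>Multiplication by \<open>z\<close> preserves a finite-dimensional space that contains 1,
  so all powers of \<open>z\<close> lie in it and are dependent.\<close>

lemma algebraic_if_span_closed:
  assumes "finite B" "1 \<in> ratvs.span B" "\<And>x. x \<in> ratvs.span B \<Longrightarrow> z * x \<in> ratvs.span B"
  shows "algebraic z"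
proof -
  have pw: "z ^ i \<in> ratvs.span B" for i
    by (induction i) (use assms in auto)
  obtain c where c: "Gcd (c ` {..card B}) = (1::int)" "(\<Sum>i\<le>card B. of_int (c i) * z ^ i) = 0"
    using int_relation[of B "\<lambda>i. z ^ i"] assms pw by blast
  have "\<exists>i\<le>card B. c i \<noteq> 0"
  proof (rule ccontr)
    assume "\<not> ?thesis"
    hence "Gcd (c ` {..card B}) = 0" by (auto simp: Gcd_0_iff)
    thus False using c by simp
  qed
  thus ?thesis using algebraic_int_polyI c(2) by blast
qed

lemma mult_span_closed:
  assumes "\<And>b. b \<in> A \<Longrightarrow> z * b \<in> ratvs.span B" "x \<in> ratvs.span A"
  shows "z * x \<in> ratvs.span B"
  using assms(2)
proof (induction rule: ratvs.span_induct_alt)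
  case (step c x y)
  have "z * (of_rat c * x + y) = of_rat c * (z * x) + z * y" by (simp add: algebra_simps)
  thus ?case using step assms(1) by (auto intro!: ratvs.span_add ratvs.span_scale)
qed (auto intro: ratvs.span_zero)

section \<open>Primitive integral minimal polynomials\<close>

abbreviation cpoly :: "int poly \<Rightarrow> complex poly" where
  "cpoly \<equiv> map_poly of_int"

lemma cpoly_simps:
  shows coeff_cpoly: "coeff (cpoly f) i = of_int (coeff f i)"
    and degree_cpoly: "degree (cpoly f) = degree f"
    and cpoly_mult: "cpoly (f * g) = cpoly f * cpoly g"
    and cpoly_add: "cpoly (f + g) = cpoly f + cpoly g"
    and cpoly_smult: "cpoly (smult c f) = smult (of_int c) (cpoly f)"
    and cpoly_eq_0: "cpoly f = 0 \<longleftrightarrow> f = 0"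
    and cpoly_pderiv: "cpoly (pderiv f) = pderiv (cpoly f)"
proof -
  show c: "coeff (cpoly f) i = of_int (coeff f i)" for f i by (simp add: coeff_map_poly)
  show "degree (cpoly f) = degree f" by (simp add: degree_map_poly)
  show "cpoly f = 0 \<longleftrightarrow> f = 0" by (simp add: map_poly_eq_0_iff)
  show "cpoly (f * g) = cpoly f * cpoly g" "cpoly (f + g) = cpoly f + cpoly g"
    "cpoly (smult c f) = smult (of_int c) (cpoly f)" "cpoly (pderiv f) = pderiv (cpoly f)"
    by (simp_all add: poly_eq_iff c coeff_mult coeff_pderiv)
qed

text \<open>Content and sign pin down the scalar. The last clause asks for divisibility among
  integer polynomials, the form that Gauss's lemma gives to minimality over the rationals.\<close>

definition minpol :: "int poly \<Rightarrow> complex \<Rightarrow> bool" where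
  "minpol f a \<longleftrightarrow> poly (cpoly f) a = 0 \<and> content f = 1 \<and> lead_coeff f > 0 \<and>
     (\<forall>h. poly (cpoly h) a = 0 \<longrightarrow> f dvd h)"

definition croots :: "int poly \<Rightarrow> complex set" where
  "croots f = {z. poly (cpoly f) z = 0}"

lemma algebraic_iff_cpoly: "algebraic a \<longleftrightarrow> (\<exists>f. f \<noteq> 0 \<and> poly (cpoly f) a = 0)"
proof
  assume "algebraic a"
  then obtain p where p: "\<forall>i. coeff p i \<in> \<int>" "p \<noteq> 0" "poly p a = 0"
    unfolding algebraic_def by blast
  define f where "f = map_poly (\<lambda>x. \<lfloor>Re x\<rfloor>) p"
  have "cpoly f = p"
  proof (rule poly_eqI)
    fix i
    have "of_int \<lfloor>Re (coeff p i)\<rfloor> = coeff p i" using p(1)[rule_format, of i] by (auto elim: Ints_cases)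
    thus "coeff (cpoly f) i = coeff p i" by (simp add: f_def coeff_cpoly coeff_map_poly)
  qed
  thus "\<exists>f. f \<noteq> 0 \<and> poly (cpoly f) a = 0" using p by (intro exI[of _ f]) auto
next
  assume "\<exists>f. f \<noteq> 0 \<and> poly (cpoly f) a = 0"
  then obtain f where "f \<noteq> 0" "poly (cpoly f) a = 0" by blast
  thus "algebraic a" by (intro algebraicI[of "cpoly f"]) (auto simp: coeff_cpoly cpoly_eq_0)
qed

text \<open>Gauss's lemma: over the fraction field \<open>c\<close> is a unit, and a primitive
  polynomial that divides there divides over the integers.\<close>

lemma primitive_dvd_smultD:
  fixes f h :: "int poly"
  assumes "content f = 1" "c \<noteq> 0" "f dvd smult c h"
  shows "f dvd h"
proof -
  have "fract_poly f dvd smult (to_fract c) (fract_poly h)"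
    using fract_poly_dvd[OF assms(3)] by simp
  hence "fract_poly f dvd fract_poly h"
    using assms(2) by (simp add: dvd_smult_iff)
  thus ?thesis using assms(1) by (rule fract_poly_dvdD)
qed

lemma minpol_exists:
  assumes "algebraic a"
  shows "\<exists>f. minpol f a"
proof -
  define P where "P f \<longleftrightarrow> f \<noteq> 0 \<and> poly (cpoly f) a = 0" for f
  have ex: "\<exists>f. P f" using assms by (simp add: algebraic_iff_cpoly P_def)
  define g where "g = arg_min degree P"
  have g: "P g" and min: "\<And>h. P h \<Longrightarrow> degree g \<le> degree h"
    using ex arg_min_natI[of P _ degree] arg_min_nat_le[of P _ degree] by (auto simp: g_def)
  \<comment> \<open>The sign that makes the leading coefficient of \<open>f\<close>
    positive.\<close>
  define s where "s = sgn (lead_coeff g)"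
  define f where "f = smult s (primitive_part g)"
  have g0: "g \<noteq> 0" using g by (simp add: P_def)
  have s: "s * s = 1" "s \<noteq> 0" "\<bar>s\<bar> = 1" using g0 by (auto simp: s_def sgn_if)
  have gc: "smult (content g) (primitive_part g) = g" by simp
  have cg: "content g \<noteq> 0" using g0 by simp
  have dg: "degree f = degree g" using s by (simp add: f_def)
  have gf: "g = smult (content g * s) f" using gc s(1) by (simp add: f_def mult.assoc)
  have root: "poly (cpoly f) a = 0"
  proof -
    have "poly (cpoly g) a = of_int (content g * s) * poly (cpoly f) a"
      using arg_cong[OF gf, of "\<lambda>q. poly (cpoly q) a"] by (simp add: cpoly_smult)
    moreover have "poly (cpoly g) a = 0" using g by (simp add: P_def)
    ultimately show ?thesis using s(2) g0 by simp
  qed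
  have cf: "content f = 1" using g0 s by (simp add: f_def content_smult)
  have lc: "lead_coeff f > 0"
  proof -
    have "lead_coeff g = content g * s * lead_coeff f"
      using arg_cong[OF gf, of "\<lambda>p. lead_coeff p"] by (simp only: lead_coeff_smult)
    hence "s * lead_coeff g = (s * s) * (content g * lead_coeff f)" by simp
    hence "s * lead_coeff g = content g * lead_coeff f" by (simp only: s(1) mult_1)
    moreover have "s * lead_coeff g = \<bar>lead_coeff g\<bar>" by (simp add: s_def abs_sgn mult.commute)
    moreover have "\<bar>lead_coeff g\<bar> > 0" using g0 by simp
    moreover have "content g > 0"
    proof -
      have "\<bar>content g\<bar> = content g" using normalize_content[of g] unfolding normalize_int_def .
      thus ?thesis using cg by linarith
    qed
    ultimately show ?thesis by (simp add: zero_less_mult_iff)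
  qed
  \<comment> \<open>Pseudo-division by \<open>f\<close> leaves a remainder with root
    \<open>a\<close> and smaller degree, hence zero. The power of the leading coefficient introduced
    on the way is cancelled by primitivity.\<close>
  have "f dvd h" if h: "poly (cpoly h) a = 0" for h
  proof -
    obtain q r where qr: "pseudo_divmod h f = (q, r)" by force
    define c where "c = coeff f (degree f) ^ (Suc (degree h) - degree f)"
    have f0: "f \<noteq> 0" using lc by auto
    note d = pseudo_divmod[OF f0 qr, folded c_def]
    have c0: "c \<noteq> 0" using f0 by (simp add: c_def)
    have "poly (cpoly r) a = poly (cpoly (smult c h)) a"
      by (simp add: d(1) cpoly_add cpoly_mult root)
    hence "poly (cpoly r) a = 0" by (simp add: cpoly_smult h)
    hence "r = 0" using d(2) min[of r] dg by (cases "r = 0") (auto simp: P_def)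
    hence "f dvd smult c h" using d(1) by simp
    thus ?thesis using primitive_dvd_smultD cf c0 by blast
  qed
  thus ?thesis using root cf lc by (auto simp: minpol_def)
qed

lemma minpolD:
  assumes "minpol f a"
  shows minpol_nz: "f \<noteq> 0" and minpol_eval: "poly (cpoly f) a = 0"
    and minpol_lead: "lead_coeff f > 0" and minpol_content: "content f = 1"
    and minpol_dvd: "poly (cpoly h) a = 0 \<Longrightarrow> f dvd h"
    and minpol_degree: "degree f > 0" and minpol_algebraic: "algebraic a"
    and minpol_croots: "a \<in> croots f"
proof -
  show *: "f \<noteq> 0" "poly (cpoly f) a = 0" "lead_coeff f > 0" "content f = 1"
    "poly (cpoly h) a = 0 \<Longrightarrow> f dvd h" "a \<in> croots f"
    using assms by (auto simp: minpol_def croots_def)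
  show "degree f > 0"
  proof (rule ccontr)
    assume "\<not> ?thesis"
    then obtain c where "f = [:c:]" by (auto elim: degree_eq_zeroE)
    thus False using *(1,2) by (auto simp: map_poly_pCons)
  qed
  show "algebraic a" using * algebraic_iff_cpoly by blast
qed

lemma minpol_coeff_0:
  assumes g: "minpol g x" and x: "x \<noteq> 0"
  shows "coeff g 0 \<noteq> 0"
proof
  assume "coeff g 0 = 0"
  then obtain h where h: "g = pCons 0 h" by (metis coeff_pCons_0 pCons_cases)
  hence "poly (cpoly h) x = 0" using minpol_eval[OF g] x by (simp add: map_poly_pCons)
  hence "g dvd h" using minpol_dvd[OF g] by blast
  moreover have "h \<noteq> 0" using h minpol_nz[OF g] by auto
  ultimately have "degree g \<le> degree h" by (auto intro: dvd_imp_degree_le)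
  thus False using h \<open>h \<noteq> 0\<close> by simp
qed

text \<open>If \<open>g\<close> is the minimal polynomial of \<open>b\<close>, then
  \<open>f = g * q\<close> and \<open>a\<close> is a root of one of the factors, which
  \<open>f\<close> then divides. Degrees force \<open>q\<close> to be constant, and content and sign
  make it 1.\<close>

lemma minpol_root:
  assumes f: "minpol f a" and b: "b \<in> croots f"
  shows "minpol f b"
proof -
  have fb: "poly (cpoly f) b = 0" using b by (simp add: croots_def)
  have "algebraic b" using fb minpol_nz[OF f] algebraic_iff_cpoly by blast
  then obtain g where g: "minpol g b" using minpol_exists by blast
  then obtain q where q: "f = g * q" using minpol_dvd[OF g fb] by (auto elim: dvdE)
  have nz: "g \<noteq> 0" "q \<noteq> 0" using minpol_nz[OF f] q by auto
  have "poly (cpoly g) a = 0 \<or> poly (cpoly q) a = 0"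
    using minpol_eval[OF f] by (simp add: q cpoly_mult)
  hence "degree q = 0"
  proof
    assume "poly (cpoly g) a = 0"
    hence "degree f \<le> degree g" using minpol_dvd[OF f] nz by (auto intro: dvd_imp_degree_le)
    thus ?thesis using nz by (simp add: q degree_mult_eq)
  next
    assume "poly (cpoly q) a = 0"
    hence "degree f \<le> degree q" using minpol_dvd[OF f] nz by (auto intro: dvd_imp_degree_le)
    thus ?thesis using nz minpol_degree[OF g] by (simp add: q degree_mult_eq)
  qed
  then obtain c where c: "q = [:c:]" by (auto elim: degree_eq_zeroE)
  have "f = smult c g" by (simp add: q c)
  moreover from this have "\<bar>c\<bar> = 1" using minpol_content[OF f] minpol_content[OF g] by (simp add: content_smult)
  moreover have "c > 0"
  proof -
    have "lead_coeff f = c * lead_coeff g" by (simp add: \<open>f = smult c g\<close>)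
    thus ?thesis using minpol_lead[OF f] minpol_lead[OF g] by (simp add: zero_less_mult_iff)
  qed
  ultimately show ?thesis using g by simp
qed

text \<open>A common root with the derivative would again have minimal polynomial \<open>f\<close>,
  which would then divide a nonzero polynomial of smaller degree.\<close>

lemma minpol_separable: assumes "minpol f a" shows "rsquarefree (cpoly f)"
  unfolding rsquarefree_roots
proof (intro allI notI)
  fix b assume b: "poly (cpoly f) b = 0 \<and> poly (pderiv (cpoly f)) b = 0"
  hence "minpol f b" using minpol_root[OF assms] by (auto simp: croots_def)
  moreover have "poly (cpoly (pderiv f)) b = 0" using b by (simp add: cpoly_pderiv)
  ultimately have "f dvd pderiv f" by (rule minpol_dvd)
  moreover have "pderiv f \<noteq> 0" using minpol_degree[OF assms] by (simp add: pderiv_eq_0_iff)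
  ultimately have "degree f \<le> degree (pderiv f)" by (rule dvd_imp_degree_le)
  thus False using minpol_degree[OF assms] by (simp add: degree_pderiv)
qed

lemma minpol_factor:
  assumes "minpol f a"
  shows "cpoly f = smult (of_int (lead_coeff f)) (\<Prod>z\<in>croots f. [:-z, 1:])"
  using complex_poly_decompose_rsquarefree[OF minpol_separable[OF assms]]
  by (simp add: croots_def degree_cpoly coeff_cpoly)

lemma finite_croots: "minpol f a \<Longrightarrow> finite (croots f)"
  unfolding croots_def using poly_roots_finite[of "cpoly f"] by (simp add: cpoly_eq_0 minpol_nz)

lemma card_croots: assumes "minpol f a" shows "card (croots f) = degree f"
proof -
  have "degree (cpoly f) = degree (\<Prod>z\<in>croots f. [:-z, 1:])"
    by (subst minpol_factor[OF assms]) (use minpol_nz[OF assms] in simp)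
  also have "\<dots> = (\<Sum>z\<in>croots f. degree [:-z, 1:])"
    by (rule degree_prod_eq_sum_degree) auto
  finally show ?thesis by (simp add: degree_cpoly)
qed

section \<open>The field of algebraic numbers\<close>

lemma power_in_span_powers:
  assumes "degree f > 0" "poly (cpoly f) a = 0"
  shows "a ^ degree f \<in> ratvs.span ((\<lambda>i. a ^ i) ` {..<degree f})"
proof -
  define n where "n = degree f"
  define l where "l = coeff f n"
  have l: "l \<noteq> 0" using assms by (auto simp: l_def n_def)
  have "0 = (\<Sum>i\<le>n. of_int (coeff f i) * a ^ i)"
    using assms(2) by (simp add: poly_altdef degree_cpoly coeff_cpoly n_def)
  also have "\<dots> = (\<Sum>i<n. of_int (coeff f i) * a ^ i) + of_int l * a ^ n"
    by (simp add: lessThan_Suc_atMost[symmetric] l_def)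
  finally have "a ^ n = (\<Sum>i<n. of_rat (- of_int (coeff f i) / of_int l) * a ^ i)"
    using l by (simp add: of_rat_divide of_rat_minus sum_divide_distrib[symmetric] sum_negf field_simps add_eq_0_iff)
  also have "\<dots> \<in> ratvs.span ((\<lambda>i. a ^ i) ` {..<n})"
    by (intro ratvs.span_sum ratvs.span_scale ratvs.span_base) auto
  finally show ?thesis by (simp add: n_def)
qed

text \<open>\<open>M\<close> is the ring of multipliers of the rational space spanned by the
  products \<open>a ^ i * b ^ j\<close>; the two minimal polynomials bring overflowing powers back
  into the span.\<close>

lemma algebraic_subring_two:
  assumes "algebraic (a::complex)" "algebraic b"
  shows "\<exists>M. is_subring M \<and> a \<in> M \<and> b \<in> M \<and> (\<forall>z\<in>M. algebraic z)"
proof -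
  obtain f g where f: "minpol f a" and g: "minpol g b" using assms minpol_exists by metis
  define n m where "n = degree f" and "m = degree g"
  define B where "B = (\<lambda>(i, j). a ^ i * b ^ j) ` ({..<n} \<times> {..<m})"
  have nm: "n > 0" "m > 0" using minpol_degree[OF f] minpol_degree[OF g] by (auto simp: n_def m_def)
  have BI: "a ^ i * b ^ j \<in> ratvs.span B" if "i < n" "j < m" for i j
    using that by (intro ratvs.span_base) (auto simp: B_def)
  have an: "a ^ n * b ^ j \<in> ratvs.span B" if j: "j < m" for j
  proof -
    have 1: "b ^ j * a ^ i \<in> ratvs.span B" if "i < n" for i
      using BI[OF that j] by (simp only: mult.commute)
    have 2: "a ^ n \<in> ratvs.span ((\<lambda>i. a ^ i) ` {..<n})"
      using power_in_span_powers[of f a] f by (simp add: n_def minpol_degree minpol_eval)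
    have "b ^ j * a ^ n \<in> ratvs.span B" by (rule mult_span_closed[OF _ 2]) (use 1 in auto)
    thus ?thesis by (simp only: mult.commute)
  qed
  have bm: "a ^ i * b ^ m \<in> ratvs.span B" if i: "i < n" for i
  proof -
    have 1: "b ^ m \<in> ratvs.span ((\<lambda>j. b ^ j) ` {..<m})"
      using power_in_span_powers[of g b] g by (simp add: m_def minpol_degree minpol_eval)
    show ?thesis by (rule mult_span_closed[OF _ 1]) (use BI[OF i] in auto)
  qed
  define M where "M = {z. \<forall>x\<in>ratvs.span B. z * x \<in> ratvs.span B}"
  have "is_subring M"
    by (auto simp: is_subring_def M_def left_diff_distrib mult.assoc intro: ratvs.span_diff)
  moreover have "a \<in> M"
  proof -
    have "a * y \<in> ratvs.span B" if "y \<in> B" for y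
    proof -
      obtain i j where ij: "y = a ^ i * b ^ j" "i < n" "j < m" using \<open>y \<in> B\<close> by (auto simp: B_def)
      have "a ^ Suc i * b ^ j \<in> ratvs.span B"
        using an[OF ij(3)] BI[of "Suc i" j] ij by (cases "Suc i = n") auto
      thus ?thesis by (simp add: ij mult_ac)
    qed
    thus ?thesis by (auto simp: M_def intro: mult_span_closed)
  qed
  moreover have "b \<in> M"
  proof -
    have "b * y \<in> ratvs.span B" if "y \<in> B" for y
    proof -
      obtain i j where ij: "y = a ^ i * b ^ j" "i < n" "j < m" using \<open>y \<in> B\<close> by (auto simp: B_def)
      have "a ^ i * b ^ Suc j \<in> ratvs.span B"
        using bm[OF ij(2)] BI[of i "Suc j"] ij by (cases "Suc j = m") auto
      thus ?thesis by (simp add: ij mult_ac)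
    qed
    thus ?thesis by (auto simp: M_def intro: mult_span_closed)
  qed
  moreover have "algebraic z" if "z \<in> M" for z
    using that nm BI[of 0 0] by (intro algebraic_if_span_closed[of B]) (auto simp: M_def B_def)
  ultimately show ?thesis by blast
qed

lemma is_subfield_Qbar: "is_subfield Qbar"
  unfolding is_subfield_iff is_subring_def
proof (intro conjI ballI)
  fix x y assume "x \<in> Qbar" "y \<in> Qbar"
  then obtain M where M: "is_subring M" "x \<in> M" "y \<in> M" "\<forall>z\<in>M. algebraic z"
    using algebraic_subring_two[of x y] unfolding Qbar_def by blast
  thus "x - y \<in> Qbar" "x * y \<in> Qbar" by (auto simp: Qbar_def intro: subring_diff subring_mult)
qed (auto simp: Qbar_def)

lemma adjoin_rat_eq_span:
  assumes f: "minpol f a"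
  shows "adjoin_rat a = ratvs.span ((\<lambda>i. a ^ i) ` {..<degree f})"
proof
  define B where "B = (\<lambda>i. a ^ i) ` {..<degree f}"
  have aB: "a * x \<in> ratvs.span B" if "x \<in> ratvs.span B" for x
  proof (rule mult_span_closed[OF _ that])
    fix y assume "y \<in> B"
    then obtain i where i: "y = a ^ i" "i < degree f" by (auto simp: B_def)
    show "a * y \<in> ratvs.span B"
    proof (cases "Suc i = degree f")
      case True
      have "a ^ degree f \<in> ratvs.span B"
        unfolding B_def using f by (intro power_in_span_powers) (auto simp: minpol_degree minpol_eval)
      thus ?thesis using True by (simp add: i flip: power_Suc)
    next
      case False
      thus ?thesis using i by (intro ratvs.span_base) (auto simp: B_def intro!: image_eqI[of _ _ "Suc i"])
    qed
  qed
  have 1: "1 \<in> ratvs.span B"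
    using minpol_degree[OF f] by (intro ratvs.span_base) (auto simp: B_def intro!: image_eqI[of _ _ 0])
  have pw: "a ^ i * x \<in> ratvs.span B" if "x \<in> ratvs.span B" for i x
    by (induction i) (use that aB in \<open>auto simp: mult.assoc\<close>)
  have mult: "z * x \<in> ratvs.span B" if z: "z \<in> ratvs.span B" and x: "x \<in> ratvs.span B" for z x
  proof -
    have "x * a ^ i \<in> ratvs.span B" for i using pw[OF x, of i] by (simp only: mult.commute)
    hence "x * z \<in> ratvs.span B" by (intro mult_span_closed[OF _ z]) (auto simp: B_def)
    thus ?thesis by (simp only: mult.commute)
  qed
  have sub: "is_subring (ratvs.span B)"
    using 1 mult by (auto simp: is_subring_def intro: ratvs.span_diff)
  \<comment> \<open>The minimal polynomial of \<open>z\<close> has a nonzero constant coefficient,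
    so its equation can be solved for \<open>inverse z\<close>.\<close>
  have "inverse z \<in> ratvs.span B" if z: "z \<in> ratvs.span B" for z
  proof (cases "z = 0")
    case False
    have "algebraic z"
      by (rule algebraic_if_span_closed[of B]) (use mult z 1 in \<open>auto simp: B_def\<close>)
    then obtain g where g: "minpol g z" using minpol_exists by blast
    have c0: "coeff g 0 \<noteq> 0" using minpol_coeff_0[OF g False] .
    obtain c h where gh: "g = pCons c h" by (metis pCons_cases)
    have "of_int c + z * poly (cpoly h) z = 0"
      using minpol_eval[OF g] by (simp add: gh map_poly_pCons)
    hence "inverse z = of_rat (- 1 / of_int c) * poly (cpoly h) z"
      using c0 gh False by (simp add: of_rat_divide of_rat_minus field_simps add_eq_0_iff)
    moreover have "poly (cpoly h) z \<in> ratvs.span B"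
      using sub z by (intro subring_poly) (auto simp: coeff_cpoly intro: subring_of_int)
    ultimately show ?thesis by (metis ratvs.span_scale)
  qed (auto intro: ratvs.span_zero)
  hence fld: "is_subfield (ratvs.span B)" using sub by (simp add: is_subfield_iff)
  have "a \<in> ratvs.span B" using aB[OF 1] by simp
  thus "adjoin_rat a \<subseteq> ratvs.span B" using fld by (auto simp: adjoin_rat_def)
  show "ratvs.span B \<subseteq> adjoin_rat a"
  proof (rule ratvs.span_minimal)
    have "of_rat c * x \<in> X" if "is_subfield X" "x \<in> X" for c x and X :: "complex set"
      using that by (intro subring_mult subfield_subring subfield_of_rat)
    thus "ratvs.subspace (adjoin_rat a)"
      by (auto simp: adjoin_rat_def ratvs.subspace_def subfield_subring intro: subring_zero subring_add)
    show "B \<subseteq> adjoin_rat a"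
      by (auto simp: adjoin_rat_def B_def subfield_subring intro: subring_power)
  qed
qed

lemma is_subfield_adjoin_rat: "is_subfield (adjoin_rat a)"
  unfolding is_subfield_def adjoin_rat_def by auto

lemma adjoin_rat_self: "a \<in> adjoin_rat a"
  by (auto simp: adjoin_rat_def)

lemma adjoin_rat_subset: "is_subfield F \<Longrightarrow> a \<in> F \<Longrightarrow> adjoin_rat a \<subseteq> F"
  by (auto simp: adjoin_rat_def)

text \<open>The degree is the denominator of the Weil height, which is why the comparison with the
  Mahler height calls for an upper bound together with positivity.\<close>

lemma degree_over_rat_adjoin:
  assumes "minpol f a"
  shows "degree_over_rat (adjoin_rat a) \<le> degree f" "degree_over_rat (adjoin_rat a) > 0"
proof -
  define B where "B = (\<lambda>i. a ^ i) ` {..<degree f}"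
  have F: "adjoin_rat a = ratvs.span B" using adjoin_rat_eq_span[OF assms] by (simp add: B_def)
  have "degree_over_rat (adjoin_rat a) \<le> card B"
    unfolding degree_over_rat_def using F by (intro ratvs.dim_le_card) (auto simp: B_def)
  also have "\<dots> \<le> degree f" unfolding B_def using card_image_le[of "{..<degree f}"] by force
  finally show "degree_over_rat (adjoin_rat a) \<le> degree f" .
  obtain A where A: "A \<subseteq> adjoin_rat a" "ratvs.independent A" "adjoin_rat a \<subseteq> ratvs.span A"
     "card A = ratvs.dim (adjoin_rat a)"
    using ratvs.basis_exists by blast
  \<comment> \<open>An infinite basis would have \<open>card A = 0\<close>, so positivity of the
    dimension rests on finiteness.\<close>
  have "finite A" using ratvs.independent_span_bound[of B A] A F by (auto simp: B_def)
  moreover have "A \<noteq> {}"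
    using A(3) subring_one[OF subfield_subring[OF is_subfield_adjoin_rat[of a]]] by auto
  ultimately show "degree_over_rat (adjoin_rat a) > 0"
    using A(4) by (auto simp: degree_over_rat_def card_gt_0_iff)
qed

section \<open>Gauss's lemma over valuation rings\<close>

text \<open>Linear factors are peeled off one at a time. A root in \<open>V\<close> is divided out
  from the top coefficient downwards without leaving \<open>V\<close>. For a root \<open>z\<close>
  outside \<open>V\<close> the coefficients are recovered from the bottom upwards, and it is
  \<open>z\<close> times the quotient that has coefficients in \<open>V\<close>.\<close>

lemma valring_prod_big_roots:
  assumes V: "valring UNIV V" and "finite R"
    and "\<And>i. coeff (smult a (\<Prod>z\<in>R. [:-z, 1:])) i \<in> V"
  shows "a * (\<Prod>z\<in>R-V. z) \<in> V"
  using assms(2,3)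
proof (induction R arbitrary: a rule: finite_induct)
  case empty
  thus ?case using empty[of 0] by simp
next
  case (insert z R)
  note sub = valring_subring[OF V]
  define q where "q = smult a (\<Prod>z\<in>R. [:-z, 1:])"
  have e: "smult a (\<Prod>z\<in>insert z R. [:-z, 1:]) = [:-z, 1:] * q"
    using insert by (simp add: q_def mult_ac)
  have p0: "- z * coeff q 0 \<in> V" using insert.prems[of 0] by (simp add: e)
  have p1: "coeff q i - z * coeff q (Suc i) \<in> V" for i
    using insert.prems[of "Suc i"] by (simp add: e)
  show ?case
  proof (cases "z \<in> V")
    case True
    have "\<forall>i. i + k \<ge> Suc (degree q) \<longrightarrow> coeff q i \<in> V" for k
    proof (induction k)
      case 0
      thus ?case by (auto simp: coeff_eq_0 subring_zero[OF sub])
    next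
      case (Suc k)
      show ?case
      proof (intro allI impI)
        fix i assume "i + Suc k \<ge> Suc (degree q)"
        hence "coeff q (Suc i) \<in> V" using Suc by auto
        hence "(coeff q i - z * coeff q (Suc i)) + z * coeff q (Suc i) \<in> V"
          using p1 True by (intro subring_add[OF sub] subring_mult[OF sub])
        thus "coeff q i \<in> V" by simp
      qed
    qed
    hence "coeff q i \<in> V" for i by (metis le_add2)
    hence "a * (\<Prod>z\<in>R-V. z) \<in> V" unfolding q_def by (rule insert.IH)
    thus ?thesis using True by (simp add: insert_Diff_if)
  next
    case False
    have iz: "inverse z \<in> V" and z0: "z \<noteq> 0"
      using V False subring_zero[OF sub] by (auto simp: valring_def)
    have "z * coeff q i \<in> V" for i
    proof (induction i)
      case 0
      show ?case using subring_uminus[OF sub p0] by simp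
    next
      case (Suc i)
      have "inverse z * (z * coeff q i) - (coeff q i - z * coeff q (Suc i)) \<in> V"
        by (rule subring_diff[OF sub subring_mult[OF sub iz Suc] p1])
      moreover have "inverse z * (z * coeff q i) - (coeff q i - z * coeff q (Suc i)) = z * coeff q (Suc i)"
        using z0 by simp
      ultimately show ?case by simp
    qed
    hence "coeff (smult (a * z) (\<Prod>z\<in>R. [:-z, 1:])) i \<in> V" for i
      by (simp add: q_def mult_ac)
    hence "(a * z) * (\<Prod>z\<in>R-V. z) \<in> V" by (rule insert.IH)
    moreover have "insert z R - V = insert z (R - V)" using False by auto
    ultimately show ?thesis using insert by (simp add: mult_ac)
  qed
qed

lemma coeff_prod_in_subring:
  assumes "is_subring V" "\<And>z i. z \<in> R \<Longrightarrow> coeff (h z) i \<in> V"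
  shows "coeff (\<Prod>z\<in>R. h z) i \<in> V"
  using assms(2)
proof (induction R arbitrary: i rule: infinite_finite_induct)
  case (insert z R)
  thus ?case using assms(1) by (auto simp: coeff_mult intro!: subring_sum subring_mult)
qed (use assms(1) in \<open>auto simp: coeff_1 intro: subring_one subring_zero\<close>)

text \<open>By Bezout the content is an integer combination of the coefficients. The ideal in
  question will be that of the integers lying in the maximal ideal of a valuation ring.\<close>

lemma content_in_ideal:
  fixes I :: "int set"
  assumes "0 \<in> I" "\<And>x y. x \<in> I \<Longrightarrow> y \<in> I \<Longrightarrow> x + y \<in> I" "\<And>r x. x \<in> I \<Longrightarrow> r * x \<in> I"
    and "\<And>i. coeff f i \<in> I"
  shows "content f \<in> I"
  using assms(4)
proof (induction f)
  case (pCons a p)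
  have "content (pCons a p) = gcd a (content p)"
    using pCons(1) by (auto simp: content_def cCons_def)
  moreover obtain u v where "u * a + v * content p = gcd a (content p)"
    using bezout_int by blast
  moreover have "a \<in> I" using pCons.prems[of 0] by simp
  moreover have "content p \<in> I" using pCons.prems[of "Suc _"] by (intro pCons.IH) simp
  ultimately show ?case using assms(2,3) by metis
qed (simp add: assms(1))

text \<open>Gauss's lemma at \<open>V\<close>: if each root outside \<open>V\<close> is pulled out
  of its linear factor, the remaining factors have coefficients in \<open>V\<close>, and a non-unit
  \<open>u\<close> would put all coefficients of the primitive \<open>f\<close> into the maximal
  ideal. In terms of absolute values, the leading coefficient times the product of
  \<open>max 1 |z|\<close> over the roots has absolute value 1.\<close>

lemma minpol_gauss:
  assumes f: "minpol f a" and V: "valring UNIV V"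
  defines "u \<equiv> of_int (lead_coeff f) * (\<Prod>z\<in>croots f - V. z)"
  shows "u \<in> V" "inverse u \<in> V" "u \<noteq> 0"
proof -
  note sub = valring_subring[OF V]
  have cf: "coeff (smult (of_int (lead_coeff f)) (\<Prod>z\<in>croots f. [:-z, 1:])) i = of_int (coeff f i)" for i
    by (subst minpol_factor[OF f, symmetric]) (simp add: coeff_cpoly)
  show u: "u \<in> V"
    unfolding u_def
    by (rule valring_prod_big_roots[OF V finite_croots[OF f]]) (simp only: cf subring_of_int[OF sub])
  \<comment> \<open>The linear factor at \<open>z\<close>, scaled so that its largest coefficient at
    \<open>V\<close> is 1 or -1.\<close>
  define h where "h z = (if z \<in> V then [:-z, 1:] else [:-1, inverse z:])" for z
  have "(\<Prod>z\<in>croots f. [:-z, 1:]) = (\<Prod>z\<in>croots f. smult (if z \<in> V then 1 else z) (h z))"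
  proof (intro prod.cong refl)
    fix z show "[:-z, 1:] = smult (if z \<in> V then 1 else z) (h z)"
      using subring_zero[OF sub] by (cases "z = 0") (auto simp: h_def)
  qed
  also have "\<dots> = smult (\<Prod>z\<in>croots f. if z \<in> V then 1 else z) (\<Prod>z\<in>croots f. h z)"
    by (rule prod_smult)
  also have "(\<Prod>z\<in>croots f. if z \<in> V then 1 else z) = (\<Prod>z\<in>croots f - V. z)"
    using finite_croots[OF f] by (intro prod.mono_neutral_cong_right) auto
  finally have P: "(\<Prod>z\<in>croots f. [:-z, 1:]) = smult (\<Prod>z\<in>croots f - V. z) (\<Prod>z\<in>croots f. h z)" .
  have eq: "of_int (coeff f i) = u * coeff (\<Prod>z\<in>croots f. h z) i" for i
    using cf[of i] unfolding P u_def by (simp only: coeff_smult mult.assoc)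
  have hV: "coeff (\<Prod>z\<in>croots f. h z) i \<in> V" for i
  proof (rule coeff_prod_in_subring[OF sub])
    fix z i
    show "coeff (h z) i \<in> V"
      using V sub by (auto simp: h_def coeff_pCons valring_def split: nat.splits
          intro: subring_one subring_zero subring_uminus)
  qed
  have "u \<notin> valmax V"
  proof
    assume um: "u \<in> valmax V"
    define I where "I = {n::int. of_int n \<in> valmax V}"
    have "content f \<in> I"
    proof (rule content_in_ideal)
      show "coeff f i \<in> I" for i
        using valmax_mult[OF sub um hV[of i]] by (simp add: I_def eq mult.commute)
    qed (auto simp: I_def valmax_add[OF V] valmax_mult[OF sub] subring_of_int[OF sub] zero_in_valmax[OF sub])
    thus False using minpol_content[OF f] one_notin_valmax[OF sub] by (simp add: I_def)
  qed
  thus "inverse u \<in> V" "u \<noteq> 0" using u by (auto simp: valmax_def)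
qed

text \<open>The rationals common to all valuation rings of the complex numbers are the integers: a
  prime in a reduced denominator fails to be invertible in a valuation ring above it.\<close>

lemma dvd_if_quotient_in_valrings:
  fixes a b :: int
  assumes b: "b \<noteq> 0" and V: "\<And>V. valring UNIV V \<Longrightarrow> of_int a / of_int b \<in> (V :: complex set)"
  shows "b dvd a"
proof (rule ccontr)
  assume nd: "\<not> b dvd a"
  define g where "g = gcd a b"
  obtain a' b' where ab: "a = a' * g" "b = b' * g" "coprime a' b'"
    using gcd_coprime_exists[of a b] b unfolding g_def by auto
  have g0: "g \<noteq> 0" "b' \<noteq> 0" using b ab by auto
  have "\<not> is_unit b'" using nd ab(1,2) unit_imp_dvd[of b' a'] by (auto intro: mult_dvd_mono)
  then obtain p where p: "prime p" "p dvd b'" using g0 prime_divisor_exists by blast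
  then obtain c where c: "b' = p * c" by (auto elim: dvdE)
  obtain W where W: "valring (UNIV::complex set) W" "inverse (of_int p) \<notin> W"
    using valring_above_prime[OF p(1)] by blast
  note sub = valring_subring[OF W(1)]
  have p0: "p \<noteq> 0" "c \<noteq> 0" using g0 c by auto
  have "of_int a / of_int b = (of_int a' / of_int b' :: complex)" using ab g0 by simp
  hence "of_int c * (of_int a' / of_int b') \<in> W"
    using V[OF W(1)] by (intro subring_mult[OF sub] subring_of_int[OF sub]) simp
  hence 1: "of_int a' / of_int p \<in> W" using p0 by (simp add: c)
  have "coprime a' p" using ab(3) p(2) by (meson coprime_divisors dvd_refl)
  then obtain u v where uv: "u * a' + v * p = 1" using bezout_int[of a' p] by auto
  have "of_int u * (of_int a' / of_int p) + of_int v \<in> W"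
    using 1 by (intro subring_add[OF sub] subring_mult[OF sub] subring_of_int[OF sub])
  also have "of_int u * (of_int a' / of_int p) + of_int v = (of_int (u * a' + v * p) / of_int p :: complex)"
    using p0 by (simp add: field_simps)
  finally show False using W(2) by (simp add: uv inverse_eq_divide)
qed

lemma algebraic_denominator:
  assumes "algebraic (l::complex)"
  shows "\<exists>D::int. D > 0 \<and> (\<forall>V. valring UNIV V \<longrightarrow> of_int D * l \<in> V)"
proof -
  obtain f where f: "minpol f l" using minpol_exists assms by blast
  have "of_int (lead_coeff f) * l \<in> V" if V: "valring UNIV V" for V
    using valring_lead_mult[OF V, of l "cpoly f"] f
    by (simp add: coeff_cpoly degree_cpoly minpol_eval subring_of_int[OF valring_subring[OF V]])
  thus ?thesis using minpol_lead[OF f] by blast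
qed

section \<open>Embeddings\<close>

lemma embeddingsD:
  assumes "\<sigma> \<in> embeddings F" and F: "is_subfield F"
  shows emb_one: "\<sigma> 1 = 1" and emb_add: "x \<in> F \<Longrightarrow> y \<in> F \<Longrightarrow> \<sigma> (x + y) = \<sigma> x + \<sigma> y"
    and emb_mult: "x \<in> F \<Longrightarrow> y \<in> F \<Longrightarrow> \<sigma> (x * y) = \<sigma> x * \<sigma> y"
    and emb_zero: "\<sigma> 0 = 0" and emb_uminus: "x \<in> F \<Longrightarrow> \<sigma> (- x) = - \<sigma> x"
    and emb_diff: "x \<in> F \<Longrightarrow> y \<in> F \<Longrightarrow> \<sigma> (x - y) = \<sigma> x - \<sigma> y"
    and emb_inverse: "x \<in> F \<Longrightarrow> \<sigma> (inverse x) = inverse (\<sigma> x)"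
    and emb_eq_0: "x \<in> F \<Longrightarrow> \<sigma> x = 0 \<longleftrightarrow> x = 0"
proof -
  note sub = subfield_subring[OF F]
  show 1: "\<sigma> 1 = 1" and add: "\<And>x y. x \<in> F \<Longrightarrow> y \<in> F \<Longrightarrow> \<sigma> (x + y) = \<sigma> x + \<sigma> y"
    and mult: "\<And>x y. x \<in> F \<Longrightarrow> y \<in> F \<Longrightarrow> \<sigma> (x * y) = \<sigma> x * \<sigma> y"
    using assms(1) by (auto simp: embeddings_def)
  show 0: "\<sigma> 0 = 0" using add[of 0 0] subring_zero[OF sub] by simp
  show m: "\<sigma> (- x) = - \<sigma> x" if "x \<in> F" for x
    using add[OF that subring_uminus[OF sub that]] 0 by (simp add: eq_neg_iff_add_eq_0 add.commute)
  show "\<sigma> (x - y) = \<sigma> x - \<sigma> y" if "x \<in> F" "y \<in> F"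
    using add[OF that(1) subring_uminus[OF sub that(2)]] m[OF that(2)] by simp
  have inv: "\<sigma> x * \<sigma> (inverse x) = 1" if "x \<in> F" "x \<noteq> 0" for x
    using mult[OF that(1) subfield_inverse[OF F that(1)]] that 1 by simp
  show "\<sigma> x = 0 \<longleftrightarrow> x = 0" if "x \<in> F" using inv[of x] that 0 by (cases "x = 0") auto
  show "\<sigma> (inverse x) = inverse (\<sigma> x)" if "x \<in> F"
    using inv[OF that] 0 by (cases "x = 0") (auto dest: inverse_unique)
qed

lemma emb_divide:
  "\<sigma> \<in> embeddings F \<Longrightarrow> is_subfield F \<Longrightarrow> x \<in> F \<Longrightarrow> y \<in> F \<Longrightarrow> \<sigma> (x / y) = \<sigma> x / \<sigma> y"
  by (simp add: divide_inverse emb_mult emb_inverse subfield_inverse)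

lemma emb_power:
  "\<sigma> \<in> embeddings F \<Longrightarrow> is_subfield F \<Longrightarrow> x \<in> F \<Longrightarrow> \<sigma> (x ^ n) = \<sigma> x ^ n"
  by (induction n) (simp_all add: emb_one emb_mult subring_power subfield_subring)

lemma emb_sum:
  assumes "\<sigma> \<in> embeddings F" "is_subfield F" "\<And>i. i \<in> I \<Longrightarrow> g i \<in> F"
  shows "\<sigma> (sum g I) = (\<Sum>i\<in>I. \<sigma> (g i))"
  using assms(3)
  by (induction I rule: infinite_finite_induct)
     (use assms(1,2) in \<open>simp_all add: emb_zero emb_add subring_sum subfield_subring\<close>)

lemma emb_of_int:
  assumes "\<sigma> \<in> embeddings F" "is_subfield F" shows "\<sigma> (of_int n) = of_int n"
proof -
  have *: "\<sigma> (of_nat k) = of_nat k" for k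
    by (induction k) (use assms in \<open>simp_all add: emb_zero emb_one emb_add subring_one
          subring_of_nat subfield_subring\<close>)
  show ?thesis
    by (cases n) (use assms * in \<open>simp_all add: emb_uminus subring_of_nat subfield_subring del: of_nat_Suc\<close>)
qed

lemma emb_of_rat:
  assumes "\<sigma> \<in> embeddings F" "is_subfield F" shows "\<sigma> (of_rat q) = of_rat q"
proof -
  obtain a b where "q = of_int a / of_int b" by (metis quotient_of_div surj_pair)
  thus ?thesis
    by (simp add: of_rat_divide emb_divide[OF assms] emb_of_int[OF assms] subring_of_int
        subfield_subring[OF assms(2)])
qed

lemma emb_cpoly:
  assumes "\<sigma> \<in> embeddings F" "is_subfield F" "x \<in> F"
  shows "\<sigma> (poly (cpoly h) x) = poly (cpoly h) (\<sigma> x)"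
proof -
  have "\<sigma> (of_int (coeff h i) * x ^ i) = of_int (coeff h i) * \<sigma> x ^ i" for i
    using assms by (simp add: emb_mult emb_of_int emb_power subring_of_int subring_power subfield_subring)
  thus ?thesis
    using assms by (simp add: poly_altdef degree_cpoly coeff_cpoly)
      (subst emb_sum[of _ F], auto intro!: subring_mult subring_of_int subring_power subfield_subring)
qed

lemma emb_croots:
  assumes "\<sigma> \<in> embeddings F" "is_subfield F" "x \<in> F" "x \<in> croots f"
  shows "\<sigma> x \<in> croots f"
  using emb_cpoly[OF assms(1-3), of f] assms(4) emb_zero[OF assms(1,2)] by (simp add: croots_def)

lemma croots_subset_Qbar: "minpol f a \<Longrightarrow> croots f \<subseteq> Qbar"
  by (auto simp: Qbar_def dest: minpol_root minpol_algebraic)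

lemma emb_Qbar:
  assumes "\<sigma> \<in> embeddings F" "is_subfield F" "x \<in> F" "x \<in> Qbar"
  shows "\<sigma> x \<in> Qbar"
proof -
  obtain f where "minpol f x" using assms minpol_exists by (auto simp: Qbar_def)
  thus ?thesis using emb_croots[OF assms(1-3)] croots_subset_Qbar minpol_croots by blast
qed

lemma emb_compose:
  assumes "\<sigma> \<in> embeddings Qbar" "\<tau> \<in> embeddings Qbar"
  shows "restrict (\<sigma> \<circ> \<tau>) Qbar \<in> embeddings Qbar"
  using assms emb_Qbar[OF assms(2) is_subfield_Qbar] is_subfield_Qbar
  by (auto simp: embeddings_def subfield_subring subring_one subring_add subring_mult)

lemma emb_restrict:
  assumes "\<sigma> \<in> embeddings E" "F \<subseteq> E" "is_subfield F"
  shows "restrict \<sigma> F \<in> embeddings F"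
  using assms by (auto simp: embeddings_def subset_iff subfield_subring subring_one subring_add subring_mult)

lemma cpoly_diff: "cpoly (f - g) = cpoly f - cpoly g"
  by (simp add: poly_eq_iff coeff_cpoly)

text \<open>The graphs of partial homomorphisms on subrings of the algebraic numbers, ordered by inclusion,
  have maximal elements, and such a maximal graph is total.\<close>

definition hom_graph :: "(complex \<times> complex) set \<Rightarrow> bool" where
  "hom_graph \<Gamma> \<longleftrightarrow> fst ` \<Gamma> \<subseteq> Qbar \<and> (1, 1) \<in> \<Gamma> \<and>
     (\<forall>x y u v. (x, y) \<in> \<Gamma> \<longrightarrow> (u, v) \<in> \<Gamma> \<longrightarrow> (x - u, y - v) \<in> \<Gamma> \<and> (x * u, y * v) \<in> \<Gamma>) \<and>
     (\<forall>y. (0, y) \<in> \<Gamma> \<longrightarrow> y = 0)"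

lemma hom_graphD:
  assumes "hom_graph \<Gamma>"
  shows hom_graph_Qbar: "(x, y) \<in> \<Gamma> \<Longrightarrow> x \<in> Qbar"
    and hom_graph_one: "(1, 1) \<in> \<Gamma>" and hom_graph_zero: "(0, 0) \<in> \<Gamma>"
    and hom_graph_diff: "(x, y) \<in> \<Gamma> \<Longrightarrow> (u, v) \<in> \<Gamma> \<Longrightarrow> (x - u, y - v) \<in> \<Gamma>"
    and hom_graph_add: "(x, y) \<in> \<Gamma> \<Longrightarrow> (u, v) \<in> \<Gamma> \<Longrightarrow> (x + u, y + v) \<in> \<Gamma>"
    and hom_graph_mult: "(x, y) \<in> \<Gamma> \<Longrightarrow> (u, v) \<in> \<Gamma> \<Longrightarrow> (x * u, y * v) \<in> \<Gamma>"
    and hom_graph_kernel: "(0, y) \<in> \<Gamma> \<Longrightarrow> y = 0"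
proof -
  show d: "\<And>x y u v. (x, y) \<in> \<Gamma> \<Longrightarrow> (u, v) \<in> \<Gamma> \<Longrightarrow> (x - u, y - v) \<in> \<Gamma>"
    and 1: "(1, 1) \<in> \<Gamma>" and "(x, y) \<in> \<Gamma> \<Longrightarrow> x \<in> Qbar" "(0, y) \<in> \<Gamma> \<Longrightarrow> y = 0"
    and "(x, y) \<in> \<Gamma> \<Longrightarrow> (u, v) \<in> \<Gamma> \<Longrightarrow> (x * u, y * v) \<in> \<Gamma>"
    using assms unfolding hom_graph_def by (blast, blast, force, blast, blast)
  show 0: "(0, 0) \<in> \<Gamma>" using d[OF 1 1] by simp
  show "(x, y) \<in> \<Gamma> \<Longrightarrow> (u, v) \<in> \<Gamma> \<Longrightarrow> (x + u, y + v) \<in> \<Gamma>"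
    using d[OF _ d[OF 0], of x y u v] by simp
qed

lemma hom_graph_sum:
  assumes "hom_graph \<Gamma>" "\<And>i. i \<in> I \<Longrightarrow> (g i, h i) \<in> \<Gamma>"
  shows "(sum g I, sum h I) \<in> \<Gamma>"
  using assms(2)
  by (induction I rule: infinite_finite_induct) (auto intro: hom_graphD[OF assms(1)])

lemma hom_graph_power:
  "hom_graph \<Gamma> \<Longrightarrow> (x, y) \<in> \<Gamma> \<Longrightarrow> (x ^ n, y ^ n) \<in> \<Gamma>"
  by (induction n) (auto intro: hom_graphD)

lemma hom_graph_of_int:
  assumes "hom_graph \<Gamma>" shows "(of_int n, of_int n) \<in> \<Gamma>"
proof -
  have *: "(of_nat k, of_nat k) \<in> \<Gamma>" for k by (induction k) (auto intro: hom_graphD[OF assms])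
  show ?thesis
  proof (cases n)
    case (neg k)
    thus ?thesis using hom_graph_diff[OF assms hom_graph_zero[OF assms] *[of "Suc k"]] by simp
  qed (use * in auto)
qed

lemma hom_graph_cpoly:
  assumes "hom_graph \<Gamma>" "(x, y) \<in> \<Gamma>"
  shows "(poly (cpoly h) x, poly (cpoly h) y) \<in> \<Gamma>"
  by (auto simp: poly_altdef degree_cpoly coeff_cpoly
      intro!: hom_graph_sum hom_graph_mult hom_graph_power hom_graph_of_int assms)

text \<open>The domain is only a ring, so inverses are not at hand. Instead the minimal polynomial
  of \<open>x\<close> turns the pair \<open>(x, 0)\<close> into \<open>(0, c)\<close> with its
  constant coefficient \<open>c\<close>, which is nonzero if \<open>x\<close> is.\<close>

lemma hom_graph_inj:
  assumes \<Gamma>: "hom_graph \<Gamma>" and "(x, 0) \<in> \<Gamma>"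
  shows "x = 0"
proof (rule ccontr)
  assume x: "x \<noteq> 0"
  have "algebraic x" using hom_graph_Qbar[OF assms] by (simp add: Qbar_def)
  then obtain g where g: "minpol g x" using minpol_exists by blast
  have "(0, of_int (coeff g 0)) \<in> \<Gamma>"
    using hom_graph_cpoly[OF assms, of g] minpol_eval[OF g] by (simp add: poly_0_coeff_0 coeff_cpoly)
  thus False using hom_graph_kernel[OF \<Gamma>] minpol_coeff_0[OF g x] by force
qed

definition coeffs_related :: "(complex \<times> complex) set \<Rightarrow> complex poly \<Rightarrow> complex poly \<Rightarrow> bool" where
  "coeffs_related \<Gamma> q q' \<longleftrightarrow> (\<forall>i. (coeff q i, coeff q' i) \<in> \<Gamma>)"

lemma coeffs_related_intros:
  assumes \<Gamma>: "hom_graph \<Gamma>"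
  shows coeffs_related_diff: "coeffs_related \<Gamma> q q' \<Longrightarrow> coeffs_related \<Gamma> r r' \<Longrightarrow> coeffs_related \<Gamma> (q - r) (q' - r')"
    and coeffs_related_mult: "coeffs_related \<Gamma> q q' \<Longrightarrow> coeffs_related \<Gamma> r r' \<Longrightarrow> coeffs_related \<Gamma> (q * r) (q' * r')"
    and coeffs_related_monom: "(c, c') \<in> \<Gamma> \<Longrightarrow> coeffs_related \<Gamma> (monom c k) (monom c' k)"
    and coeffs_related_0: "coeffs_related \<Gamma> 0 q' \<Longrightarrow> q' = 0"
  using hom_graph_diff[OF \<Gamma>] hom_graph_zero[OF \<Gamma>] hom_graph_kernel[OF \<Gamma>]
  by (auto simp: coeffs_related_def coeff_mult poly_eq_iff intro!: hom_graph_sum[OF \<Gamma>] hom_graph_mult[OF \<Gamma>])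

text \<open>Pseudo-division of \<open>q\<close> by the relation \<open>p\<close> of least degree,
  carried out in parallel on the images. The coefficients form only a ring, so leading terms are
  cancelled by cross-multiplication; the factor \<open>c'\<close> that this introduces is nonzero
  because the homomorphism is injective.\<close>

lemma hom_graph_common_root:
  assumes \<Gamma>: "hom_graph \<Gamma>" and p: "coeffs_related \<Gamma> p p'" "p \<noteq> 0" "poly p s = 0"
    and min: "\<And>q q'. coeffs_related \<Gamma> q q' \<Longrightarrow> q \<noteq> 0 \<Longrightarrow> poly q s = 0 \<Longrightarrow> degree p \<le> degree q"
    and s': "poly p' s' = 0" and q: "coeffs_related \<Gamma> q q'" "poly q s = 0"
  shows "poly q' s' = 0"
  using q
proof (induction "degree q" arbitrary: q q' rule: less_induct)
  case less
  show ?case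
  proof (cases "q = 0")
    case True
    hence "q' = 0" using less.prems(1) coeffs_related_0[OF \<Gamma>] by blast
    thus ?thesis by simp
  next
    case False
    hence le: "degree p \<le> degree q" using min less.prems by blast
    define c c' b b' k where "c = lead_coeff p" and "c' = coeff p' (degree p)"
      and "b = lead_coeff q" and "b' = coeff q' (degree q)" and "k = degree q - degree p"
    define r r' where "r = monom c 0 * q - monom b k * p" and "r' = monom c' 0 * q' - monom b' k * p'"
    have rr: "coeffs_related \<Gamma> r r'"
      unfolding r_def r'_def using less.prems p
      by (intro coeffs_related_diff coeffs_related_mult coeffs_related_monom \<Gamma>)
         (auto simp: coeffs_related_def c_def c'_def b_def b'_def)
    have rs: "poly r s = 0" using less.prems p by (simp add: r_def poly_monom)
    have dr: "degree r \<le> degree q"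
      unfolding r_def using le
      by (intro degree_diff_le order.trans[OF degree_mult_le])
         (auto simp: k_def monom_0 intro: order.trans[OF add_right_mono[OF degree_monom_le]])
    have "coeff r (degree q) = 0"
      using le by (simp add: r_def coeff_monom_mult c_def b_def k_def)
    hence "r = 0 \<or> degree r < degree q"
      using dr by (metis leading_coeff_0_iff le_neq_implies_less)
    hence "poly r' s' = 0"
    proof
      assume "r = 0"
      hence "r' = 0" using rr coeffs_related_0[OF \<Gamma>] by blast
      thus ?thesis by simp
    qed (use less.hyps[of r r'] rr rs in auto)
    hence "c' * poly q' s' = 0" by (simp add: r'_def poly_monom s')
    moreover have "c' \<noteq> 0" using p(1,2) hom_graph_inj[OF \<Gamma>, of "lead_coeff p"] unfolding c'_def coeffs_related_def
      by (metis leading_coeff_0_iff)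
    ultimately show ?thesis by simp
  qed
qed

text \<open>\<open>s'\<close> is a root of the image of a relation of least degree for
  \<open>s\<close>. By \<open>hom_graph_common_root\<close> the value of an image polynomial at
  \<open>s'\<close> then depends only on the value of the polynomial at \<open>s\<close>.\<close>

lemma hom_graph_extend:
  assumes \<Gamma>: "hom_graph \<Gamma>" and s: "s \<in> Qbar"
  shows "\<exists>\<Gamma>' s'. hom_graph \<Gamma>' \<and> \<Gamma> \<subseteq> \<Gamma>' \<and> (s, s') \<in> \<Gamma>'"
proof -
  let ?PP = "coeffs_related \<Gamma>"
  note PPd = coeffs_related_diff[OF \<Gamma>] and PPm = coeffs_related_mult[OF \<Gamma>] and PPmon = coeffs_related_monom[OF \<Gamma>]
  define P where "P = (\<lambda>(p, p'). ?PP p p' \<and> p \<noteq> 0 \<and> poly p s = 0)"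
  obtain m where m: "minpol m s" using s minpol_exists by (auto simp: Qbar_def)
  have "P (cpoly m, cpoly m)"
    using m hom_graph_of_int[OF \<Gamma>]
    by (auto simp: P_def coeffs_related_def coeff_cpoly cpoly_eq_0 minpol_nz minpol_eval)
  hence ex: "\<exists>z. P z" by blast
  obtain p p' where pp: "P (p, p')" and min: "\<And>z. P z \<Longrightarrow> degree p \<le> degree (fst z)"
    using ex_has_least_nat[of P _ "\<lambda>z. degree (fst z)"] ex by (metis fst_conv surj_pair)
  have p: "?PP p p'" "p \<noteq> 0" "poly p s = 0" using pp by (auto simp: P_def)
  \<comment> \<open>Injectivity keeps nonzero coefficients nonzero, so \<open>p'\<close> has the
    degree of \<open>p\<close>; in particular it is not constant and has a root.\<close>
  have ci: "coeff p' i = 0 \<longleftrightarrow> coeff p i = 0" for i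
    using p(1) hom_graph_inj[OF \<Gamma>] hom_graph_kernel[OF \<Gamma>] unfolding coeffs_related_def by metis
  have dp: "degree p' = degree p"
  proof (rule antisym)
    show "degree p' \<le> degree p" by (rule degree_le) (simp add: ci coeff_eq_0)
    show "degree p \<le> degree p'" by (rule degree_le) (simp add: ci[symmetric] coeff_eq_0)
  qed
  have "degree p > 0"
  proof (rule ccontr)
    assume "\<not> ?thesis"
    then obtain c where "p = [:c:]" by (auto elim: degree_eq_zeroE)
    thus False using p by auto
  qed
  then obtain s' where s': "poly p' s' = 0"
    using dp alg_closed_imp_poly_has_root[of p'] by auto
  have vanish: "poly q' s' = 0" if "?PP q q'" "poly q s = 0" for q q'
    using hom_graph_common_root[OF \<Gamma> p _ s' that] min by (fastforce simp: P_def)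
  define \<Gamma>' where "\<Gamma>' = {(poly q s, poly q' s') | q q'. ?PP q q'}"
  have in': "(poly q s, poly q' s') \<in> \<Gamma>'" if "?PP q q'" for q q' using that by (auto simp: \<Gamma>'_def)
  have "hom_graph \<Gamma>'"
    unfolding hom_graph_def
  proof (intro conjI allI impI)
    have "poly q s \<in> Qbar" if "?PP q q'" for q q'
      using that s hom_graph_Qbar[OF \<Gamma>] unfolding coeffs_related_def
      by (intro subring_poly subfield_subring is_subfield_Qbar) blast+
    thus "fst ` \<Gamma>' \<subseteq> Qbar" by (auto simp: \<Gamma>'_def)
    show "(1, 1) \<in> \<Gamma>'" using in'[OF PPmon[OF hom_graph_one[OF \<Gamma>], of 0]] by (simp add: poly_monom)
    show "y = 0" if "(0, y) \<in> \<Gamma>'" for y using that vanish by (auto simp: \<Gamma>'_def)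
    fix x y u v assume "(x, y) \<in> \<Gamma>'" "(u, v) \<in> \<Gamma>'"
    then obtain q q' r r' where q: "x = poly q s" "y = poly q' s'" "?PP q q'"
      "u = poly r s" "v = poly r' s'" "?PP r r'"
      by (auto simp: \<Gamma>'_def)
    show "(x - u, y - v) \<in> \<Gamma>'" using in'[OF PPd[OF q(3,6)]] by (simp add: q)
    show "(x * u, y * v) \<in> \<Gamma>'" using in'[OF PPm[OF q(3,6)]] by (simp add: q)
  qed
  moreover have "\<Gamma> \<subseteq> \<Gamma>'"
  proof
    fix z assume "z \<in> \<Gamma>"
    then obtain c c' where "z = (c, c')" "(c, c') \<in> \<Gamma>" by (cases z) auto
    thus "z \<in> \<Gamma>'" using in'[OF PPmon[of c c' 0]] by (simp add: poly_monom)
  qed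
  moreover have "(s, s') \<in> \<Gamma>'"
    using in'[OF PPmon[OF hom_graph_one[OF \<Gamma>], of 1]] by (simp add: poly_monom)
  ultimately show ?thesis by blast
qed

text \<open>The starting graph sends the value at \<open>a\<close> of each integer polynomial to its
  value at \<open>b\<close>. It is well defined because \<open>f\<close> divides every integer
  polynomial that vanishes at \<open>a\<close>.\<close>

lemma emb_transitive:
  assumes f: "minpol f a" and b: "b \<in> croots f"
  shows "\<exists>\<tau>\<in>embeddings Qbar. \<tau> a = b"
proof -
  define \<Gamma>0 where "\<Gamma>0 = {(poly (cpoly h) a, poly (cpoly h) b) | h. True}"
  have in0: "(poly (cpoly h) a, poly (cpoly h) b) \<in> \<Gamma>0" for h by (auto simp: \<Gamma>0_def)
  have a: "a \<in> Qbar" using minpol_algebraic[OF f] by (simp add: Qbar_def)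
  have g0: "hom_graph \<Gamma>0"
    unfolding hom_graph_def
  proof (intro conjI allI impI)
    show "fst ` \<Gamma>0 \<subseteq> Qbar"
      using a by (auto simp: \<Gamma>0_def coeff_cpoly
          intro!: subring_poly subring_of_int subfield_subring is_subfield_Qbar)
    show "(1, 1) \<in> \<Gamma>0" using in0[of 1] by simp
    show "y = 0" if y: "(0, y) \<in> \<Gamma>0" for y
    proof -
      obtain h where h: "poly (cpoly h) a = 0" "y = poly (cpoly h) b" using y by (auto simp: \<Gamma>0_def)
      then obtain q where "h = f * q" using minpol_dvd[OF f] by (blast elim: dvdE)
      thus ?thesis using b h by (simp add: cpoly_mult croots_def)
    qed
    fix x y u v assume "(x, y) \<in> \<Gamma>0" "(u, v) \<in> \<Gamma>0"
    then obtain q r where q: "x = poly (cpoly q) a" "y = poly (cpoly q) b"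
      "u = poly (cpoly r) a" "v = poly (cpoly r) b"
      by (auto simp: \<Gamma>0_def)
    show "(x * u, y * v) \<in> \<Gamma>0" using in0[of "q * r"] by (simp add: q cpoly_mult)
    show "(x - u, y - v) \<in> \<Gamma>0"
      using in0[of "q - r"] by (simp add: q cpoly_diff)
  qed
  define A where "A = {\<Gamma>. hom_graph \<Gamma> \<and> \<Gamma>0 \<subseteq> \<Gamma>}"
  have "\<Union>C \<in> A" if "C \<noteq> {}" "subset.chain A C" for C
  proof -
    have CA: "\<And>X. X \<in> C \<Longrightarrow> hom_graph X" "\<And>X. X \<in> C \<Longrightarrow> \<Gamma>0 \<subseteq> X"
      and ch: "\<And>X Y. X \<in> C \<Longrightarrow> Y \<in> C \<Longrightarrow> X \<subseteq> Y \<or> Y \<subseteq> X"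
      using that(2) unfolding subset_chain_def A_def by blast+
    have "hom_graph (\<Union>C)"
      unfolding hom_graph_def
    proof (intro conjI allI impI)
      show "fst ` \<Union>C \<subseteq> Qbar" using hom_graph_Qbar[OF CA(1)] by force
      show "(1, 1) \<in> \<Union>C" using hom_graph_one[OF CA(1)] that(1) by auto
      show "y = 0" if "(0, y) \<in> \<Union>C" for y using that hom_graph_kernel[OF CA(1)] by auto
      fix x y u v assume "(x, y) \<in> \<Union>C" "(u, v) \<in> \<Union>C"
      then obtain X Y where "X \<in> C" "Y \<in> C" "(x, y) \<in> X" "(u, v) \<in> Y" by auto
      then obtain Z where Z: "Z \<in> C" "(x, y) \<in> Z" "(u, v) \<in> Z" using ch[of X Y] by auto
      show "(x - u, y - v) \<in> \<Union>C" "(x * u, y * v) \<in> \<Union>C"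
        using hom_graph_diff[OF CA(1)] hom_graph_mult[OF CA(1)] Z by blast+
    qed
    thus ?thesis using that(1) CA(2) by (auto simp: A_def)
  qed
  moreover have "A \<noteq> {}" using g0 by (auto simp: A_def)
  ultimately obtain \<Gamma> where G: "\<Gamma> \<in> A" and max: "\<And>X. X \<in> A \<Longrightarrow> \<Gamma> \<subseteq> X \<Longrightarrow> X = \<Gamma>"
    using subset_Zorn_nonempty[of A] by blast
  have \<Gamma>: "hom_graph \<Gamma>" and G0: "\<Gamma>0 \<subseteq> \<Gamma>" using G by (auto simp: A_def)
  have total: "\<exists>y. (x, y) \<in> \<Gamma>" if x: "x \<in> Qbar" for x
  proof -
    obtain \<Gamma>' y where "hom_graph \<Gamma>'" "\<Gamma> \<subseteq> \<Gamma>'" "(x, y) \<in> \<Gamma>'"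
      using hom_graph_extend[OF \<Gamma> x] by blast
    moreover from this have "\<Gamma>' = \<Gamma>" using G0 by (intro max) (auto simp: A_def)
    ultimately show ?thesis by blast
  qed
  have uniq: "y = y'" if "(x, y) \<in> \<Gamma>" "(x, y') \<in> \<Gamma>" for x y y'
    using hom_graph_kernel[OF \<Gamma>, of "y - y'"] hom_graph_diff[OF \<Gamma> that] by simp
  define \<tau> where "\<tau> = restrict (\<lambda>x. THE y. (x, y) \<in> \<Gamma>) Qbar"
  have t: "\<tau> x = y" if "(x, y) \<in> \<Gamma>" for x y
    using that uniq hom_graph_Qbar[OF \<Gamma> that] by (auto simp: \<tau>_def)
  have t': "(x, \<tau> x) \<in> \<Gamma>" if "x \<in> Qbar" for x using total[OF that] t by auto
  have "\<tau> \<in> embeddings Qbar"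
    using t[OF hom_graph_one[OF \<Gamma>]] t[OF hom_graph_add[OF \<Gamma> t' t']] t[OF hom_graph_mult[OF \<Gamma> t' t']]
    by (auto simp: embeddings_def \<tau>_def)
  moreover have "(a, b) \<in> \<Gamma>" using in0[of "[:0, 1:]"] G0 by (auto simp: map_poly_pCons)
  hence "\<tau> a = b" by (rule t)
  ultimately show ?thesis by blast
qed

section \<open>Mahler heights\<close>

lemma log_plus_nonneg: "log_plus t \<ge> 0"
  by (simp add: log_plus_def)

lemma log_plus_mult:
  assumes "a \<ge> 0" "b \<ge> 0"
  shows "log_plus (a * b) \<le> log_plus a + log_plus b"
proof -
  have "a * b \<le> max 1 a * max 1 b" using assms by (intro mult_mono) auto
  moreover have "1 * 1 \<le> max 1 a * max 1 b" by (intro mult_mono) auto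
  ultimately have "max 1 (a * b) \<le> max 1 a * max 1 b" by simp
  hence "ln (max 1 (a * b)) \<le> ln (max 1 a * max 1 b)" by (intro ln_mono) auto
  moreover have "0 < max 1 a" "0 < max 1 b" by auto
  ultimately show ?thesis by (simp add: log_plus_def ln_mult)
qed

lemma log_plus_power: assumes "t \<ge> 0" shows "log_plus (t ^ m) = m * log_plus t"
proof (cases "t \<ge> 1")
  case True
  thus ?thesis by (simp add: log_plus_def max_def one_le_power ln_realpow)
next
  case False
  hence "t ^ m \<le> 1" using assms by (intro power_le_one) auto
  thus ?thesis using False by (simp add: log_plus_def max_def)
qed

lemma log_plus_inverse: assumes "t > 0" shows "log_plus (inverse t) = log_plus t - ln t"
  using assms by (cases "t \<ge> 1") (auto simp: log_plus_def max_def ln_inverse inverse_le_1_iff one_le_inverse_iff)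

definition mahler_height :: "int poly \<Rightarrow> real" where
  "mahler_height f = (ln (lead_coeff f) + (\<Sum>z\<in>croots f. log_plus (norm z))) / degree f"

text \<open>The orbit \<open>U\<close> stands in for a Galois group; it is finite although there are
  infinitely many embeddings. Composition with an embedding that maps \<open>t\<close> to
  \<open>t'\<close> sends the fibre over \<open>t\<close> injectively into the fibre over
  \<open>t'\<close>, so all fibres have the same size.\<close>

lemma orbit_fibres:
  fixes pr :: "complex \<times> complex \<times> complex \<Rightarrow> complex"
  assumes xyz: "x \<in> Qbar" "y \<in> Qbar" "z \<in> Qbar"
    and f: "minpol f s" and pr: "\<And>\<tau>. \<tau> \<in> embeddings Qbar \<Longrightarrow> pr (\<tau> x, \<tau> y, \<tau> z) = \<tau> s"
  defines "U \<equiv> (\<lambda>\<tau>. (\<tau> x, \<tau> y, \<tau> z)) ` embeddings Qbar"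
  shows "\<exists>k. card U = k * degree f \<and> pr ` U \<subseteq> croots f \<and> (\<forall>t\<in>croots f. card {u\<in>U. pr u = t} = k)"
proof -
  note Q = is_subfield_Qbar
  have sQ: "s \<in> Qbar" using minpol_algebraic[OF f] by (simp add: Qbar_def)
  obtain fx where fx: "minpol fx x" using xyz(1) minpol_exists unfolding Qbar_def by blast
  obtain fy where fy: "minpol fy y" using xyz(2) minpol_exists unfolding Qbar_def by blast
  obtain fz where fz: "minpol fz z" using xyz(3) minpol_exists unfolding Qbar_def by blast
  have "U \<subseteq> croots fx \<times> croots fy \<times> croots fz"
    using emb_croots[OF _ Q] minpol_croots[OF fx] minpol_croots[OF fy] minpol_croots[OF fz] xyz
    by (auto simp: U_def)
  hence fin: "finite U"
    by (rule finite_subset) (use fx fy fz finite_croots in blast)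
  have sub: "pr ` U \<subseteq> croots f"
    using emb_croots[OF _ Q sQ minpol_croots[OF f]] pr by (auto simp: U_def)
  have le: "card {u\<in>U. pr u = t} \<le> card {u\<in>U. pr u = t'}" if tt: "t \<in> croots f" "t' \<in> croots f" for t t'
  proof -
    obtain \<rho> where r: "\<rho> \<in> embeddings Qbar" "\<rho> t = t'"
      using emb_transitive[OF minpol_root[OF f tt(1)] tt(2)] by blast
    define \<Phi> where "\<Phi> = (\<lambda>(a, b, c). (\<rho> a, \<rho> b, \<rho> c))"
    have rinj: "a = b" if "\<rho> a = \<rho> b" "a \<in> Qbar" "b \<in> Qbar" for a b
      using that emb_diff[OF r(1) Q, of a b] emb_eq_0[OF r(1) Q, of "a - b"]
        subring_diff[OF subfield_subring[OF Q]] by auto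
    have UQ: "U \<subseteq> Qbar \<times> Qbar \<times> Qbar" using emb_Qbar[OF _ Q] xyz by (auto simp: U_def)
    have "inj_on \<Phi> {u\<in>U. pr u = t}"
    proof (rule inj_onI)
      fix u v assume "u \<in> {u\<in>U. pr u = t}" "v \<in> {u\<in>U. pr u = t}" "\<Phi> u = \<Phi> v"
      thus "u = v" using UQ rinj by (cases u; cases v) (auto simp: \<Phi>_def)
    qed
    moreover have "\<Phi> ` {u\<in>U. pr u = t} \<subseteq> {u\<in>U. pr u = t'}"
    proof (rule image_subsetI)
      fix u assume "u \<in> {u\<in>U. pr u = t}"
      hence u: "u \<in> U" and t: "t = pr u" by auto
      then obtain \<tau> where tau: "\<tau> \<in> embeddings Qbar" "u = (\<tau> x, \<tau> y, \<tau> z)" by (auto simp: U_def)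
      define \<sigma> where "\<sigma> = restrict (\<rho> \<circ> \<tau>) Qbar"
      have s: "\<sigma> \<in> embeddings Qbar" unfolding \<sigma>_def by (rule emb_compose[OF r(1) tau(1)])
      have e: "\<Phi> u = (\<sigma> x, \<sigma> y, \<sigma> z)" using xyz by (simp add: \<sigma>_def \<Phi>_def tau)
      hence "\<Phi> u \<in> U" using s by (auto simp: U_def)
      moreover have "pr (\<Phi> u) = \<rho> (pr u)" 
      proof -
        have "pr (\<Phi> u) = \<sigma> s" by (simp only: e pr[OF s])
        also have "\<dots> = \<rho> (\<tau> s)" using sQ by (simp add: \<sigma>_def)
        also have "\<tau> s = pr u" by (simp only: tau(2) pr[OF tau(1)])
        finally show ?thesis .
      qed
      ultimately show "\<Phi> u \<in> {u\<in>U. pr u = t'}" using r(2) t by simp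
    qed
    ultimately show ?thesis by (rule card_inj_on_le) (use fin in auto)
  qed
  define k where "k = card {u\<in>U. pr u = s}"
  have k: "card {u\<in>U. pr u = t} = k" if "t \<in> croots f" for t
    using le[OF that minpol_croots[OF f]] le[OF minpol_croots[OF f] that] by (simp add: k_def)
  have "card U = (\<Sum>u\<in>U. 1)" by simp
  also have "\<dots> = (\<Sum>t\<in>croots f. \<Sum>u\<in>{u\<in>U. pr u = t}. 1)"
    by (rule sum.group[symmetric, OF fin finite_croots[OF f] sub])
  also have "\<dots> = (\<Sum>t\<in>croots f. k)" by (intro sum.cong refl) (simp add: k)
  also have "\<dots> = k * degree f" by (simp add: card_croots[OF f])
  finally show ?thesis using sub k by blast
qed

lemma sum_fibres:
  fixes \<phi> :: "'b \<Rightarrow> real"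
  assumes "finite U" "finite T" "pr ` U \<subseteq> T" "\<And>t. t \<in> T \<Longrightarrow> card {u\<in>U. pr u = t} = k"
  shows "(\<Sum>u\<in>U. \<phi> (pr u)) = k * (\<Sum>t\<in>T. \<phi> t)"
proof -
  have "(\<Sum>u\<in>U. \<phi> (pr u)) = (\<Sum>t\<in>T. \<Sum>u\<in>{u\<in>U. pr u = t}. \<phi> (pr u))"
    by (rule sum.group[symmetric, OF assms(1-3)])
  also have "\<dots> = (\<Sum>t\<in>T. k * \<phi> t)" by (intro sum.cong refl) (simp add: assms(4))
  finally show ?thesis by (simp add: sum_distrib_left)
qed

lemma prod_fibres:
  fixes \<phi> :: "'b \<Rightarrow> 'c::comm_semiring_1"
  assumes "finite U" "finite T" "pr ` U \<subseteq> T" "\<And>t. t \<in> T \<Longrightarrow> card {u\<in>U. pr u = t} = k"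
  shows "(\<Prod>u\<in>U. \<phi> (pr u)) = (\<Prod>t\<in>T. \<phi> t) ^ k"
proof -
  have "(\<Prod>u\<in>U. \<phi> (pr u)) = (\<Prod>t\<in>T. \<Prod>u\<in>{u\<in>U. pr u = t}. \<phi> (pr u))"
    by (rule prod.group[symmetric, OF assms(1-3)])
  also have "\<dots> = (\<Prod>t\<in>T. \<phi> t ^ k)" by (intro prod.cong refl) (simp add: assms(4))
  finally show ?thesis by (simp add: prod_power_distrib)
qed

text \<open>Over the whole orbit, the roots outside \<open>V\<close> together with the leading
  coefficients multiply to a power of the element in \<open>minpol_gauss\<close>. Passing to the
  part \<open>I\<close> only brings in the factors \<open>\<psi> u\<close>, all in \<open>V\<close>:
  inverses of omitted large roots, and the small roots that are kept.\<close>

lemma lead_power_prod_in_valring: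
  assumes f: "minpol f s" and V: "valring UNIV V" and U: "finite U" "I \<subseteq> U" "pr ` U \<subseteq> croots f"
    and k: "\<And>t. t \<in> croots f \<Longrightarrow> card {u\<in>U. pr u = t} = k"
  shows "of_int (lead_coeff f) ^ k * (\<Prod>u\<in>I. pr u) \<in> V"
proof -
  note sub = valring_subring[OF V]
  define \<phi> where "\<phi> t = (if t \<in> V then 1 else t)" for t
  define \<psi> where "\<psi> u = (if u \<in> I then (if pr u \<in> V then pr u else 1)
     else (if pr u \<in> V then 1 else inverse (pr u)))" for u
  have nz: "t \<noteq> 0" if "t \<notin> V" for t using that subring_zero[OF sub] by auto
  have "(\<Prod>t\<in>croots f - V. t) = (\<Prod>t\<in>croots f. \<phi> t)"
    using finite_croots[OF f] by (intro prod.mono_neutral_cong_left) (auto simp: \<phi>_def)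
  hence u: "of_int (lead_coeff f) * (\<Prod>t\<in>croots f. \<phi> t) \<in> V"
    using minpol_gauss(1)[OF f V] by simp
  have "(\<Prod>u\<in>I. pr u) = (\<Prod>u\<in>U. if u \<in> I then pr u else 1)"
    using U by (intro prod.mono_neutral_cong_left) auto
  also have "\<dots> = (\<Prod>u\<in>U. \<phi> (pr u) * \<psi> u)"
    by (intro prod.cong refl) (auto simp: \<phi>_def \<psi>_def nz)
  also have "\<dots> = (\<Prod>t\<in>croots f. \<phi> t) ^ k * (\<Prod>u\<in>U. \<psi> u)"
    by (simp add: prod.distrib prod_fibres[OF U(1) finite_croots[OF f] U(3) k])
  finally have "of_int (lead_coeff f) ^ k * (\<Prod>u\<in>I. pr u) =
      (of_int (lead_coeff f) * (\<Prod>t\<in>croots f. \<phi> t)) ^ k * (\<Prod>u\<in>U. \<psi> u)"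
    by (simp add: power_mult_distrib mult_ac)
  also have "\<dots> \<in> V"
  proof (rule subring_mult[OF sub subring_power[OF sub u] subring_prod[OF sub]])
    show "\<psi> u \<in> V" for u
      using V by (auto simp: \<psi>_def valring_def subring_one)
  qed
  finally show ?thesis .
qed

lemma minpol_norm:
  assumes "minpol f a"
  shows "of_int (coeff f 0) = of_int (lead_coeff f) * (\<Prod>z\<in>croots f. - z)"
proof -
  have "of_int (coeff f 0) = poly (cpoly f) 0" by (simp add: poly_0_coeff_0 coeff_cpoly)
  also have "\<dots> = of_int (lead_coeff f) * (\<Prod>z\<in>croots f. - z)"
    by (subst minpol_factor[OF assms]) (simp add: poly_prod)
  finally show ?thesis .
qed

text \<open>After multiplication by \<open>card U\<close>, the left side is the sum of an
  archimedean part and of \<open>(l * m) * ln b\<close>. The denominators \<gamma> bring the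
  constant coefficient \<open>c\<close> of \<open>f\<close> into the bounds for both parts, with
  opposite signs, so that it cancels in the end.\<close>

lemma height_conjugate_quotient:
  assumes f: "minpol f \<gamma>" and \<gamma>': "\<gamma>' \<in> croots f" and \<gamma>: "\<gamma> \<noteq> 0"
    and g: "minpol g x" and m: "m > 0" and x: "x ^ m = \<gamma>' / \<gamma>"
  shows "m * mahler_height g \<le> 2 * mahler_height f"
proof -
  note Q = is_subfield_Qbar
  have f': "minpol f \<gamma>'" using minpol_root[OF f \<gamma>'] .
  have mem: "x \<in> Qbar" "\<gamma> \<in> Qbar" "\<gamma>' \<in> Qbar"
    using minpol_algebraic[OF f] minpol_algebraic[OF f'] minpol_algebraic[OF g] by (auto simp: Qbar_def)
  define U where "U = (\<lambda>\<tau>. (\<tau> x, \<tau> \<gamma>, \<tau> \<gamma>')) ` embeddings Qbar"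
  define p1 p2 p3 :: "complex \<times> complex \<times> complex \<Rightarrow> complex"
    where "p1 = fst" and "p2 = fst \<circ> snd" and "p3 = snd \<circ> snd"
  have "\<exists>k. card U = k * degree g \<and> p1 ` U \<subseteq> croots g \<and> (\<forall>t\<in>croots g. card {u\<in>U. p1 u = t} = k)"
    unfolding U_def by (rule orbit_fibres[OF mem g]) (simp add: p1_def)
  then obtain l where l: "card U = l * degree g" "p1 ` U \<subseteq> croots g"
      "\<And>t. t \<in> croots g \<Longrightarrow> card {u\<in>U. p1 u = t} = l"
    by blast
  have "\<exists>k. card U = k * degree f \<and> p2 ` U \<subseteq> croots f \<and> (\<forall>t\<in>croots f. card {u\<in>U. p2 u = t} = k)"
    unfolding U_def by (rule orbit_fibres[OF mem f]) (simp add: p2_def)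
  then obtain k where k: "card U = k * degree f" "p2 ` U \<subseteq> croots f"
      "\<And>t. t \<in> croots f \<Longrightarrow> card {u\<in>U. p2 u = t} = k"
    by blast
  have "\<exists>k. card U = k * degree f \<and> p3 ` U \<subseteq> croots f \<and> (\<forall>t\<in>croots f. card {u\<in>U. p3 u = t} = k)"
    unfolding U_def by (rule orbit_fibres[OF mem f']) (simp add: p3_def)
  then obtain k' where k': "card U = k' * degree f" "p3 ` U \<subseteq> croots f"
      "\<And>t. t \<in> croots f \<Longrightarrow> card {u\<in>U. p3 u = t} = k'"
    by blast
  have [simp]: "k' = k" using k(1) k'(1) minpol_degree[OF f] by simp
  have ne: "U \<noteq> {}" using emb_transitive[OF f \<gamma>'] by (auto simp: U_def)
  have "U \<subseteq> croots g \<times> croots f \<times> croots f"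
    using l(2) k(2) k'(2) by (force simp: p1_def p2_def p3_def)
  hence fin: "finite U"
    by (rule finite_subset) (use finite_croots f g in blast)
  have rel: "p1 u ^ m = p3 u / p2 u" "p2 u \<noteq> 0" if u: "u \<in> U" for u
  proof -
    obtain \<tau> where t: "\<tau> \<in> embeddings Qbar" "u = (\<tau> x, \<tau> \<gamma>, \<tau> \<gamma>')" using u by (auto simp: U_def)
    have "\<tau> (x ^ m) = \<tau> (\<gamma>' / \<gamma>)" by (simp add: x)
    thus "p1 u ^ m = p3 u / p2 u"
      using t mem by (simp add: p1_def p2_def p3_def emb_power[OF _ Q] emb_divide[OF _ Q])
    show "p2 u \<noteq> 0" using emb_eq_0[OF t(1) Q mem(2)] \<gamma> t by (simp add: p2_def)
  qed
  have c0: "coeff f 0 \<noteq> 0" using minpol_coeff_0[OF f \<gamma>] .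
  define a b c where "a = lead_coeff f" and "b = lead_coeff g" and "c = coeff f 0"
  have ab: "a > 0" "b > 0" using minpol_lead[OF f] minpol_lead[OF g] by (auto simp: a_def b_def)
  have rt: "t \<noteq> 0" if "t \<in> croots f" for t
    using minpol_root[OF f that] that c0 by (auto simp: croots_def poly_0_coeff_0 coeff_cpoly)
  define S where "S h = (\<Sum>z\<in>croots h. log_plus (norm z))" for h
  have arch: "l * (m * S g) \<le> k * S f + k * (S f - (ln \<bar>c\<bar> - ln a))"
  proof -
    have "l * (m * S g) = (\<Sum>u\<in>U. m * log_plus (norm (p1 u)))"
      using sum_fibres[OF fin finite_croots[OF g] l(2,3), of "\<lambda>t. m * log_plus (norm t)"]
      by (simp add: S_def sum_distrib_left)
    also have "\<dots> = (\<Sum>u\<in>U. log_plus (norm (p3 u) * inverse (norm (p2 u))))"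
    proof (intro sum.cong refl)
      fix u assume "u \<in> U"
      have "m * log_plus (norm (p1 u)) = log_plus (norm (p1 u ^ m))"
        by (simp add: log_plus_power norm_power)
      also have "norm (p1 u ^ m) = norm (p3 u) * inverse (norm (p2 u))"
        using rel(1)[OF \<open>u \<in> U\<close>] by (simp add: norm_mult norm_inverse divide_inverse)
      finally show "m * log_plus (norm (p1 u)) = log_plus (norm (p3 u) * inverse (norm (p2 u)))" .
    qed
    also have "\<dots> \<le> (\<Sum>u\<in>U. log_plus (norm (p3 u)) + log_plus (inverse (norm (p2 u))))"
      by (intro sum_mono log_plus_mult) auto
    also have "\<dots> = k * S f + k * (\<Sum>t\<in>croots f. log_plus (inverse (norm t)))"
      using sum_fibres[OF fin finite_croots[OF f] k'(2,3), of "\<lambda>t. log_plus (norm t)"]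
        sum_fibres[OF fin finite_croots[OF f] k(2,3), of "\<lambda>t. log_plus (inverse (norm t))"]
      by (simp add: sum.distrib S_def)
    also have "(\<Sum>t\<in>croots f. log_plus (inverse (norm t))) = S f - (\<Sum>t\<in>croots f. ln (norm t))"
      using rt by (simp add: log_plus_inverse S_def sum_subtractf)
    \<comment> \<open>The product of the roots is \<open>c / a\<close> up to sign.\<close>
    also have "(\<Sum>t\<in>croots f. ln (norm t)) = ln \<bar>c\<bar> - ln a"
    proof -
      have "norm (of_int c :: complex) = a * (\<Prod>t\<in>croots f. norm t)"
        unfolding c_def minpol_norm[OF f] using ab by (simp add: a_def norm_mult prod_norm[symmetric])
      hence "\<bar>of_int c\<bar> = a * (\<Prod>t\<in>croots f. norm t)" by simp
      moreover have "(\<Prod>t\<in>croots f. norm t) > 0" using rt by (intro prod_pos) auto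
      ultimately have "ln \<bar>of_int c\<bar> = ln a + ln (\<Prod>t\<in>croots f. norm t)"
        using ab by (simp only:) (subst ln_mult, auto)
      moreover have "ln (\<Prod>t\<in>croots f. norm t) = (\<Sum>t\<in>croots f. ln (norm t))"
        using rt finite_croots[OF f] by (intro ln_prod) auto
      ultimately show ?thesis by simp
    qed
    finally show ?thesis .
  qed
  \<comment> \<open>The non-archimedean counterpart of \<open>arch\<close>. Stated as a divisibility
    it can be checked in one valuation ring at a time.\<close>
  have dvd: "b ^ (l * m) dvd (a * c) ^ k"
  proof (rule dvd_if_quotient_in_valrings)
    fix V :: "complex set" assume V: "valring UNIV V"
    note sub = valring_subring[OF V]
    \<comment> \<open>The orbit points at which the conjugate of \<open>x\<close> is large. There
      \<open>a ^ k\<close> makes the product of the numerators \<open>p3\<close> integral. Up to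
      sign \<open>c ^ k\<close> is \<open>a ^ k\<close> times the product of all \<open>p2\<close>;
      its part over \<open>I\<close> cancels the denominators, and the rest over
      \<open>U - I\<close> is integral together with \<open>a ^ k\<close>.\<close>
    define I where "I = {u\<in>U. p1 u \<notin> V}"
    have I: "I \<subseteq> U" "U - I \<subseteq> U" by (auto simp: I_def)
    have finI: "finite I" using fin I finite_subset by blast
    have 1: "of_int a ^ k * (\<Prod>u\<in>I. p3 u) \<in> V"
      using lead_power_prod_in_valring[OF f V fin I(1) k'(2) k'(3)] by (simp add: a_def)
    have 2: "of_int a ^ k * (\<Prod>u\<in>U-I. p2 u) \<in> V"
      using lead_power_prod_in_valring[OF f V fin I(2) k(2,3)] by (simp add: a_def)
    have "of_int c ^ k = of_int a ^ k * (\<Prod>t\<in>croots f. - t) ^ k"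
      by (simp add: c_def a_def minpol_norm[OF f] power_mult_distrib)
    also have "(\<Prod>t\<in>croots f. - t) ^ k = (\<Prod>u\<in>U. - p2 u)"
      by (rule prod_fibres[symmetric, OF fin finite_croots[OF f] k(2,3)])
    also have "\<dots> = (- 1) ^ card U * (\<Prod>u\<in>U. p2 u)" by (simp add: prod_uminus)
    also have "(\<Prod>u\<in>U. p2 u) = (\<Prod>u\<in>U-I. p2 u) * (\<Prod>u\<in>I. p2 u)"
      using prod.subset_diff[OF I(1) fin] .
    finally have ck: "of_int c ^ k = (- 1) ^ card U * (of_int a ^ k * (\<Prod>u\<in>U-I. p2 u)) * (\<Prod>u\<in>I. p2 u)"
      by (simp add: mult_ac)
    have nzI: "(\<Prod>u\<in>I. p2 u) \<noteq> 0" using rel(2) finI I by auto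
    have "(\<Prod>u\<in>I. p1 u) ^ m = (\<Prod>u\<in>I. p3 u / p2 u)"
      unfolding prod_power_distrib using rel(1) I by (intro prod.cong) auto
    hence "of_int (a * c) ^ k * (\<Prod>u\<in>I. p1 u) ^ m =
        (- 1) ^ card U * (of_int a ^ k * (\<Prod>u\<in>U-I. p2 u)) * (of_int a ^ k * (\<Prod>u\<in>I. p3 u))"
      using nzI by (simp add: power_mult_distrib ck prod_dividef)
    also have "\<dots> \<in> V"
      using sub by (intro subring_mult 1 2 subring_power subring_uminus subring_one)
    finally have 3: "of_int (a * c) ^ k * (\<Prod>u\<in>I. p1 u) ^ m \<in> V" .
    define u where "u = of_int b * (\<Prod>t\<in>croots g - V. t)"
    have u: "inverse u \<in> V" "u \<noteq> 0" using minpol_gauss[OF g V] by (auto simp: u_def b_def)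
    have "(\<Prod>u\<in>I. p1 u) = (\<Prod>u\<in>U. if p1 u \<in> V then 1 else p1 u)"
      using fin by (intro prod.mono_neutral_cong_left) (auto simp: I_def)
    also have "\<dots> = (\<Prod>t\<in>croots g. if t \<in> V then 1 else t) ^ l"
      by (rule prod_fibres[OF fin finite_croots[OF g] l(2,3)])
    also have "(\<Prod>t\<in>croots g. if t \<in> V then 1 else t) = (\<Prod>t\<in>croots g - V. t)"
      using finite_croots[OF g] by (intro prod.mono_neutral_cong_right) auto
    finally have "of_int b ^ (l * m) * (\<Prod>u\<in>I. p1 u) ^ m = u ^ (l * m)"
      by (simp add: u_def power_mult_distrib power_mult)
    moreover have "(of_int b :: complex) \<noteq> 0" using ab by simp
    ultimately have "(\<Prod>u\<in>I. p1 u) ^ m * inverse u ^ (l * m) = 1 / of_int b ^ (l * m)"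
      using u(2) by (simp add: power_inverse field_simps)
    hence "of_int (a * c) ^ k / of_int b ^ (l * m) =
        (of_int (a * c) ^ k * (\<Prod>u\<in>I. p1 u) ^ m) * inverse u ^ (l * m)"
      by (simp add: mult.assoc)
    also have "\<dots> \<in> V" using sub by (intro subring_mult 3 subring_power u)
    finally show "of_int ((a * c) ^ k) / of_int (b ^ (l * m)) \<in> V" by simp
  qed (use ab in simp)
  have "b ^ (l * m) \<le> \<bar>(a * c) ^ k\<bar>"
    using dvd_imp_le_int[OF _ dvd] ab c0 by (simp add: c_def)
  hence "real_of_int (b ^ (l * m)) \<le> real_of_int \<bar>(a * c) ^ k\<bar>" by (simp only: of_int_le_iff)
  hence "real_of_int b ^ (l * m) \<le> (real_of_int a * \<bar>real_of_int c\<bar>) ^ k"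
    using ab by (simp add: power_abs abs_mult)
  hence "ln (real_of_int b ^ (l * m)) \<le> ln ((real_of_int a * \<bar>real_of_int c\<bar>) ^ k)"
    using ab by (intro ln_mono) auto
  hence fin_part: "(l * m) * ln b \<le> k * (ln a + ln \<bar>c\<bar>)"
    using ab c0 by (simp add: ln_realpow ln_mult c_def)
  have N: "card U > 0" using ne fin by (simp add: card_gt_0_iff)
  have hg: "l * (degree g * mahler_height g) = l * (ln b + S g)"
    using minpol_degree[OF g] by (simp add: mahler_height_def b_def S_def)
  have hf: "k * (degree f * mahler_height f) = k * (ln a + S f)"
    using minpol_degree[OF f] by (simp add: mahler_height_def a_def S_def)
  have "card U * (m * mahler_height g) = m * (l * (degree g * mahler_height g))"
    by (simp add: l(1) mult_ac)
  also have "\<dots> = (l * m) * ln b + l * (m * S g)" unfolding hg by (simp add: algebra_simps)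
  also have "\<dots> \<le> k * (ln a + ln \<bar>c\<bar>) + (k * S f + k * (S f - (ln \<bar>c\<bar> - ln a)))"
    using fin_part arch by linarith
  also have "\<dots> = 2 * (k * (degree f * mahler_height f))" unfolding hf by (simp add: algebra_simps)
  also have "\<dots> = card U * (2 * mahler_height f)" by (simp add: k(1) mult_ac)
  finally show ?thesis using N by simp
qed

section \<open>Lagrange interpolation and Kronecker's theorem\<close>

definition lagrange :: "complex set \<Rightarrow> complex \<Rightarrow> complex poly" where
  "lagrange R z = smult (inverse (\<Prod>w\<in>R-{z}. z - w)) (\<Prod>w\<in>R-{z}. [:-w, 1:])"

text \<open>Writes each coefficient as a fixed linear combination of the values on \<open>R\<close>.
  With conjugates as nodes this controls coefficients both in size and in their
  denominators.\<close>

lemma lagrange_interpolation: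
  assumes R: "finite R" and deg: "degree P < card R"
  shows "P = (\<Sum>z\<in>R. smult (poly P z) (lagrange R z))"
proof (rule ccontr)
  define D where "D = P - (\<Sum>z\<in>R. smult (poly P z) (lagrange R z))"
  assume "P \<noteq> (\<Sum>z\<in>R. smult (poly P z) (lagrange R z))"
  hence D0: "D \<noteq> 0" by (simp add: D_def)
  have dl: "degree (lagrange R z) < card R" if "z \<in> R" for z
  proof -
    have "degree (lagrange R z) \<le> degree (\<Prod>w\<in>R-{z}. [:-w, 1:])"
      unfolding lagrange_def by (rule degree_smult_le)
    also have "\<dots> \<le> (\<Sum>w\<in>R-{z}. degree [:-w, 1:])"
      using R degree_prod_sum_le[of "R - {z}" "\<lambda>w. [:-w, 1:]"] by simp
    also have "\<dots> < card R" using that R card_gt_0_iff[of R] by auto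
    finally show ?thesis .
  qed
  have "degree D < card R"
    unfolding D_def using dl deg
    by (intro degree_diff_less degree_sum_less le_less_trans[OF degree_smult_le]) auto
  moreover have "card R \<le> card {z. poly D z = 0}"
  proof (rule card_mono[OF poly_roots_finite[OF D0]], safe)
    fix w assume w: "w \<in> R"
    have lv: "poly (lagrange R z) w = (if z = w then 1 else 0)" if "z \<in> R" for z
      using R w that by (auto simp: lagrange_def poly_prod)
    have "(\<Sum>z\<in>R. poly P z * poly (lagrange R z) w) = (\<Sum>z\<in>R. if z = w then poly P z else 0)"
      by (intro sum.cong refl) (simp add: lv)
    thus "poly D w = 0" using R w by (simp add: D_def poly_sum)
  qed
  moreover have "card {z. poly D z = 0} \<le> degree D" by (rule card_poly_roots_bound[OF D0])
  ultimately show False by simp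
qed

lemma finite_bounded_int_polys:
  "finite {h::int poly. degree h \<le> n \<and> (\<forall>i. \<bar>coeff h i\<bar> \<le> M)}" (is "finite ?A")
proof -
  have "?A \<subseteq> Poly ` {xs. set xs \<subseteq> {-M..M} \<and> length xs \<le> Suc n}"
  proof
    fix h assume h: "h \<in> ?A"
    have "set (coeffs h) \<subseteq> {-M..M}"
    proof
      fix c assume "c \<in> set (coeffs h)"
      then obtain i where "c = coeff h i" by (auto simp: coeffs_def split: if_splits)
      hence "\<bar>c\<bar> \<le> M" using h by auto
      thus "c \<in> {-M..M}" by auto
    qed
    moreover have "length (coeffs h) \<le> Suc n" using h by (cases "h = 0") (auto simp: length_coeffs)
    ultimately show "h \<in> Poly ` {xs. set xs \<subseteq> {-M..M} \<and> length xs \<le> Suc n}"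
      by (intro image_eqI[of _ _ "coeffs h"]) auto
  qed
  thus ?thesis using finite_lists_length_le[of "{-M..M}" "Suc n"] finite_surj by blast
qed

text \<open>The remainders of the powers of the variable modulo the monic \<open>g\<close> have
  values of norm at most 1 at all conjugates, so interpolation bounds their integer coefficients.
  Two remainders therefore coincide, and with them two powers of \<open>x\<close>.\<close>

lemma kronecker:
  assumes g: "minpol g x" and lc: "lead_coeff g = 1" and le: "\<And>z. z \<in> croots g \<Longrightarrow> norm z \<le> 1"
    and x0: "x \<noteq> 0"
  shows "\<exists>n>0. x ^ n = 1"
proof -
  define R where "R = croots g"
  have R: "finite R" "card R = degree g" by (simp_all add: R_def finite_croots[OF g] card_croots[OF g])
  have "\<exists>r. degree r < degree g \<and> (\<forall>z\<in>R. poly (cpoly r) z = z ^ k)" for k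
  proof -
    obtain q r where qr: "pseudo_divmod (monom 1 k) g = (q, r)" by force
    have d: "monom 1 k = g * q + r" "r = 0 \<or> degree r < degree g"
      using pseudo_divmod[OF minpol_nz[OF g] qr] lc by simp_all
    have "poly (cpoly r) z = z ^ k" if "z \<in> R" for z
    proof -
      have "poly (cpoly (monom 1 k)) z = poly (cpoly r) z"
        using that unfolding d(1) by (simp add: cpoly_add cpoly_mult R_def croots_def)
      thus ?thesis by (simp add: map_poly_monom poly_monom)
    qed
    thus ?thesis using d(2) minpol_degree[OF g] by (intro exI[of _ r]) auto
  qed
  then obtain r where r: "\<And>k. degree (r k) < degree g" "\<And>k z. z \<in> R \<Longrightarrow> poly (cpoly (r k)) z = z ^ k"
    by metis
  define B where "B = (\<Sum>z\<in>R. \<Sum>i\<le>degree g. norm (coeff (lagrange R z) i))"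
  have "\<bar>coeff (r k) i\<bar> \<le> \<lceil>B\<rceil>" for k i
  proof (cases "i \<le> degree g")
    case False
    hence "coeff (r k) i = 0" using r(1)[of k] by (intro coeff_eq_0) simp
    moreover have "B \<ge> 0" by (auto simp: B_def intro!: sum_nonneg)
    ultimately show ?thesis by (simp add: le_of_int_ceiling order_trans[OF _ ceiling_mono[of 0 B]])
  next
    case True
    have "of_int (coeff (r k) i) = coeff (cpoly (r k)) i" by (simp add: coeff_cpoly)
    also have "cpoly (r k) = (\<Sum>z\<in>R. smult (poly (cpoly (r k)) z) (lagrange R z))"
      using r(1)[of k] R by (intro lagrange_interpolation) (auto simp: degree_cpoly)
    also have "coeff \<dots> i = (\<Sum>z\<in>R. z ^ k * coeff (lagrange R z) i)"
      by (simp add: coeff_sum r(2))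
    finally have "norm (of_int (coeff (r k) i) :: complex) \<le> (\<Sum>z\<in>R. norm (z ^ k * coeff (lagrange R z) i))"
      by (simp add: norm_sum)
    also have "\<dots> \<le> (\<Sum>z\<in>R. norm (coeff (lagrange R z) i))"
      using le by (intro sum_mono) (auto simp: norm_mult norm_power R_def intro!: mult_left_le_one_le power_le_one)
    also have "\<dots> \<le> B"
      unfolding B_def using True by (intro sum_mono member_le_sum) auto
    finally have "real_of_int \<bar>coeff (r k) i\<bar> \<le> B" by simp
    thus ?thesis by linarith
  qed
  hence "range r \<subseteq> {h. degree h \<le> degree g \<and> (\<forall>i. \<bar>coeff h i\<bar> \<le> \<lceil>B\<rceil>)}"
    using r(1) by (auto simp: less_imp_le)
  hence "finite (range r)" using finite_bounded_int_polys finite_subset by blast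
  hence "\<not> inj r" using finite_imageD[of r UNIV] by auto
  then obtain i j where "i < j" "r i = r j" unfolding inj_def by (metis linorder_neqE_nat)
  hence "x ^ i = x ^ j" using r(2)[of x] minpol_croots[OF g] by (metis R_def)
  moreover have "x ^ j = x ^ i * x ^ (j - i)" using \<open>i < j\<close> by (simp flip: power_add)
  ultimately have "x ^ (j - i) = 1" using x0 by simp
  thus ?thesis using \<open>i < j\<close> by (intro exI[of _ "j - i"]) auto
qed

text \<open>The leading coefficient and each conjugate contribute a nonnegative term, so all these
  terms vanish, which is what Kronecker's theorem asks for.\<close>

lemma root_of_unity_if_height_le_0:
  assumes g: "minpol g x" and "x \<noteq> 0" and h: "mahler_height g \<le> 0"
  shows "\<exists>n>0. x ^ n = 1"
proof (rule kronecker[OF g])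
  have S: "(\<Sum>z\<in>croots g. log_plus (norm z)) \<ge> 0" by (intro sum_nonneg log_plus_nonneg)
  have l: "lead_coeff g \<ge> 1" using minpol_lead[OF g] by linarith
  hence l': "ln (lead_coeff g) \<ge> 0" by simp
  have le: "ln (lead_coeff g) + (\<Sum>z\<in>croots g. log_plus (norm z)) \<le> 0"
    using h minpol_degree[OF g] by (simp add: mahler_height_def divide_le_0_iff)
  hence "ln (lead_coeff g) \<le> 0" using S by linarith
  thus "lead_coeff g = 1" using l by (simp add: ln_le_zero_iff)
  show "norm z \<le> 1" if "z \<in> croots g" for z
  proof -
    have "log_plus (norm z) \<le> (\<Sum>z\<in>croots g. log_plus (norm z))"
      using that finite_croots[OF g] by (intro member_le_sum log_plus_nonneg)
    hence "log_plus (norm z) \<le> 0" using le l' by linarith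
    hence "ln (max 1 (norm z)) \<le> 0" by (simp add: log_plus_def)
    hence "max 1 (norm z) \<le> 1" by (subst (asm) ln_le_zero_iff) auto
    thus ?thesis by simp
  qed
qed fact

section \<open>Rational primes below a valuation ring\<close>

lemma valring_prime_exists:
  fixes n :: int
  assumes W: "valring F W" and "n \<noteq> 0" "inverse (of_int n) \<notin> (W :: complex set)"
  shows "\<exists>p. prime p \<and> p dvd n \<and> inverse (of_int p) \<notin> W"
  using assms(2,3)
proof (induction "nat \<bar>n\<bar>" arbitrary: n rule: less_induct)
  case less
  note sub = valring_subring[OF W]
  have "\<not> is_unit n"
  proof
    assume "is_unit n"
    hence "n = 1 \<or> n = -1" by auto
    thus False using less.prems subring_one[OF sub] subring_uminus[OF sub subring_one[OF sub]] by auto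
  qed
  then obtain p where p: "prime p" "p dvd n" using less.prems prime_divisor_exists by blast
  then obtain m where m: "n = p * m" by blast
  have p2: "p \<ge> 2" using p(1) by (rule prime_ge_2_int)
  have m0: "m \<noteq> 0" using m less.prems by auto
  show ?case
  proof (cases "inverse (of_int p) \<in> W")
    case True
    have "inverse (of_int m) \<notin> W"
    proof
      assume "inverse (of_int m) \<in> W"
      hence "inverse (of_int p) * inverse (of_int m) \<in> W" using True by (intro subring_mult[OF sub])
      thus False using less.prems m by simp
    qed
    moreover have "nat \<bar>m\<bar> < nat \<bar>n\<bar>" using m m0 p2 by (auto simp: abs_mult)
    ultimately show ?thesis using less.hyps[of m] m0 m by (metis dvd_mult)
  qed (use p in auto)
qed

lemma valring_coprime_unit:
  fixes p c :: int
  assumes W: "valring F (W :: complex set)" and p: "prime p" "inverse (of_int p) \<notin> W" and c: "\<not> p dvd c"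
  shows "inverse (of_int c) \<in> W"
proof (rule ccontr)
  note sub = valring_subring[OF W]
  assume n: "inverse (of_int c) \<notin> W"
  have m: "of_int c \<in> valmax W" "of_int p \<in> valmax W"
    using n p by (auto simp: valmax_def subring_of_int[OF sub])
  have "coprime p c" using p(1) c by (rule prime_imp_coprime)
  then obtain a b where ab: "a * p + b * c = 1" using bezout_int[of p c] by auto
  have "of_int a * of_int p + of_int b * of_int c \<in> valmax W"
    by (intro valmax_add[OF W] valmax_mult[OF sub] m subring_of_int[OF sub])
  hence "of_int (a * p + b * c) \<in> valmax W" by simp
  thus False using one_notin_valmax[OF sub] by (simp only: ab) simp
qed

section \<open>Finite places\<close>

text \<open>Finite places are extensional on the nonzero elements, so \<open>v 0\<close> carries no
  information and the rules below are restricted to nonzero arguments.\<close>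

locale place =
  fixes F :: "complex set" and v :: "complex \<Rightarrow> int"
  assumes F: "is_subfield F" and v: "v \<in> finite_places F"
begin

lemma sub: "is_subring F" using F by (rule subfield_subring)

lemma v_mult: "x \<in> F \<Longrightarrow> y \<in> F \<Longrightarrow> x \<noteq> 0 \<Longrightarrow> y \<noteq> 0 \<Longrightarrow> v (x * y) = v x + v y"
  and v_add: "x \<in> F \<Longrightarrow> y \<in> F \<Longrightarrow> x \<noteq> 0 \<Longrightarrow> y \<noteq> 0 \<Longrightarrow> x + y \<noteq> 0 \<Longrightarrow> min (v x) (v y) \<le> v (x + y)"
  and v_surj: "\<exists>x\<in>F. x \<noteq> 0 \<and> v x = k"
proof -
  show "x \<in> F \<Longrightarrow> y \<in> F \<Longrightarrow> x \<noteq> 0 \<Longrightarrow> y \<noteq> 0 \<Longrightarrow> v (x * y) = v x + v y"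
    and "x \<in> F \<Longrightarrow> y \<in> F \<Longrightarrow> x \<noteq> 0 \<Longrightarrow> y \<noteq> 0 \<Longrightarrow> x + y \<noteq> 0 \<Longrightarrow> min (v x) (v y) \<le> v (x + y)"
    using v unfolding finite_places_def by blast+
  have "k \<in> v ` (F - {0})" using v unfolding finite_places_def by blast
  thus "\<exists>x\<in>F. x \<noteq> 0 \<and> v x = k" by blast
qed

lemma v_one [simp]: "v 1 = 0"
  using v_mult[of 1 1] subring_one[OF sub] by simp

lemma v_inverse: "x \<in> F \<Longrightarrow> x \<noteq> 0 \<Longrightarrow> v (inverse x) = - v x"
  using v_mult[of x "inverse x"] subfield_inverse[OF F, of x] by simp

lemma v_divide: "x \<in> F \<Longrightarrow> y \<in> F \<Longrightarrow> x \<noteq> 0 \<Longrightarrow> y \<noteq> 0 \<Longrightarrow> v (x / y) = v x - v y"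
  by (simp add: divide_inverse v_mult v_inverse subfield_inverse[OF F])

lemma v_minus_one [simp]: "v (- 1) = 0"
  using v_mult[of "-1" "-1"] subring_uminus[OF sub subring_one[OF sub]] by simp

lemma v_uminus: "x \<in> F \<Longrightarrow> x \<noteq> 0 \<Longrightarrow> v (- x) = v x"
  using v_mult[of "- 1" x] subring_uminus[OF sub subring_one[OF sub]] by simp

lemma v_power: "x \<in> F \<Longrightarrow> x \<noteq> 0 \<Longrightarrow> v (x ^ n) = n * v x"
  by (induction n) (simp_all add: v_mult subring_power[OF sub] algebra_simps)

lemma v_add_strict:
  assumes "x \<in> F" "y \<in> F" "x \<noteq> 0" "y \<noteq> 0" "v x < v y"
  shows "x + y \<noteq> 0" "v (x + y) = v x"
proof -
  show nz: "x + y \<noteq> 0"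
  proof
    assume "x + y = 0"
    hence "y = - x" by (simp add: add_eq_0_iff)
    thus False using assms v_uminus[of x] by simp
  qed
  have "v x \<le> v (x + y)" using v_add[OF assms(1-4) nz] assms(5) by simp
  moreover have "v (x + y) \<le> v x"
  proof (rule ccontr)
    assume "\<not> ?thesis"
    hence *: "v (x + y) > v x" by simp
    have "min (v (x + y)) (v (- y)) \<le> v (x + y + (- y))"
      using assms nz by (intro v_add subring_add[OF sub] subring_uminus[OF sub]) auto
    thus False using * assms v_uminus[of y] by simp
  qed
  ultimately show "v (x + y) = v x" by simp
qed

lemma valring_place: "valring F (valuation_ring F v)"
  unfolding valring_def is_subring_def
proof (intro conjI ballI)
  fix x y assume "x \<in> valuation_ring F v" "y \<in> valuation_ring F v"
  hence xy: "x \<in> F" "y \<in> F" "x = 0 \<or> v x \<ge> 0" "y = 0 \<or> v y \<ge> 0" by (auto simp: valuation_ring_def)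
  show "x * y \<in> valuation_ring F v"
    using xy by (cases "x = 0 \<or> y = 0") (auto simp: valuation_ring_def v_mult subring_mult[OF sub])
  have "v (x - y) \<ge> 0" if "x - y \<noteq> 0"
  proof (cases "x = 0 \<or> y = 0")
    case True
    thus ?thesis using xy that by (auto simp: v_uminus)
  next
    case False
    thus ?thesis using v_add[of x "- y"] xy that v_uminus[of y] subring_uminus[OF sub, of y] by auto
  qed
  thus "x - y \<in> valuation_ring F v"
    using xy by (auto simp: valuation_ring_def subring_diff[OF sub])
next
  fix x assume "x \<in> F"
  thus "x \<in> valuation_ring F v \<or> inverse x \<in> valuation_ring F v"
    by (cases "x = 0") (auto simp: valuation_ring_def v_inverse subfield_inverse[OF F])
qed (auto simp: F valuation_ring_def subring_one[OF sub])

lemma valmax_place: "valmax (valuation_ring F v) = valuation_ideal F v"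
  by (auto simp: valmax_def valuation_ring_def valuation_ideal_def v_inverse subfield_inverse[OF F])

lemma v_of_int: "n \<noteq> 0 \<Longrightarrow> v (of_int n) \<ge> 0"
  using subring_of_int[OF valring_subring[OF valring_place], of n] by (auto simp: valuation_ring_def)

lemma inverse_of_int_notin: "n \<noteq> 0 \<Longrightarrow> inverse (of_int n) \<notin> valuation_ring F v \<longleftrightarrow> v (of_int n) > 0"
  by (auto simp: valuation_ring_def v_inverse subring_of_int[OF sub] subfield_inverse[OF F])

lemma prime_divisor_positive:
  fixes n :: int
  assumes "n \<noteq> 0" "v (of_int n) > 0"
  shows "\<exists>p. prime p \<and> p dvd n \<and> v (of_int p) > 0"
proof -
  have "inverse (of_int n) \<notin> valuation_ring F v" using assms inverse_of_int_notin by blast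
  then obtain p where "prime p" "p dvd n" "inverse (of_int p) \<notin> valuation_ring F v"
    using valring_prime_exists[OF valring_place assms(1)] by blast
  thus ?thesis using inverse_of_int_notin[of p] by auto
qed

lemma v_coprime_to_prime:
  fixes p n :: int
  assumes p: "prime p" "v (of_int p) > 0" and n: "\<not> p dvd n"
  shows "v (of_int n) = 0"
proof -
  have "p \<noteq> 0" "n \<noteq> 0" using p(1) n by auto
  thus ?thesis
    using valring_coprime_unit[OF valring_place p(1) _ n] inverse_of_int_notin[of p] inverse_of_int_notin[of n]
      v_of_int[of n] p(2) by auto
qed

end

section \<open>Independence of finite places and weak approximation\<close>

lemma places_eqI:
  assumes F: "is_subfield F" and v: "v \<in> finite_places F" and w: "w \<in> finite_places F"
    and le: "valuation_ring F v \<subseteq> valuation_ring F w"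
  shows "v = w"
proof -
  interpret v: place F v by unfold_locales fact+
  interpret w: place F w by unfold_locales fact+
  have ge: "w x \<ge> 0" if "x \<in> F" "x \<noteq> 0" "v x \<ge> 0" for x
    using that le by (auto simp: valuation_ring_def)
  have 0: "w x = 0" if "x \<in> F" "x \<noteq> 0" "v x = 0" for x
    using ge[of x] ge[of "inverse x"] that v.v_inverse[of x] w.v_inverse[of x] subfield_inverse[OF F, of x]
    by auto
  obtain \<pi> where \<pi>: "\<pi> \<in> F" "\<pi> \<noteq> 0" "v \<pi> = 1" using v.v_surj[of 1] by auto
  \<comment> \<open>A power of \<pi> reduces this to elements of value 0 at \<open>v\<close>, which
    are integral at \<open>w\<close> together with their inverses. So \<open>w\<close> is a multiple
    of \<open>v\<close>, and surjectivity of \<open>w\<close> makes the factor 1.\<close>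
  have lin: "w x = v x * w \<pi>" if x: "x \<in> F" "x \<noteq> 0" for x
  proof (cases "v x \<ge> 0")
    case True
    hence "w (x / \<pi> ^ nat (v x)) = 0"
      using x \<pi> by (intro 0) (auto simp: v.v_divide v.v_power subring_power[OF v.sub] intro: subfield_divide[OF F])
    thus ?thesis using x \<pi> True by (simp add: w.v_divide w.v_power subring_power[OF v.sub])
  next
    case False
    hence "w (x * \<pi> ^ nat (- v x)) = 0"
      using x \<pi> by (intro 0) (auto simp: v.v_mult v.v_power subring_power[OF v.sub] intro: subring_mult[OF v.sub])
    thus ?thesis using x \<pi> False by (simp add: w.v_mult w.v_power subring_power[OF v.sub])
  qed
  obtain x where "x \<in> F" "x \<noteq> 0" "w x = 1" using w.v_surj[of 1] by auto
  hence "v x * w \<pi> = 1" using lin by metis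
  hence "w \<pi> = 1" using ge[OF \<pi>(1,2)] \<pi>(3) by (auto simp: zmult_eq_1_iff)
  hence "v x = w x" if "x \<in> F - {0}" for x using lin that by auto
  thus "v = w" using v w by (intro extensionalityI[of _ "F - {0}"]) (auto simp: finite_places_def)
qed

lemma places_separate_two:
  assumes F: "is_subfield F" and v: "v \<in> finite_places F" and w: "w \<in> finite_places F" and ne: "v \<noteq> w"
  shows "\<exists>z\<in>F. z \<noteq> 0 \<and> v z < 0 \<and> w z > 0"
proof -
  interpret v: place F v by unfold_locales fact+
  interpret w: place F w by unfold_locales fact+
  obtain x where x: "x \<in> F" "x \<noteq> 0" "v x \<ge> 0" "w x < 0"
  proof -
    have "\<not> valuation_ring F v \<subseteq> valuation_ring F w" using places_eqI[OF F v w] ne by blast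
    then obtain x where "x \<in> valuation_ring F v" "x \<notin> valuation_ring F w" by blast
    thus ?thesis using that[of x] by (auto simp: valuation_ring_def not_le)
  qed
  obtain y where y: "y \<in> F" "y \<noteq> 0" "w y \<ge> 0" "v y < 0"
  proof -
    have "\<not> valuation_ring F w \<subseteq> valuation_ring F v" using places_eqI[OF F w v] ne by blast
    then obtain y where "y \<in> valuation_ring F w" "y \<notin> valuation_ring F v" by blast
    thus ?thesis using that[of y] by (auto simp: valuation_ring_def not_le)
  qed
  show ?thesis
    using x y by (intro bexI[of _ "y / x"]) (auto simp: v.v_divide w.v_divide intro: subfield_divide[OF F])
qed

text \<open>Induction on \<open>S\<close>: \<open>y\<close> is right at the old places,
  \<open>z\<close> separates \<open>v\<close> from the new place \<open>w\<close>, and the sign of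
  \<open>w y\<close> decides how the two are combined.\<close>

lemma places_separate:
  assumes F: "is_subfield F" and v: "v \<in> finite_places F"
    and S: "finite S" "S \<subseteq> finite_places F" "v \<notin> S"
  shows "\<exists>y\<in>F. y \<noteq> 0 \<and> v y < 0 \<and> (\<forall>w\<in>S. w y > 0)"
  using S
proof (induction S rule: finite_induct)
  case empty
  interpret v: place F v by unfold_locales fact+
  show ?case using v.v_surj[of "-1"] by auto
next
  case (insert w S)
  interpret v: place F v by unfold_locales fact+
  interpret w: place F w using F insert.prems by unfold_locales auto
  obtain y where y: "y \<in> F" "y \<noteq> 0" "v y < 0" "\<And>u. u \<in> S \<Longrightarrow> u y > 0" using insert by auto
  obtain z where z: "z \<in> F" "z \<noteq> 0" "v z < 0" "w z > 0"
    using places_separate_two[OF F v, of w] insert.prems by auto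
  \<comment> \<open>Large enough for \<open>N\<close> times a positive value to outweigh
    \<open>u z\<close> at every place of \<open>S\<close>.\<close>
  define N where "N = Suc (nat (\<Sum>u\<in>S. \<bar>u z\<bar>))"
  have N0: "N > 0" by (simp add: N_def)
  have N: "int N * u y + u z > 0" if "u \<in> S" for u
  proof -
    have "\<bar>u z\<bar> \<le> (\<Sum>u\<in>S. \<bar>u z\<bar>)" using that insert.hyps by (intro member_le_sum) auto
    hence "int N > \<bar>u z\<bar>" by (simp add: N_def)
    moreover have "int N * u y \<ge> int N * 1" using y(4)[OF that] by (intro mult_left_mono) auto
    ultimately show ?thesis by linarith
  qed
  have yN: "y ^ N \<in> F" "y ^ N \<noteq> 0" using y by (auto intro: subring_power[OF v.sub])
  consider "w y > 0" | "w y = 0" | "w y < 0" by linarith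
  thus ?case
  proof cases
    case 1
    thus ?thesis using y by auto
  next
    case 2
    have pl: "u (y ^ N * z) = int N * u y + u z" if "u \<in> finite_places F" for u
    proof -
      interpret u: place F u using F that by unfold_locales auto
      show ?thesis
        using u.v_mult[OF yN(1) z(1) yN(2) z(2)] u.v_power[OF y(1,2), of N] by simp
    qed
    have "v (y ^ N * z) < 0"
      using pl[OF v] y z mult_nonneg_nonpos[of "int N" "v y"] by simp
    moreover have "w (y ^ N * z) > 0" using pl[of w] 2 z insert.prems by simp
    moreover have "u (y ^ N * z) > 0" if "u \<in> S" for u using pl[of u] N[OF that] insert.prems that by auto
    ultimately show ?thesis
      using y z yN by (intro bexI[of _ "y ^ N * z"]) (auto intro: subring_mult[OF v.sub])
  next
    case 3
    \<comment> \<open>The factor \<open>y ^ N / (1 + y ^ N)\<close> has value 0 at a pole of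
      \<open>y\<close> and \<open>N * u y\<close> at a zero, so it repairs \<open>z\<close> on
      \<open>S\<close> without disturbing it at \<open>v\<close> and \<open>w\<close>.\<close>
    have neg: "1 + y ^ N \<noteq> 0 \<and> u (y ^ N / (1 + y ^ N) * z) = u z"
      if "u \<in> finite_places F" "u y < 0" for u
    proof -
      interpret u: place F u using F that by unfold_locales auto
      have "u (y ^ N) < u 1" using y that by (simp add: u.v_power N0 mult_pos_neg)
      from u.v_add_strict[OF yN(1) subring_one[OF u.sub] yN(2) _ this]
      have *: "1 + y ^ N \<noteq> 0" "u (1 + y ^ N) = u (y ^ N)" by (auto simp: add.commute)
      have y1: "1 + y ^ N \<in> F" using yN by (intro subring_add[OF u.sub] subring_one[OF u.sub])
      show ?thesis
        using u.v_mult[OF subfield_divide[OF F yN(1) y1] z(1) _ z(2)] u.v_divide[OF yN(1) y1 yN(2)] * yN(2)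
        by simp
    qed
    have pos: "u (y ^ N / (1 + y ^ N) * z) = int N * u y + u z"
      if "u \<in> finite_places F" "u y > 0" for u
    proof -
      interpret u: place F u using F that by unfold_locales auto
      have "u 1 < u (y ^ N)" using y that by (simp add: u.v_power N0)
      from u.v_add_strict[OF subring_one[OF u.sub] yN(1) _ yN(2) this]
      have *: "1 + y ^ N \<noteq> 0" "u (1 + y ^ N) = 0" by auto
      have y1: "1 + y ^ N \<in> F" using yN by (intro subring_add[OF u.sub] subring_one[OF u.sub])
      show ?thesis
        using u.v_mult[OF subfield_divide[OF F yN(1) y1] z(1) _ z(2)] u.v_divide[OF yN(1) y1 yN(2)] * yN(2)
        by (simp add: u.v_power[OF y(1,2)])
    qed
    have "1 + y ^ N \<in> F" using yN by (intro subring_add[OF v.sub] subring_one[OF v.sub])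
    moreover have "1 + y ^ N \<noteq> 0" using neg[OF v y(3)] by simp
    moreover have "w (y ^ N / (1 + y ^ N) * z) > 0" using neg[of w] 3 z insert.prems by simp
    moreover have "v (y ^ N / (1 + y ^ N) * z) < 0" using neg[OF v y(3)] z by simp
    moreover have "u (y ^ N / (1 + y ^ N) * z) > 0" if "u \<in> S" for u
      using pos[of u] N[OF that] y(4)[OF that] insert.prems that by auto
    ultimately show ?thesis
      using y z yN by (intro bexI[of _ "y ^ N / (1 + y ^ N) * z"])
        (auto intro: subring_mult[OF v.sub] subfield_divide[OF F])
  qed
qed

text \<open>\<open>y / (1 + y)\<close> has value 0 where \<open>y\<close> has a pole and keeps the
  value of \<open>y\<close> where that is positive.\<close>

lemma places_approximation:
  assumes F: "is_subfield F" and v: "v \<in> finite_places F"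
    and S: "finite S" "S \<subseteq> finite_places F" "v \<notin> S"
  shows "\<exists>y\<in>F. y \<noteq> 0 \<and> v y = 0 \<and> (\<forall>w\<in>S. w y > 0)"
proof -
  interpret v: place F v by unfold_locales fact+
  obtain y where y: "y \<in> F" "y \<noteq> 0" "v y < 0" "\<And>w. w \<in> S \<Longrightarrow> w y > 0"
    using places_separate[OF assms] by auto
  have y1: "1 + y \<in> F" using y by (intro subring_add[OF v.sub] subring_one[OF v.sub])
  have "1 + y \<noteq> 0 \<and> v (1 + y) = v y"
    using v.v_add_strict[OF y(1) subring_one[OF v.sub] y(2)] y(3) by (auto simp: add.commute)
  moreover have "w (y / (1 + y)) > 0" if "w \<in> S" for w
  proof -
    interpret w: place F w using F that S by unfold_locales auto
    have "1 + y \<noteq> 0 \<and> w (1 + y) = 0"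
      using w.v_add_strict[OF subring_one[OF w.sub] y(1) _ y(2)] y(4)[OF that] by simp
    thus ?thesis using y y1 y(4)[OF that] by (simp add: w.v_divide)
  qed
  ultimately show ?thesis
    using y y1 by (intro bexI[of _ "y / (1 + y)"]) (auto simp: v.v_divide intro: subfield_divide[OF F])
qed

text \<open>Given more than \<open>card B\<close> places, approximation yields elements
  \<open>u i\<close> that are units at \<open>f i\<close> and have positive value at the other
  chosen places. They satisfy a relation in which some coefficient \<open>c i\<close> is prime to
  \<open>p\<close>; at \<open>f i\<close> its term has value 0 while all others have positive
  value.\<close>

lemma card_places_above_prime:
  fixes p :: int
  assumes F: "is_subfield F" and B: "finite B" "F \<subseteq> ratvs.span B" and p: "prime p"
    and S: "finite S" "S \<subseteq> finite_places F" "\<And>v. v \<in> S \<Longrightarrow> v (of_int p) > 0"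
  shows "card S \<le> card B"
proof (rule ccontr)
  assume "\<not> ?thesis"
  hence "card {..card B} \<le> card S" by simp
  then obtain f where f: "inj_on f {..card B}" "f ` {..card B} \<subseteq> S"
    using card_le_inj[of "{..card B}" S] S(1) by auto
  define T where "T = f ` {..card B}"
  have T: "finite T" "T \<subseteq> finite_places F" using f S by (auto simp: T_def)
  have "\<exists>y\<in>F. y \<noteq> 0 \<and> f i y = 0 \<and> (\<forall>w\<in>T - {f i}. w y > 0)" if "i \<le> card B" for i
    using T that by (intro places_approximation[OF F]) (auto simp: T_def)
  then obtain u where u: "\<And>i. i \<le> card B \<Longrightarrow> u i \<in> F \<and> u i \<noteq> 0 \<and> f i (u i) = 0 \<and> (\<forall>w\<in>T - {f i}. w (u i) > 0)"
    by metis
  obtain c where c: "\<exists>i\<le>card B. \<not> p dvd c i" "(\<Sum>i\<le>card B. of_int (c i) * u i) = 0"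
    using int_relation_prime[OF B(1) _ p, of u] u B(2) by blast
  then obtain i where i: "i \<le> card B" "\<not> p dvd c i" by auto
  have fi: "f i \<in> S" using f i by auto
  interpret v: place F "f i" using F S fi by unfold_locales auto
  note W = v.valring_place
  have ci: "f i (of_int (c i)) = 0" using v.v_coprime_to_prime[OF p S(3)[OF fi] i(2)] .
  have ci0: "c i \<noteq> 0" using i(2) by auto
  have "of_int (c j) * u j \<in> valuation_ideal F (f i)" if "j \<in> {..card B} - {i}" for j
    unfolding v.valmax_place[symmetric]
  proof (intro valmax_mult valring_subring[OF W] subring_of_int)
    have "f i \<noteq> f j" using that i f(1) by (auto simp: inj_on_def)
    hence "f i (u j) > 0" using u[of j] that i by (auto simp: T_def)
    thus "u j \<in> valmax (valuation_ring F (f i))"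
      using u[of j] that unfolding v.valmax_place by (auto simp: valuation_ideal_def)
  qed
  hence "(\<Sum>j\<in>{..card B}-{i}. of_int (c j) * u j) \<in> valuation_ideal F (f i)"
    unfolding v.valmax_place[symmetric] by (intro valmax_sum[OF W]) auto
  moreover have "(\<Sum>j\<in>{..card B}-{i}. of_int (c j) * u j) = - (of_int (c i) * u i)"
    using c(2) i by (simp add: sum.remove[of _ i] add_eq_0_iff)
  moreover have "of_int (c i) * u i \<noteq> 0" using u[OF i(1)] i(2) by auto
  moreover have "f i (- (of_int (c i) * u i)) = 0"
    using u[OF i(1)] ci ci0
    by (subst v.v_uminus) (auto simp: v.v_mult subring_of_int[OF v.sub] intro: subring_mult[OF v.sub])
  ultimately show False by (auto simp: valuation_ideal_def)
qed

lemma finite_places_above: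
  fixes n :: int
  assumes F: "is_subfield F" and B: "finite B" "F \<subseteq> ratvs.span B" and n: "n \<noteq> 0"
  shows "finite {v \<in> finite_places F. v (of_int n) > 0}"
proof (rule finite_subset)
  show "{v \<in> finite_places F. v (of_int n) > 0} \<subseteq>
      (\<Union>p\<in>{p. prime p \<and> p dvd n}. {v \<in> finite_places F. v (of_int p) > 0})"
  proof
    fix v assume v: "v \<in> {v \<in> finite_places F. v (of_int n) > 0}"
    then interpret v: place F v using F by unfold_locales auto
    show "v \<in> (\<Union>p\<in>{p. prime p \<and> p dvd n}. {v \<in> finite_places F. v (of_int p) > 0})"
      using v.prime_divisor_positive[OF n] v by auto
  qed
  have "finite {p::int. prime p \<and> p dvd n}"
    by (rule finite_subset[OF _ finite_divisors_int[OF n]]) auto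
  moreover have "finite {v \<in> finite_places F. v (of_int p) > 0}" if "prime p" for p :: int
  proof (rule ccontr)
    assume "infinite {v \<in> finite_places F. v (of_int p) > 0}"
    then obtain S where "finite S" "card S = Suc (card B)" "S \<subseteq> {v \<in> finite_places F. v (of_int p) > 0}"
      using infinite_arbitrarily_large by blast
    thus False using card_places_above_prime[OF F B \<open>prime p\<close>, of S] by auto
  qed
  ultimately show "finite (\<Union>p\<in>{p. prime p \<and> p dvd n}. {v \<in> finite_places F. v (of_int p) > 0})"
    by blast
qed

section \<open>Residue fields of finite places\<close>

context place
begin

text \<open>For \<open>x\<close> of value -1, the leading coefficient of its minimal polynomial
  makes \<open>x\<close> integral and so has positive value itself.\<close>

lemma prime_below:
  assumes alg: "F \<subseteq> Qbar"
  shows "\<exists>p::int. prime p \<and> v (of_int p) > 0"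
proof -
  obtain x where x: "x \<in> F" "x \<noteq> 0" "v x = -1" using v_surj by blast
  obtain f where f: "minpol f x" using x alg minpol_exists by (auto simp: Qbar_def)
  define a where "a = lead_coeff f"
  have a: "a \<noteq> 0" using minpol_nz[OF f] by (simp add: a_def)
  have "lead_coeff (cpoly f) * x \<in> valuation_ring F v"
    using subring_of_int[OF valring_subring[OF valring_place]] minpol_eval[OF f]
    by (intro valring_lead_mult[OF valring_place x(1)]) (auto simp: coeff_cpoly)
  hence "v (of_int a * x) \<ge> 0" using a x by (auto simp: valuation_ring_def a_def coeff_cpoly degree_cpoly)
  hence "v (of_int a) > 0" using a x by (simp add: v_mult subring_of_int[OF sub])
  thus ?thesis using prime_divisor_positive[OF a] by blast
qed

text \<open>Integral elements with residues independent over the field of \<open>p\<close> elements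
  are independent over the rationals, since a rational relation can be made nontrivial modulo
  \<open>p\<close>. So the residue field has dimension at most \<open>card B\<close> over that
  field.\<close>

lemma finite_residues:
  assumes alg: "F \<subseteq> Qbar" and B: "finite B" "F \<subseteq> ratvs.span B"
  shows "\<exists>R. finite R \<and> (\<forall>x\<in>valuation_ring F v. \<exists>r\<in>R. x - r \<in> valuation_ideal F v)"
proof -
  define A where "A = valuation_ring F v"
  define m where "m = valuation_ideal F v"
  have W: "valring F A" and mA: "valmax A = m" by (simp_all add: A_def m_def valring_place valmax_place)
  note subA = valring_subring[OF W]
  obtain p :: int where p: "prime p" "v (of_int p) > 0" using prime_below[OF alg] by blast
  have pm: "of_int p \<in> m" using p by (auto simp: m_def valuation_ideal_def subring_of_int[OF sub])
  \<comment> \<open>Independence of \<open>t\<close> residues, phrased with integer coefficients in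
    place of a vector space structure on the residue field.\<close>
  define P where "P t \<longleftrightarrow> (\<exists>u. (\<forall>i<t. u i \<in> A) \<and>
      (\<forall>c::nat \<Rightarrow> int. (\<Sum>i<t. of_int (c i) * u i) \<in> m \<longrightarrow> (\<forall>i<t. p dvd c i)))" for t :: nat
  have "P 0" by (simp add: P_def)
  moreover have "t \<le> card B" if Pt: "P t" for t
  proof (rule ccontr)
    assume t: "\<not> t \<le> card B"
    obtain u where u: "\<And>i. i < t \<Longrightarrow> u i \<in> A"
        "\<And>c::nat \<Rightarrow> int. (\<Sum>i<t. of_int (c i) * u i) \<in> m \<Longrightarrow> \<forall>i<t. p dvd c i"
      using Pt by (auto simp: P_def)
    have "u i \<in> ratvs.span B" if "i \<le> card B" for i
      using u(1)[of i] t that B(2) valring_subset[OF W] by auto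
    then obtain c where c: "\<exists>i\<le>card B. \<not> p dvd c i" "(\<Sum>i\<le>card B. of_int (c i) * u i) = 0"
      using int_relation_prime[OF B(1) _ p(1), of u] by blast
    define c' where "c' i = (if i \<le> card B then c i else 0)" for i
    have "(\<Sum>i<t. of_int (c' i) * u i) = (\<Sum>i\<le>card B. of_int (c i) * u i)"
      using t by (intro sum.mono_neutral_cong_right) (auto simp: c'_def)
    also have "\<dots> \<in> m" using c(2) zero_in_valmax[OF subA] mA by simp
    finally have "\<forall>i<t. p dvd c' i" by (rule u(2))
    moreover obtain i where i: "i \<le> card B" "\<not> p dvd c i" using c(1) by auto
    ultimately have "p dvd c' i" using t by simp
    thus False using i by (simp add: c'_def)
  qed
  ultimately obtain t where t: "P t" "\<And>s. P s \<Longrightarrow> s \<le> t"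
    using GreatestI_nat[of P 0 "card B"] Greatest_le_nat[of P _ "card B"] by blast
  obtain u where u: "\<And>i. i < t \<Longrightarrow> u i \<in> A"
      "\<And>c::nat \<Rightarrow> int. (\<Sum>i<t. of_int (c i) * u i) \<in> m \<Longrightarrow> \<forall>i<t. p dvd c i"
    using t(1) by (auto simp: P_def)
  define R where "R = (\<lambda>a. \<Sum>i<t. of_int (a i) * u i) ` PiE {..<t} (\<lambda>_. {0..<p})"
  have "finite R" unfolding R_def by (intro finite_imageI finite_PiE) auto
  moreover have "\<exists>r\<in>R. x - r \<in> m" if x: "x \<in> A" for x
  proof -
    have "\<not> P (Suc t)" using t(2)[of "Suc t"] by auto
    moreover have "\<forall>i<Suc t. (u(t := x)) i \<in> A" using u(1) x by (auto simp: less_Suc_eq)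
    ultimately obtain c :: "nat \<Rightarrow> int" where c: "(\<Sum>i<Suc t. of_int (c i) * (u(t := x)) i) \<in> m"
        "\<exists>i<Suc t. \<not> p dvd c i"
      unfolding P_def by blast
    have c1: "(\<Sum>i<t. of_int (c i) * u i) + of_int (c t) * x \<in> m" using c(1) by simp
    have uO: "(\<Sum>i<t. of_int (a i) * u i) \<in> A" for a :: "nat \<Rightarrow> int"
      using u(1) by (intro subring_sum[OF subA] subring_mult[OF subA] subring_of_int[OF subA]) auto
    note neg = valmax_uminus[OF subA, unfolded mA]
    note add = valmax_add[OF W, unfolded mA]
    have pmul: "of_int (p * k) * y \<in> m" if "y \<in> A" for k y
    proof -
      have "(of_int k * y) * of_int p \<in> m"
        using pm that unfolding mA[symmetric] by (intro valmax_mult[OF subA] subring_mult[OF subA] subring_of_int[OF subA])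
      thus ?thesis by (simp add: mult_ac)
    qed
    have ct: "\<not> p dvd c t"
    proof
      assume "p dvd c t"
      then obtain k where k: "c t = p * k" by (auto elim: dvdE)
      have "(\<Sum>i<t. of_int (c i) * u i) + of_int (c t) * x + - (of_int (c t) * x) \<in> m"
        unfolding k by (intro add neg pmul x c1[unfolded k])
      hence "\<forall>i<t. p dvd c i" by (intro u(2)) simp
      thus False using c(2) \<open>p dvd c t\<close> by (auto simp: less_Suc_eq)
    qed
    hence "coprime (c t) p" using p(1) by (metis coprime_commute prime_imp_coprime)
    \<comment> \<open>\<open>e\<close> inverts \<open>c t\<close> modulo \<open>p\<close>, so the
      relation modulo the maximal ideal can be solved for \<open>x\<close>; reducing the
      coefficients modulo \<open>p\<close> then lands in \<open>R\<close>.\<close>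
    then obtain e k where ek: "e * c t + k * p = 1" using bezout_int[of "c t" p] by auto
    define a where "a i = (- e * c i) mod p" for i
    define a' where "a' = restrict a {..<t}"
    have "(\<Sum>i<t. of_int (a' i) * u i) \<in> R"
      unfolding R_def a'_def using p(1) prime_gt_0_int[of p]
      by (intro imageI, subst restrict_PiE_iff) (simp add: a_def)
    moreover have "x - (\<Sum>i<t. of_int (a' i) * u i) \<in> m"
    proof -
      define b where "b i = - ((- e * c i) div p)" for i
      have ai: "a i = - e * c i + p * b i" for i
        unfolding a_def b_def
        by (simp only: minus_mult_div_eq_mod[symmetric] mult_minus_right add_uminus_conv_diff)
      have "(\<Sum>i<t. of_int (a' i) * u i) = (\<Sum>i<t. of_int (a i) * u i)"
        by (intro sum.cong) (auto simp: a'_def)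
      also have "\<dots> = (\<Sum>i<t. (- of_int e) * (of_int (c i) * u i) + of_int p * (of_int (b i) * u i))"
        by (intro sum.cong refl) (simp only: ai of_int_add of_int_mult of_int_minus distrib_right mult.assoc)
      also have "\<dots> = - of_int e * (\<Sum>i<t. of_int (c i) * u i) + of_int p * (\<Sum>i<t. of_int (b i) * u i)"
        by (simp only: sum.distrib sum_distrib_left)
      finally have s: "(\<Sum>i<t. of_int (a' i) * u i) = - of_int e * (\<Sum>i<t. of_int (c i) * u i)
          + of_int (p * 1) * (\<Sum>i<t. of_int (b i) * u i)" by simp
      have xe: "of_int e * (of_int (c t) * x) + of_int (p * k) * x = x"
      proof -
        have "of_int (e * c t + k * p) * x = x" by (simp only: ek) simp
        thus ?thesis by (simp add: algebra_simps)
      qed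
      have "of_int e * ((\<Sum>i<t. of_int (c i) * u i) + of_int (c t) * x)
          + (of_int (p * k) * x + - (of_int (p * 1) * (\<Sum>i<t. of_int (b i) * u i)))
        = of_int e * (\<Sum>i<t. of_int (c i) * u i) + (of_int e * (of_int (c t) * x) + of_int (p * k) * x)
          - of_int (p * 1) * (\<Sum>i<t. of_int (b i) * u i)"
        by (simp only: distrib_left) simp
      also have "\<dots> = x - (\<Sum>i<t. of_int (a' i) * u i)" unfolding s xe by simp
      finally have "x - (\<Sum>i<t. of_int (a' i) * u i) = of_int e * ((\<Sum>i<t. of_int (c i) * u i) + of_int (c t) * x)
          + (of_int (p * k) * x + - (of_int (p * 1) * (\<Sum>i<t. of_int (b i) * u i)))" ..
      also have "\<dots> \<in> m"
      proof (intro add neg pmul x uO)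
        show "of_int e * ((\<Sum>i<t. of_int (c i) * u i) + of_int (c t) * x) \<in> m"
          using c1 unfolding mA[symmetric] by (intro valmax_mult[OF subA] subring_of_int[OF subA])
      qed
      finally show ?thesis .
    qed
    ultimately show ?thesis by blast
  qed
  ultimately show ?thesis unfolding A_def m_def by blast
qed

text \<open>The quotient must be known to be finite: for an infinite one \<open>card\<close> would
  be 0, and \<open>place_abs\<close> would degenerate.\<close>

lemma residue_field_reps:
  assumes alg: "F \<subseteq> Qbar" and B: "finite B" "F \<subseteq> ratvs.span B"
  shows "card (residue_field F v) > 0"
    and "\<exists>R. finite R \<and> card R \<le> card (residue_field F v) \<and> R \<subseteq> F \<and>
           (\<forall>x\<in>valuation_ring F v. \<exists>r\<in>R. x - r \<in> valuation_ideal F v)"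
proof -
  define A where "A = valuation_ring F v"
  define m where "m = valuation_ideal F v"
  have W: "valring F A" and mA: "valmax A = m" by (simp_all add: A_def m_def valring_place valmax_place)
  note subA = valring_subring[OF W]
  note neg = valmax_uminus[OF subA, unfolded mA]
  note add = valmax_add[OF W, unfolded mA]
  have m0: "0 \<in> m" using zero_in_valmax[OF subA] by (simp add: mA)
  define rel where "rel = {(x, y) \<in> A \<times> A. x - y \<in> m}"
  have rf: "residue_field F v = A // rel" by (simp add: residue_field_def A_def m_def rel_def)
  have eq: "equiv A rel"
  proof (rule equivI)
    show "rel \<subseteq> A \<times> A" by (auto simp: rel_def)
    show "refl_on A rel" using m0 by (auto simp: refl_on_def rel_def)
    show "sym rel" using neg by (auto simp: sym_def rel_def) (metis minus_diff_eq)
    show "trans rel"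
    proof (rule transI)
      fix x y z assume "(x, y) \<in> rel" "(y, z) \<in> rel"
      thus "(x, z) \<in> rel" using add[of "x - y" "y - z"] by (auto simp: rel_def)
    qed
  qed
  obtain R where R: "finite R" "\<forall>x\<in>A. \<exists>r\<in>R. x - r \<in> m"
    using finite_residues[OF assms] unfolding A_def m_def by blast
  have "A // rel \<subseteq> (\<lambda>r. {x\<in>A. x - r \<in> m}) ` R"
  proof
    fix C assume "C \<in> A // rel"
    then obtain x where x: "x \<in> A" "C = rel `` {x}" by (auto simp: quotient_def)
    then obtain r where r: "r \<in> R" "x - r \<in> m" using R by auto
    have "y - r \<in> m \<longleftrightarrow> x - y \<in> m" for y
    proof
      show "x - y \<in> m" if "y - r \<in> m" using add[OF r(2) neg[OF that]] by simp
      show "y - r \<in> m" if "x - y \<in> m" using add[OF r(2) neg[OF that]] by simp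
    qed
    hence "C = {y\<in>A. y - r \<in> m}" using x by (auto simp: rel_def)
    thus "C \<in> (\<lambda>r. {x\<in>A. x - r \<in> m}) ` R" using r by blast
  qed
  hence fin: "finite (A // rel)" using R(1) finite_surj by blast
  moreover have "A // rel \<noteq> {}" using subring_one[OF subA] by (auto simp: quotient_def)
  ultimately show "card (residue_field F v) > 0" by (simp add: rf card_gt_0_iff)
  define R' where "R' = (\<lambda>C. SOME x. x \<in> C) ` (A // rel)"
  have ch: "(SOME x. x \<in> C) \<in> C" if C: "C \<in> A // rel" for C
  proof -
    obtain x where "x \<in> C" using in_quotient_imp_non_empty[OF eq C] by blast
    thus ?thesis by (rule someI)
  qed
  have "finite R'" "card R' \<le> card (A // rel)" using fin by (auto simp: R'_def card_image_le)
  moreover have "R' \<subseteq> F"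
    using ch in_quotient_imp_subset[OF eq] valring_subset[OF W] unfolding R'_def by blast
  moreover have "\<exists>r\<in>R'. x - r \<in> m" if x: "x \<in> A" for x
  proof -
    have C: "rel `` {x} \<in> A // rel" using x by (rule quotientI)
    have "x - (SOME y. y \<in> rel `` {x}) \<in> m" using ch[OF C] unfolding rel_def by blast
    thus ?thesis using imageI[OF C, of "\<lambda>C. SOME x. x \<in> C"] unfolding R'_def by blast
  qed
  ultimately show "\<exists>R. finite R \<and> card R \<le> card (residue_field F v) \<and> R \<subseteq> F \<and>
           (\<forall>x\<in>valuation_ring F v. \<exists>r\<in>R. x - r \<in> valuation_ideal F v)"
    by (intro exI[of _ R']) (auto simp: rf A_def m_def)
qed

text \<open>Modulo the valuation ring, the elements of value at least \<open>- n\<close> are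
  filtered in \<open>n\<close> steps, each a copy of the residue field.\<close>

lemma reps_modulo_integers:
  assumes alg: "F \<subseteq> Qbar" and B: "finite B" "F \<subseteq> ratvs.span B"
  shows "\<exists>R. finite R \<and> card R \<le> card (residue_field F v) ^ n \<and>
           (\<forall>x\<in>F. x = 0 \<or> v x \<ge> - int n \<longrightarrow> (\<exists>r\<in>R. x - r \<in> valuation_ring F v))"
proof (induction n)
  case 0
  show ?case by (intro exI[of _ "{0}"]) (auto simp: valuation_ring_def)
next
  case (Suc n)
  then obtain S where S: "finite S" "card S \<le> card (residue_field F v) ^ n"
      "\<And>x. x \<in> F \<Longrightarrow> x = 0 \<or> v x \<ge> - int n \<Longrightarrow> \<exists>r\<in>S. x - r \<in> valuation_ring F v"
    by blast
  obtain R where R: "finite R" "card R \<le> card (residue_field F v)" "R \<subseteq> F"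
      "\<And>x. x \<in> valuation_ring F v \<Longrightarrow> \<exists>r\<in>R. x - r \<in> valuation_ideal F v"
    using residue_field_reps(2)[OF assms] by blast
  obtain \<pi> where \<pi>: "\<pi> \<in> F" "\<pi> \<noteq> 0" "v \<pi> = 1" using v_surj[of 1] by auto
  \<comment> \<open>Multiplication by \<open>q\<close> moves value \<open>- (n + 1)\<close> to 0,
    where a residue representative can be subtracted; what remains has value at least
    \<open>- n\<close> after dividing back.\<close>
  define q where "q = \<pi> ^ Suc n"
  have q: "q \<in> F" "q \<noteq> 0" "v q = 1 + int n"
    unfolding q_def using \<pi> by (simp_all add: v_power subring_power[OF sub] del: power_Suc)
  define T where "T = (\<lambda>(r, s). r / q + s) ` (R \<times> S)"
  have "finite T" using R(1) S(1) by (simp add: T_def)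
  moreover have "card T \<le> card (residue_field F v) ^ Suc n"
  proof -
    have "card T \<le> card (R \<times> S)" unfolding T_def by (intro card_image_le) (use R S in auto)
    also have "\<dots> = card R * card S" by (simp add: card_cartesian_product)
    also have "\<dots> \<le> card (residue_field F v) * card (residue_field F v) ^ n"
      using R S by (intro mult_mono) auto
    finally show ?thesis by simp
  qed
  moreover have "\<exists>t\<in>T. x - t \<in> valuation_ring F v" if x: "x \<in> F" "x = 0 \<or> v x \<ge> - int (Suc n)" for x
  proof -
    have "x * q \<in> valuation_ring F v"
      using x q by (cases "x = 0") (auto simp: valuation_ring_def v_mult subring_mult[OF sub])
    then obtain r where r: "r \<in> R" "x * q - r \<in> valuation_ideal F v" using R(4) by blast
    have rF: "r \<in> F" using r R by auto
    have e: "x - r / q = (x * q - r) / q" using q by (simp add: field_simps)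
    have "x - r / q \<in> F" using x rF q by (intro subring_diff[OF sub] subfield_divide[OF F])
    moreover have "x - r / q = 0 \<or> v (x - r / q) \<ge> - int n"
    proof (cases "x * q - r = 0")
      case False
      hence "v (x * q - r) > 0" "x * q - r \<in> F" using r by (auto simp: valuation_ideal_def)
      hence "v (x - r / q) = v (x * q - r) - (1 + int n)"
        unfolding e using q False by (simp add: v_divide)
      thus ?thesis using \<open>v (x * q - r) > 0\<close> by simp
    qed (simp add: e)
    ultimately obtain s where s: "s \<in> S" "x - r / q - s \<in> valuation_ring F v" using S(3) by blast
    have "r / q + s \<in> T" using r(1) s(1) by (auto simp: T_def)
    moreover have "x - (r / q + s) \<in> valuation_ring F v" using s(2) by (simp add: algebra_simps)
    ultimately show ?thesis by blast
  qed
  ultimately show ?case by blast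
qed

end

section \<open>Discrete valuations from valuation rings\<close>

text \<open>The last assumption puts \<open>p\<close> into the maximal ideal, so \<open>W\<close> is
  not all of \<open>F\<close>.\<close>

locale valring_above =
  fixes F W B :: "complex set" and p :: int
  assumes W: "valring F W" and B: "finite B" "F \<subseteq> ratvs.span B"
    and p: "prime p" "inverse (of_int p) \<notin> W"
begin

lemma F: "is_subfield F" and Fsub: "is_subring F" and sub: "is_subring W"
  using valring_subfield[OF W] valring_subring[OF W] by (auto intro: subfield_subring)

definition P :: complex where "P = of_int p"

definition U :: "complex set" where "U = {x \<in> W. x \<noteq> 0 \<and> inverse x \<in> W}"

text \<open>The powers \<open>1, z, \<dots>, z ^ card B\<close> are linearly dependent over the rationals, so two terms of a
  relation have the same value. Hence some \<open>z ^ n\<close> with \<open>n \<le> card B\<close> has the value of a power of \<open>p\<close>, and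
  the value of \<open>z\<close> can be measured by the exponent of the power of \<open>p\<close> associated to \<open>z ^ M\<close>.\<close>

definition M :: nat where "M = fact (card B)"

definition val :: "complex \<Rightarrow> int" where "val z = (THE t. z ^ M * P powi (- t) \<in> U)"

lemma P: "P \<in> W" "P \<noteq> 0" "inverse P \<notin> W" "P \<in> F"
  using p prime_gt_0_int[OF p(1)] valring_subset[OF W, of P]
  by (auto simp: P_def subring_of_int[OF sub])

lemma M: "M > 0" by (simp add: M_def)

lemma U_mult: "x \<in> U \<Longrightarrow> z \<in> U \<Longrightarrow> x * z \<in> U"
  by (auto simp: U_def intro: subring_mult[OF sub])

lemma U_one: "1 \<in> U" using subring_one[OF sub] by (simp add: U_def)

lemma U_inverse: "x \<in> U \<Longrightarrow> inverse x \<in> U" by (auto simp: U_def)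

lemma U_power: "x \<in> U \<Longrightarrow> x ^ n \<in> U" by (induction n) (use U_mult U_one in auto)

lemma of_int_unit: "\<not> p dvd c \<Longrightarrow> of_int c \<in> U"
  using valring_coprime_unit[OF W p] by (auto simp: U_def subring_of_int[OF sub])

lemma of_int_associated: assumes c: "c \<noteq> 0" shows "\<exists>a. of_int c * inverse P ^ a \<in> U"
proof -
  define a where "a = multiplicity p c"
  have "\<not> is_unit p" using p(1) not_prime_unit by blast
  then obtain d where d: "c = p ^ a * d" "\<not> p dvd d"
    unfolding a_def using multiplicity_decompose'[OF c] by blast
  have "of_int c * inverse P ^ a = of_int d"
    using P(2) by (simp add: d(1) P_def[symmetric] power_inverse)
  thus ?thesis using of_int_unit[OF d(2)] by (intro exI[of _ a]) simp
qed

lemma power_P_notin_U: assumes k: "k > 0" shows "P powi (- int k) \<notin> U"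
proof
  assume h: "P powi (- int k) \<in> U"
  obtain j where j: "k = Suc j" using k by (cases k) auto
  have "P ^ j * P powi (- int k) \<in> W"
    using h P by (intro subring_mult[OF sub] subring_power[OF sub]) (auto simp: U_def)
  moreover have "P ^ j * P powi (- int k) = inverse P"
    unfolding power_int_minus j power_int_of_nat using P(2) by (simp add: field_simps)
  ultimately show False using P by simp
qed

lemma powi_P_in_UD: assumes s: "P powi s \<in> U" shows "s = 0"
proof (rule ccontr)
  assume "s \<noteq> 0"
  hence "s > 0 \<or> s < 0" by linarith
  moreover have "P powi (- s) \<in> U" using U_inverse[OF s] by (simp add: power_int_minus)
  ultimately show False using power_P_notin_U[of "nat s"] power_P_notin_U[of "nat (- s)"] s by auto
qed

lemma val_exists_aux:
  assumes z: "z \<in> F" "z \<noteq> 0"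
    and ik: "i \<le> card B" "k < i" "of_int (c i) * z ^ i \<noteq> 0" "of_int (c k) * z ^ k \<noteq> 0"
    and q: "of_int (c i) * z ^ i / (of_int (c k) * z ^ k) \<in> U"
  shows "\<exists>t. z ^ M * P powi (- t) \<in> U"
proof -
  have ck: "c i \<noteq> 0" "c k \<noteq> 0" using ik by auto
  obtain a where a: "of_int (c i) * inverse P ^ a \<in> U" using of_int_associated[OF ck(1)] by blast
  obtain b where b: "of_int (c k) * inverse P ^ b \<in> U" using of_int_associated[OF ck(2)] by blast
  define n where "n = i - k"
  have n: "n > 0" "n \<le> card B" using ik by (auto simp: n_def)
  define X where "X = z ^ n * P powi (- (int b - int a))"
  have "X \<in> U"
  proof -
    have "of_int (c i) * z ^ i / (of_int (c k) * z ^ k) * (of_int (c k) * inverse P ^ b) *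
        inverse (of_int (c i) * inverse P ^ a) \<in> U"
      by (rule U_mult[OF U_mult[OF q b] U_inverse[OF a]])
    also have "of_int (c i) * z ^ i / (of_int (c k) * z ^ k) * (of_int (c k) * inverse P ^ b) *
        inverse (of_int (c i) * inverse P ^ a) = z ^ i / z ^ k * (P ^ a / P ^ b)"
      using ck z P(2) by (simp add: power_inverse field_simps)
    also have "z ^ i / z ^ k = z ^ n" using ik z by (simp add: n_def power_diff)
    also have "P ^ a / P ^ b = P powi (- (int b - int a))"
      using P(2) by (simp add: power_int_diff)
    finally show ?thesis by (simp add: X_def)
  qed
  \<comment> \<open>The exponent \<open>n\<close> depends on \<open>z\<close> but is at most
    \<open>card B\<close>; a factorial is a common multiple of all these exponents.\<close>
  moreover have "n dvd M" using n by (auto simp: M_def intro: dvd_fact)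
  then obtain r where r: "M = n * r" by (auto elim: dvdE)
  have "X ^ r = z ^ M * P powi (- (int b - int a) * int r)"
    by (simp only: X_def power_mult_distrib r power_mult power_int_mult power_int_of_nat)
  ultimately show ?thesis using U_power[of X r] by (metis mult_minus_left)
qed

lemma val_exists:
  assumes z: "z \<in> F" "z \<noteq> 0"
  shows "\<exists>t. z ^ M * P powi (- t) \<in> U"
proof -
  obtain c where c: "Gcd (c ` {..card B}) = (1::int)" "(\<Sum>i\<le>card B. of_int (c i) * z ^ i) = 0"
    using int_relation[OF B(1), of "\<lambda>i. z ^ i"] z B(2) subring_power[OF Fsub] by blast
  have "\<exists>i\<le>card B. c i \<noteq> 0"
  proof (rule ccontr)
    assume "\<not> ?thesis"
    hence "Gcd (c ` {..card B}) = 0" by (auto simp: Gcd_0_iff)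
    thus False using c by simp
  qed
  then obtain l where l: "l \<in> {..card B}" "of_int (c l) * z ^ l \<noteq> 0" using z by auto
  have "of_int (c i) * z ^ i \<in> F" for i
    using z by (intro subring_mult[OF Fsub] subring_of_int[OF Fsub] subring_power[OF Fsub])
  then obtain i k where ik: "i \<le> card B" "k \<le> card B" "i \<noteq> k"
      "of_int (c i) * z ^ i \<noteq> 0" "of_int (c k) * z ^ k \<noteq> 0"
      "of_int (c i) * z ^ i / (of_int (c k) * z ^ k) \<in> W" "of_int (c k) * z ^ k / (of_int (c i) * z ^ i) \<in> W"
    using valring_tie[OF W finite_atMost _ c(2) l] unfolding atMost_iff by blast
  have q: "of_int (c i) * z ^ i / (of_int (c k) * z ^ k) \<in> U" "of_int (c k) * z ^ k / (of_int (c i) * z ^ i) \<in> U"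
    using ik by (auto simp: U_def)
  show ?thesis
    using val_exists_aux[OF z ik(1) _ ik(4,5) q(1)] val_exists_aux[OF z ik(2) _ ik(5,4) q(2)] ik(3) nat_neq_iff
    by blast
qed

lemma val_eqI:
  assumes "z \<noteq> 0" "z ^ M * P powi (- t) \<in> U" shows "val z = t"
  unfolding val_def
proof (rule the_equality)
  fix s assume s: "z ^ M * P powi (- s) \<in> U"
  have "z ^ M * P powi (- s) * inverse (z ^ M * P powi (- t)) \<in> U" by (rule U_mult[OF s U_inverse[OF assms(2)]])
  also have "z ^ M * P powi (- s) * inverse (z ^ M * P powi (- t)) = P powi (t - s)"
    using \<open>z \<noteq> 0\<close> P(2) by (simp add: power_int_diff power_int_minus field_simps)
  finally show "s = t" using powi_P_in_UD by force
qed fact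

lemma val: "z \<in> F \<Longrightarrow> z \<noteq> 0 \<Longrightarrow> z ^ M * P powi (- val z) \<in> U"
  using val_exists val_eqI by blast

lemma val_one: "val 1 = 0"
  by (rule val_eqI) (use U_one in auto)

lemma val_mult:
  assumes "x \<in> F" "z \<in> F" "x \<noteq> 0" "z \<noteq> 0" shows "val (x * z) = val x + val z"
proof (rule val_eqI)
  have "(x ^ M * P powi (- val x)) * (z ^ M * P powi (- val z)) \<in> U" by (rule U_mult[OF val[OF assms(1,3)] val[OF assms(2,4)]])
  also have "(x ^ M * P powi (- val x)) * (z ^ M * P powi (- val z)) = (x * z) ^ M * P powi (- val x + - val z)"
    unfolding power_int_add[OF disjI1[OF P(2)]] by (simp add: power_mult_distrib mult_ac)
  finally show "(x * z) ^ M * P powi (- (val x + val z)) \<in> U" by simp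
qed (use assms in auto)

lemma val_P: "val P = int M"
  by (rule val_eqI) (use P U_one in \<open>simp_all add: power_int_minus\<close>)

lemma val_ge_0_iff:
  assumes z: "z \<in> F" "z \<noteq> 0" shows "val z \<ge> 0 \<longleftrightarrow> z \<in> W"
proof
  assume "val z \<ge> 0"
  hence "z ^ M = (z ^ M * P powi (- val z)) * P ^ nat (val z)"
    using P(2) by (simp add: power_int_def power_inverse)
  also have "\<dots> \<in> W" 
    using val[OF z] unfolding U_def by (intro subring_mult[OF sub _ subring_power[OF sub P(1)]]) blast
  finally show "z \<in> W" using valring_power_iff[OF W z(1) M] by simp
next
  assume zW: "z \<in> W"
  show "val z \<ge> 0"
  proof (rule ccontr)
    assume n: "\<not> val z \<ge> 0"
    have "z ^ M * inverse (z ^ M * P powi (- val z)) \<in> W"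
      using U_inverse[OF val[OF z]] unfolding U_def by (intro subring_mult[OF sub subring_power[OF sub zW]]) blast
    hence "P powi (val z) \<in> W" using z P(2) by (simp add: power_int_minus mult.assoc[symmetric])
    moreover have "inverse (P powi (val z)) \<in> W"
      using n P by (simp add: power_int_def subring_power[OF sub] power_inverse)
    ultimately have "P powi (val z) \<in> U" using P(2) by (simp add: U_def)
    thus False using powi_P_in_UD n by force
  qed
qed

lemma val_inverse: "z \<in> F \<Longrightarrow> z \<noteq> 0 \<Longrightarrow> val (inverse z) = - val z"
  using val_mult[of z "inverse z"] subfield_inverse[OF F, of z] val_one by simp

lemma val_add_aux:
  assumes xz: "x \<in> F" "z \<in> F" "x \<noteq> 0" "z \<noteq> 0" "x + z \<noteq> 0" "val z \<le> val x"
  shows "val z \<le> val (x + z)"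
proof -
  have q: "x / z \<in> F" "x / z \<noteq> 0" using xz by (auto intro: subfield_divide[OF F])
  have "val (x / z) = val x - val z"
    using xz by (simp add: divide_inverse val_mult val_inverse subfield_inverse[OF F])
  hence "x / z \<in> W" using val_ge_0_iff[OF q] xz by simp
  hence 1: "1 + x / z \<in> W" by (intro subring_add[OF sub] subring_one[OF sub])
  have e: "x + z = z * (1 + x / z)" using xz by (simp add: field_simps)
  have nz: "1 + x / z \<noteq> 0" using xz(5) unfolding e by auto
  have "val (1 + x / z) \<ge> 0" using val_ge_0_iff[OF valring_subset[OF W 1] nz] 1 by simp
  moreover have "val (x + z) = val z + val (1 + x / z)"
    unfolding e by (intro val_mult xz nz valring_subset[OF W 1])
  ultimately show ?thesis by simp
qed

lemma val_add:
  assumes "x \<in> F" "z \<in> F" "x \<noteq> 0" "z \<noteq> 0" "x + z \<noteq> 0"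
  shows "min (val x) (val z) \<le> val (x + z)"
  using val_add_aux[of x z] val_add_aux[of z x] assms by (cases "val z \<le> val x") (auto simp: add.commute)

lemma val_power: "z \<in> F \<Longrightarrow> z \<noteq> 0 \<Longrightarrow> val (z ^ n) = int n * val z"
  by (induction n) (simp_all add: val_mult val_one subring_power[OF Fsub] algebra_simps)

lemma val_powi:
  assumes "z \<in> F" "z \<noteq> 0" shows "val (z powi k) = k * val z"
proof (cases "k \<ge> 0")
  case True
  thus ?thesis using val_power[OF assms, of "nat k"] by (simp add: power_int_def)
next
  case False
  thus ?thesis
    using val_power[OF assms, of "nat (- k)"] val_inverse[of "z ^ nat (- k)"] assms subring_power[OF Fsub assms(1)]
    by (simp add: power_int_def power_inverse)
qed

text \<open>\<open>val\<close> is additive, but its image may be a proper subgroup of the integers.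
  Division by the least positive value \<open>g\<close>, which exists because of \<open>P\<close>,
  makes it surjective.\<close>

lemma place_exists: "\<exists>v\<in>finite_places F. \<forall>z\<in>F - {0}. 0 \<le> v z \<longleftrightarrow> z \<in> W"
proof -
  define Q where "Q k \<longleftrightarrow> k > 0 \<and> (\<exists>z\<in>F. z \<noteq> 0 \<and> val z = int k)" for k
  have "Q M" using M P val_P by (auto simp: Q_def)
  define g where "g = (LEAST k. Q k)"
  have g: "Q g" "\<And>k. Q k \<Longrightarrow> g \<le> k" using \<open>Q M\<close> by (auto simp: g_def intro: LeastI Least_le)
  obtain \<pi> where \<pi>: "\<pi> \<in> F" "\<pi> \<noteq> 0" "val \<pi> = int g" "g > 0" using g(1) by (auto simp: Q_def)
  have Vpi: "val (\<pi> powi k) = k * int g" for k using val_powi[OF \<pi>(1,2)] \<pi>(3) by simp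
  have piF: "\<pi> powi k \<in> F" "\<pi> powi k \<noteq> 0" for k using \<pi> by (auto intro: subfield_powi[OF F])
  have gdvd: "int g dvd val z" if z: "z \<in> F" "z \<noteq> 0" for z
  proof (rule ccontr)
    assume n: "\<not> int g dvd val z"
    define q where "q = val z div int g"
    have e: "val (z * \<pi> powi (- q)) = val z mod int g"
      using val_mult[OF z(1) piF(1)[of "- q"] z(2) piF(2)[of "- q"]] Vpi[of "- q"]
        minus_div_mult_eq_mod[of "val z" "int g"] by (simp add: q_def)
    have pos: "val z mod int g > 0" "val z mod int g < int g"
      using n \<pi>(4) pos_mod_sign[of "int g" "val z"] pos_mod_bound[of "int g" "val z"]
        mod_eq_0_iff_dvd[of "val z" "int g"] by linarith+
    have "z * \<pi> powi (- q) \<in> F" "z * \<pi> powi (- q) \<noteq> 0"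
      using z piF[of "- q"] by (auto intro: subring_mult[OF Fsub])
    hence "Q (nat (val z mod int g))"
      unfolding Q_def using pos e by (intro conjI bexI[of _ "z * \<pi> powi (- q)"]) auto
    thus False using g(2) pos by force
  qed
  define v where "v = restrict (\<lambda>z. val z div int g) (F - {0})"
  have v: "v z * int g = val z" if "z \<in> F" "z \<noteq> 0" for z
    using gdvd[OF that] that by (simp add: v_def)
  have "v \<in> finite_places F"
    unfolding finite_places_def
  proof (intro CollectI conjI ballI impI)
    show "v \<in> extensional (F - {0})" by (simp add: v_def)
    show "v ` (F - {0}) = UNIV"
    proof (intro set_eqI iffI)
      fix k :: int
      have "v (\<pi> powi k) * int g = k * int g" using v[OF piF] Vpi by simp
      hence "v (\<pi> powi k) = k" using \<pi>(4) by simp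
      thus "k \<in> v ` (F - {0})" using piF by (metis DiffI image_eqI singletonD)
    qed simp
  next
    fix x z assume xz: "x \<in> F - {0}" "z \<in> F - {0}"
    have "v (x * z) * int g = (v x + v z) * int g"
      using xz v[of x] v[of z] v[of "x * z"] val_mult[of x z] subring_mult[OF Fsub, of x z]
      by (simp add: algebra_simps)
    thus "v (x * z) = v x + v z" using \<pi>(4) by simp
    assume nz: "x + z \<noteq> 0"
    have "min (v x * int g) (v z * int g) \<le> v (x + z) * int g"
      using xz v[of x] v[of z] v[of "x + z"] val_add[of x z] nz subring_add[OF Fsub, of x z] by simp
    thus "min (v x) (v z) \<le> v (x + z)" using \<pi>(4) by (auto simp: min_def split: if_splits)
  qed
  moreover have "0 \<le> v z \<longleftrightarrow> z \<in> W" if z: "z \<in> F - {0}" for z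
  proof -
    have "0 \<le> v z * int g \<longleftrightarrow> z \<in> W" using v[of z] val_ge_0_iff[of z] z by simp
    thus ?thesis using \<pi>(4) by (simp add: zero_le_mult_iff)
  qed
  ultimately show ?thesis by blast
qed

end

text \<open>\<open>W\<close> misses \<open>y\<close> but contains the leading coefficient of its
  minimal polynomial times \<open>y\<close>. So this integer is not invertible in \<open>W\<close>,
  and neither is one of its prime divisors.\<close>

lemma place_from_valring:
  assumes W: "valring F W" and alg: "F \<subseteq> Qbar" and B: "finite B" "F \<subseteq> ratvs.span B"
    and y: "y \<in> F" "y \<notin> W"
  shows "\<exists>v\<in>finite_places F. v y < 0"
proof -
  note sub = valring_subring[OF W]
  obtain f where f: "minpol f y" using y alg minpol_exists by (auto simp: Qbar_def)
  have "of_int (lead_coeff f) * y \<in> W"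
    using valring_lead_mult[OF W y(1), of "cpoly f"] subring_of_int[OF sub] minpol_eval[OF f]
    by (simp add: coeff_cpoly degree_cpoly)
  moreover have lf: "lead_coeff f \<noteq> 0" using minpol_nz[OF f] by simp
  ultimately have "inverse (of_int (lead_coeff f)) \<notin> W"
    using y(2) subring_mult[OF sub, of "inverse (of_int (lead_coeff f))" "of_int (lead_coeff f) * y"]
    by (auto simp: mult.assoc[symmetric])
  then obtain p where p: "prime p" "inverse (of_int p) \<notin> W"
    using valring_prime_exists[OF W lf] by blast
  interpret valring_above F W B p by unfold_locales fact+
  have "y \<noteq> 0" using y subring_zero[OF sub] by auto
  thus ?thesis using place_exists y by force
qed

section \<open>The finite part of the height\<close>

text \<open>Pulling \<open>V\<close> back along \<open>\<sigma>\<close> gives a valuation ring of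
  \<open>F\<close>; if it missed \<open>x\<close>, some finite place of \<open>F\<close> would have
  a pole at \<open>x\<close>. This transfers integrality from the finite places of \<open>F\<close>
  to the valuation rings of the complex numbers.\<close>

lemma emb_in_valring:
  assumes F: "is_subfield F" and alg: "F \<subseteq> Qbar" and B: "finite B" "F \<subseteq> ratvs.span B"
    and x: "x \<in> F" "\<And>v. v \<in> finite_places F \<Longrightarrow> x \<in> valuation_ring F v"
    and s: "\<sigma> \<in> embeddings F" and V: "valring UNIV V"
  shows "\<sigma> x \<in> V"
proof (rule ccontr)
  assume n: "\<sigma> x \<notin> V"
  define W where "W = {x\<in>F. \<sigma> x \<in> V}"
  have "valring F W"
    unfolding valring_def is_subring_def
  proof (intro conjI ballI)
    fix a b assume "a \<in> W" "b \<in> W"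
    thus "a - b \<in> W" "a * b \<in> W"
      using subfield_subring[OF F] valring_subring[OF V]
      by (auto simp: W_def emb_diff[OF s F] emb_mult[OF s F] intro: subring_diff subring_mult)
  next
    fix a assume "a \<in> F"
    thus "a \<in> W \<or> inverse a \<in> W"
      using V by (auto simp: W_def emb_inverse[OF s F] valring_def intro: subfield_inverse[OF F])
  qed (use F s in \<open>auto simp: W_def emb_one[OF s F] intro: subring_one[OF valring_subring[OF V]]
        subring_one[OF subfield_subring[OF F]]\<close>)
  moreover have "x \<notin> W" using n by (simp add: W_def)
  ultimately obtain v where v: "v \<in> finite_places F" "v x < 0"
    using place_from_valring[of F W B x] alg B x(1) by blast
  have "x \<noteq> 0" using n emb_zero[OF s F] subring_zero[OF valring_subring[OF V]] by auto
  thus False using v x(2)[OF v(1)] by (auto simp: valuation_ring_def)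
qed

lemma lagrange_algebraic:
  assumes "R \<subseteq> Qbar" "z \<in> R" shows "coeff (lagrange R z) i \<in> Qbar"
proof -
  note Q = is_subfield_Qbar
  note sub = subfield_subring[OF Q]
  have "coeff (\<Prod>w\<in>R-{z}. [:-w, 1:]) i \<in> Qbar"
    using assms by (intro coeff_prod_in_subring[OF sub])
      (auto simp: coeff_pCons split: nat.splits intro: subring_one[OF sub] subring_zero[OF sub] subring_uminus[OF sub])
  moreover have "inverse (\<Prod>w\<in>R-{z}. z - w) \<in> Qbar"
    using assms by (intro subfield_inverse[OF Q] subring_prod[OF sub] subring_diff[OF sub]) auto
  ultimately show ?thesis by (auto simp: lagrange_def intro: subring_mult[OF sub])
qed

section \<open>Number fields with a chosen generator\<close>

locale simple_field =
  fixes f :: "int poly" and \<gamma> :: complex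
  assumes f: "minpol f \<gamma>" and \<gamma>: "\<gamma> \<noteq> 0"
begin

definition F :: "complex set" where "F = adjoin_rat \<gamma>"
definition d :: nat where "d = degree f"
definition B :: "complex set" where "B = (\<lambda>i. \<gamma> ^ i) ` {..<d}"
definition S :: "(complex \<Rightarrow> int) set" where "S = {v \<in> finite_places F. v \<gamma> < 0}"

lemma F: "is_subfield F" by (simp add: F_def is_subfield_adjoin_rat)
lemma F_subring: "is_subring F" using F by (rule subfield_subring)
lemma generator_in_F: "\<gamma> \<in> F" by (simp add: F_def adjoin_rat_self)
lemma B: "finite B" "F \<subseteq> ratvs.span B"
  using adjoin_rat_eq_span[OF f] by (auto simp: B_def F_def d_def)

lemma F_Qbar: "F \<subseteq> Qbar"
  unfolding F_def using minpol_algebraic[OF f] by (intro adjoin_rat_subset is_subfield_Qbar) (simp add: Qbar_def)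

lemma F_coordinates:
  assumes "x \<in> F"
  shows "\<exists>c::nat \<Rightarrow> rat. x = (\<Sum>i<d. of_rat (c i) * \<gamma> ^ i)"
proof -
  have "x \<in> ratvs.span B" using assms B by blast
  thus ?thesis
  proof (induction rule: ratvs.span_induct_alt)
    case base
    show ?case by (intro exI[of _ "\<lambda>_. 0"]) simp
  next
    case (step a x y)
    then obtain c where c: "y = (\<Sum>i<d. of_rat (c i) * \<gamma> ^ i)" by blast
    obtain j where j: "j < d" "x = \<gamma> ^ j" using step(1) by (auto simp: B_def)
    have "(\<Sum>i<d. of_rat (if i = j then a else 0) * \<gamma> ^ i) = (\<Sum>i<d. if i = j then of_rat a * \<gamma> ^ j else 0)"
      by (intro sum.cong) auto
    also have "\<dots> = of_rat a * x" using j by simp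
    finally have "of_rat a * x + y = (\<Sum>i<d. of_rat ((if i = j then a else 0) + c i) * \<gamma> ^ i)"
      unfolding c by (simp only: of_rat_add distrib_right sum.distrib)
    thus ?case by (rule exI[of _ "\<lambda>i. (if i = j then a else 0) + c i"])
  qed
qed

lemma root_embedding:
  assumes "z \<in> croots f"
  shows "\<exists>\<sigma>\<in>embeddings F. \<sigma> \<gamma> = z"
proof -
  obtain \<tau> where "\<tau> \<in> embeddings Qbar" "\<tau> \<gamma> = z" using emb_transitive[OF f assms] by blast
  thus ?thesis using emb_restrict[OF _ F_Qbar F] generator_in_F by (intro bexI[of _ "restrict \<tau> F"]) auto
qed

lemma emb_coordinates:
  assumes "\<sigma> \<in> embeddings F"
  shows "\<sigma> (\<Sum>i<d. of_rat (c i) * \<gamma> ^ i) = (\<Sum>i<d. of_rat (c i) * \<sigma> \<gamma> ^ i)"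
proof -
  have m: "of_rat q * \<gamma> ^ i \<in> F" for q i
    by (intro subring_mult[OF F_subring] subring_power[OF F_subring] generator_in_F subfield_of_rat[OF F])
  have "\<sigma> (\<Sum>i<d. of_rat (c i) * \<gamma> ^ i) = (\<Sum>i<d. \<sigma> (of_rat (c i) * \<gamma> ^ i))"
    by (rule emb_sum[OF assms F m])
  also have "\<dots> = (\<Sum>i<d. of_rat (c i) * \<sigma> \<gamma> ^ i)"
    by (intro sum.cong refl)
       (simp add: emb_mult[OF assms F] emb_of_rat[OF assms F] emb_power[OF assms F generator_in_F]
          subfield_of_rat[OF F] subring_power[OF F_subring generator_in_F])
  finally show ?thesis .
qed

lemma embeddings_bij: "bij_betw (\<lambda>\<sigma>. \<sigma> \<gamma>) (embeddings F) (croots f)"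
proof (rule bij_betwI')
  fix \<sigma> \<tau> assume st: "\<sigma> \<in> embeddings F" "\<tau> \<in> embeddings F"
  show "\<sigma> \<gamma> = \<tau> \<gamma> \<longleftrightarrow> \<sigma> = \<tau>"
  proof
    assume e: "\<sigma> \<gamma> = \<tau> \<gamma>"
    show "\<sigma> = \<tau>"
    proof (rule extensionalityI[of _ F])
      fix x assume "x \<in> F"
      then obtain c where "x = (\<Sum>i<d. of_rat (c i) * \<gamma> ^ i)" using F_coordinates by blast
      thus "\<sigma> x = \<tau> x" using emb_coordinates[OF st(1)] emb_coordinates[OF st(2)] e by simp
    qed (use st in \<open>auto simp: embeddings_def\<close>)
  qed simp
next
  fix \<sigma> assume "\<sigma> \<in> embeddings F"
  thus "\<sigma> \<gamma> \<in> croots f" using emb_croots[OF _ F generator_in_F] minpol_croots[OF f] by blast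
next
  fix z assume "z \<in> croots f"
  thus "\<exists>\<sigma>\<in>embeddings F. z = \<sigma> \<gamma>" using root_embedding by blast
qed

text \<open>The coordinates of \<open>x\<close> are the coefficients of a polynomial whose values at
  the conjugates of \<gamma> are conjugates of \<open>x\<close>, and these lie in every
  \<open>V\<close>. By interpolation only denominators of Lagrange coefficients can occur, and
  \<open>D\<close> is the product of such denominators.\<close>

lemma common_denominator:
  "\<exists>D::int. D > 0 \<and> (\<forall>x\<in>F. (\<forall>v\<in>finite_places F. x \<in> valuation_ring F v) \<longrightarrow>
      (\<exists>e::nat \<Rightarrow> int. of_int D * x = (\<Sum>i<d. of_int (e i) * \<gamma> ^ i)))"
proof -
  define R where "R = croots f"
  have R: "finite R" "card R = d" "R \<subseteq> Qbar"
    by (auto simp: R_def d_def finite_croots[OF f] card_croots[OF f] dest: croots_subset_Qbar[OF f, THEN subsetD])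
  have "\<exists>E::int. E > 0 \<and> (\<forall>V. valring UNIV V \<longrightarrow> of_int E * coeff (lagrange R z) i \<in> V)" if "z \<in> R" for z i
    using lagrange_algebraic[OF R(3) that] by (intro algebraic_denominator) (simp add: Qbar_def)
  then obtain E :: "complex \<Rightarrow> nat \<Rightarrow> int" where E: "\<And>z i. z \<in> R \<Longrightarrow> E z i > 0"
      "\<And>z i V. z \<in> R \<Longrightarrow> valring UNIV V \<Longrightarrow> of_int (E z i) * coeff (lagrange R z) i \<in> V"
    by metis
  define D where "D = (\<Prod>z\<in>R. \<Prod>i<d. E z i)"
  have D0: "D > 0" unfolding D_def using E(1) by (intro prod_pos) auto
  have DV: "of_int D * coeff (lagrange R z) i \<in> V" if z: "z \<in> R" and i: "i < d" and V: "valring UNIV V" for z i V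
  proof -
    have "E z i dvd (\<Prod>i<d. E z i)" using i by (intro dvd_prodI) auto
    also have "\<dots> dvd D" unfolding D_def using z R(1) by (intro dvd_prodI) auto
    finally obtain k where "D = E z i * k" by blast
    hence "of_int D * coeff (lagrange R z) i = of_int k * (of_int (E z i) * coeff (lagrange R z) i)" by simp
    also have "\<dots> \<in> V"
      by (rule subring_mult[OF valring_subring[OF V] subring_of_int[OF valring_subring[OF V]] E(2)[OF z V]])
    finally show ?thesis .
  qed
  have "\<exists>e::nat \<Rightarrow> int. of_int D * x = (\<Sum>i<d. of_int (e i) * \<gamma> ^ i)"
    if x: "x \<in> F" "\<forall>v\<in>finite_places F. x \<in> valuation_ring F v" for x
  proof -
    obtain c where c: "x = (\<Sum>i<d. of_rat (c i) * \<gamma> ^ i)" using F_coordinates[OF x(1)] by blast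
    define P :: "complex poly" where "P = (\<Sum>i<d. monom (of_rat (c i)) i)"
    have coP: "coeff P i = of_rat (c i)" if "i < d" for i
      using that by (simp add: P_def coeff_sum)
    have "degree P < card R"
      unfolding P_def R(2) using minpol_degree[OF f]
      by (intro degree_sum_less) (auto simp: d_def intro: le_less_trans[OF degree_monom_le])
    hence P: "P = (\<Sum>z\<in>R. smult (poly P z) (lagrange R z))" by (rule lagrange_interpolation[OF R(1)])
    have PV: "poly P z \<in> V" if z: "z \<in> R" and V: "valring UNIV V" for z V
    proof -
      obtain \<sigma> where s: "\<sigma> \<in> embeddings F" "\<sigma> \<gamma> = z" using root_embedding z by (auto simp: R_def)
      have "\<sigma> x \<in> V" using x by (intro emb_in_valring[OF F F_Qbar B _ _ s(1) V]) auto
      also have "\<sigma> x = poly P z" unfolding c emb_coordinates[OF s(1)] by (simp add: P_def poly_sum poly_monom s(2))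
      finally show ?thesis .
    qed
    have "\<exists>k::int. of_int D * c i = of_int k" if i: "i < d" for i
    proof -
      obtain a b where ab: "c i = of_int a / of_int b" "b > 0"
        by (metis quotient_of_div quotient_of_denom_pos surj_pair)
      have "of_int (D * a) / of_int b \<in> V" if V: "valring UNIV V" for V :: "complex set"
      proof -
        have "of_int (D * a) / of_int b = of_int D * coeff P i" by (simp add: coP[OF i] ab of_rat_divide)
        also have "\<dots> = (\<Sum>z\<in>R. poly P z * (of_int D * coeff (lagrange R z) i))"
          by (subst P) (simp add: coeff_sum sum_distrib_left mult_ac)
        also have "\<dots> \<in> V"
          by (rule subring_sum[OF valring_subring[OF V]])
             (rule subring_mult[OF valring_subring[OF V] PV[OF _ V] DV[OF _ i V]])
        finally show ?thesis .
      qed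
      hence "b dvd D * a" using ab by (intro dvd_if_quotient_in_valrings) auto
      then obtain k where k: "D * a = b * k" by blast
      have "of_int D * c i = of_int (D * a) / of_int b" by (simp add: ab)
      also have "\<dots> = of_int k" unfolding k using ab by simp
      finally show ?thesis by blast
    qed
    then obtain e :: "nat \<Rightarrow> int" where e: "\<And>i. i < d \<Longrightarrow> of_int D * c i = of_int (e i)" by metis
    have "of_int D * x = (\<Sum>i<d. of_rat (of_int D * c i) * \<gamma> ^ i)"
      unfolding c by (simp add: sum_distrib_left of_rat_mult mult.assoc)
    also have "\<dots> = (\<Sum>i<d. of_int (e i) * \<gamma> ^ i)" by (intro sum.cong refl) (simp add: e)
    finally show ?thesis by blast
  qed
  thus ?thesis using D0 by blast
qed

text \<open>At the largest index of disagreement the difference is the leading coefficient of an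
  integer polynomial with root \<gamma>, hence a multiple of \<open>lead_coeff f\<close>, but it is
  smaller in absolute value. Exponents from \<open>d\<close> on keep it clear of the terms on the
  right side.\<close>

lemma high_coefficients_unique:
  fixes c c' k :: "nat \<Rightarrow> int"
  assumes cc: "\<And>j. j < N \<Longrightarrow> c j \<in> {0..<lead_coeff f}" "\<And>j. j < N \<Longrightarrow> c' j \<in> {0..<lead_coeff f}"
    and eq: "(\<Sum>j<N. of_int (c j) * \<gamma> ^ (d + j)) - (\<Sum>j<N. of_int (c' j) * \<gamma> ^ (d + j)) =
        (\<Sum>i<d. of_int (k i) * \<gamma> ^ i)"
    and "j < N"
  shows "c j = c' j"
proof (rule ccontr)
  assume ne: "c j \<noteq> c' j"
  define J where "J = Max {j. j < N \<and> c j \<noteq> c' j}"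
  have "J \<in> {j. j < N \<and> c j \<noteq> c' j}"
    unfolding J_def using ne \<open>j < N\<close> by (intro Max_in) auto
  hence J: "J < N" "c J \<noteq> c' J" by auto
  have max: "c j = c' j" if "j < N" "j > J" for j
  proof (rule ccontr)
    assume "c j \<noteq> c' j"
    hence "j \<le> J" unfolding J_def using that by (intro Max_ge) auto
    thus False using that by simp
  qed
  define h where "h = (\<Sum>j<N. monom (c j - c' j) (d + j)) - (\<Sum>i<d. monom (k i) i)"
  have co: "coeff h n = (if n < d then - k n else if n < d + N then c (n - d) - c' (n - d) else 0)" for n
  proof -
    have "coeff (\<Sum>j<N. monom (c j - c' j) (d + j)) n = (\<Sum>j<N. if d + j = n then c j - c' j else 0)"
      by (simp add: coeff_sum)
    also have "\<dots> = (\<Sum>j<N. if j = n - d then (if n \<ge> d then c j - c' j else 0) else 0)"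
      by (intro sum.cong) auto
    also have "\<dots> = (if n < d then 0 else if n < d + N then c (n - d) - c' (n - d) else 0)"
      by auto
    finally have "coeff (\<Sum>j<N. monom (c j - c' j) (d + j)) n =
        (if n < d then 0 else if n < d + N then c (n - d) - c' (n - d) else 0)" .
    moreover have "coeff (\<Sum>i<d. monom (k i) i) n = (if n < d then k n else 0)"
      by (simp add: coeff_sum)
    ultimately show ?thesis by (simp add: h_def)
  qed
  have "cpoly h = (\<Sum>j<N. monom (of_int (c j) - of_int (c' j)) (d + j)) - (\<Sum>i<d. monom (of_int (k i)) i)"
    by (intro poly_eqI) (simp add: coeff_cpoly h_def coeff_sum of_int_sum if_distrib cong: if_cong)
  hence "poly (cpoly h) \<gamma> = 0"
    using eq by (simp add: poly_sum poly_monom left_diff_distrib sum_subtractf)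
  hence "f dvd h" by (rule minpol_dvd[OF f])
  then obtain q where q: "h = f * q" by blast
  have "degree h = d + J"
  proof (rule antisym)
    show "degree h \<le> d + J"
    proof (rule degree_le, intro allI impI)
      fix i assume "d + J < i"
      thus "coeff h i = 0" using max[of "i - d"] by (auto simp: co)
    qed
    show "d + J \<le> degree h" using J by (intro le_degree) (simp add: co)
  qed
  hence "lead_coeff h = c J - c' J" using J by (simp add: co)
  hence "lead_coeff f dvd c J - c' J" by (metis q lead_coeff_mult dvd_triv_left)
  moreover have "\<bar>c J - c' J\<bar> < lead_coeff f" using cc[OF J(1)] by auto
  ultimately show False using J(2) by (metis dvd_imp_le_int abs_of_pos minpol_lead[OF f] not_le right_minus_eq)
qed

text \<open>The leading coefficient times \<gamma> is integral everywhere, so the leading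
  coefficient has positive value at every pole of \<gamma>.\<close>

lemma finite_S: "finite S"
proof (rule finite_subset)
  have l: "lead_coeff f \<noteq> 0" using minpol_nz[OF f] by simp
  show "S \<subseteq> {v \<in> finite_places F. v (of_int (lead_coeff f)) > 0}"
  proof
    fix v assume v: "v \<in> S"
    then interpret v: place F v using F by unfold_locales (auto simp: S_def)
    have "of_int (lead_coeff f) * \<gamma> \<in> valuation_ring F v"
      using valring_lead_mult[OF v.valring_place generator_in_F, of "cpoly f"] minpol_eval[OF f]
        subring_of_int[OF valring_subring[OF v.valring_place]]
      by (simp add: coeff_cpoly degree_cpoly)
    hence "v (of_int (lead_coeff f) * \<gamma>) \<ge> 0" using l \<gamma> by (auto simp: valuation_ring_def)
    thus "v \<in> {v \<in> finite_places F. v (of_int (lead_coeff f)) > 0}"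
      using v l \<gamma> generator_in_F by (simp add: v.v_mult subring_of_int[OF F_subring] S_def)
  qed
  show "finite {v \<in> finite_places F. v (of_int (lead_coeff f)) > 0}"
    by (rule finite_places_above[OF F B l])
qed

definition res_card :: "(complex \<Rightarrow> int) \<Rightarrow> nat" where "res_card v = card (residue_field F v)"

text \<open>The product of \<open>place_abs F v \<gamma>\<close> over the poles of \<gamma>; its
  logarithm is the finite part of the Weil height before division by the degree.\<close>

definition denom :: nat where "denom = (\<Prod>v\<in>S. res_card v ^ nat (- v \<gamma>))"

lemma res_card_pos: assumes "v \<in> finite_places F" shows "res_card v > 0"
proof -
  interpret v: place F v using F assms by unfold_locales
  show ?thesis unfolding res_card_def by (rule v.residue_field_reps(1)[OF F_Qbar B])
qed

lemma denom_pos: "denom > 0"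
  unfolding denom_def by (intro prod_pos) (auto simp: S_def res_card_pos)

text \<open>\<open>\<rho> c\<close> records the class of \<open>\<theta> c\<close> at each pole of
  \<gamma>, and \<open>\<kappa> c\<close> the coordinates modulo \<open>D\<close> of
  \<open>D\<close> times its difference from a fixed member of the class. Together they determine
  \<open>c\<close>, and the right side bounds the number of such pairs.\<close>

lemma counting_bound:
  assumes D: "D > 0" "\<And>x. x \<in> F \<Longrightarrow> (\<And>v. v \<in> finite_places F \<Longrightarrow> x \<in> valuation_ring F v) \<Longrightarrow>
      \<exists>e::nat \<Rightarrow> int. of_int D * x = (\<Sum>i<d. of_int (e i) * \<gamma> ^ i)"
  shows "nat (lead_coeff f) ^ N \<le> denom ^ (d + N) * nat D ^ d"
proof -
  define \<theta> where "\<theta> c = (\<Sum>j<N. of_int (c j) * \<gamma> ^ (d + j))" for c :: "nat \<Rightarrow> int"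
  define T where "T = PiE {..<N} (\<lambda>_. {0..<lead_coeff f})"
  have \<theta>F: "\<theta> c \<in> F" for c
    unfolding \<theta>_def by (intro subring_sum[OF F_subring] subring_mult[OF F_subring] subring_of_int[OF F_subring] subring_power[OF F_subring] generator_in_F)
  \<comment> \<open>Divided by \<open>\<gamma> ^ (d + N)\<close>, the combination becomes an integer
    polynomial in \<open>inverse \<gamma>\<close>, which is integral at a pole of \<gamma>. This
    bounds the order of the pole of \<open>\<theta> c\<close>.\<close>
  have "\<exists>R. finite R \<and> card R \<le> res_card v ^ (nat (- v \<gamma>) * (d + N)) \<and> (\<forall>c. \<exists>r\<in>R. \<theta> c - r \<in> valuation_ring F v)"
    if v: "v \<in> S" for v
  proof -
    interpret v: place F v using F v by unfold_locales (auto simp: S_def)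
    note W = v.valring_place
    note sub = valring_subring[OF W]
    define n where "n = nat (- v \<gamma>) * (d + N)"
    obtain R where R: "finite R" "card R \<le> res_card v ^ n"
        "\<And>x. x \<in> F \<Longrightarrow> x = 0 \<or> v x \<ge> - int n \<Longrightarrow> \<exists>r\<in>R. x - r \<in> valuation_ring F v"
      using v.reps_modulo_integers[OF F_Qbar B, of n] unfolding res_card_def by blast
    have "\<theta> c = 0 \<or> v (\<theta> c) \<ge> - int n" for c
    proof (cases "\<theta> c = 0")
      case False
      have ig: "inverse \<gamma> \<in> valuation_ring F v"
        using v \<gamma> generator_in_F by (auto simp: valuation_ring_def v.v_inverse S_def intro: subfield_inverse[OF F])
      have "\<theta> c * inverse \<gamma> ^ (d + N) = (\<Sum>j<N. of_int (c j) * inverse \<gamma> ^ (N - j))"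
        unfolding \<theta>_def sum_distrib_right
      proof (intro sum.cong refl)
        fix j assume "j \<in> {..<N}"
        hence "inverse \<gamma> ^ (d + N) = inverse \<gamma> ^ (d + j) * inverse \<gamma> ^ (N - j)"
          by (simp flip: power_add)
        thus "of_int (c j) * \<gamma> ^ (d + j) * inverse \<gamma> ^ (d + N) = of_int (c j) * inverse \<gamma> ^ (N - j)"
          using \<gamma> by (simp add: power_inverse)
      qed
      also have "\<dots> \<in> valuation_ring F v"
        by (intro subring_sum[OF sub] subring_mult[OF sub] subring_of_int[OF sub] subring_power[OF sub] ig)
      finally have "v (\<theta> c * inverse \<gamma> ^ (d + N)) \<ge> 0"
        using False \<gamma> by (auto simp: valuation_ring_def)
      moreover have "v (\<theta> c * inverse \<gamma> ^ (d + N)) = v (\<theta> c) + int (d + N) * (- v \<gamma>)"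
        using \<theta>F False \<gamma> generator_in_F subfield_inverse[OF F generator_in_F]
          v.v_mult[of "\<theta> c" "inverse \<gamma> ^ (d + N)"] v.v_power[of "inverse \<gamma>" "d + N"]
        by (simp add: v.v_inverse subring_power[OF F_subring])
      moreover have "int n = int (d + N) * (- v \<gamma>)" using v by (simp add: n_def S_def)
      ultimately show ?thesis by linarith
    qed simp
    thus ?thesis using R \<theta>F unfolding n_def by blast
  qed
  then obtain R where R: "\<And>v. v \<in> S \<Longrightarrow> finite (R v)"
      "\<And>v. v \<in> S \<Longrightarrow> card (R v) \<le> res_card v ^ (nat (- v \<gamma>) * (d + N))"
      "\<And>v c. v \<in> S \<Longrightarrow> \<exists>r\<in>R v. \<theta> c - r \<in> valuation_ring F v"
    by metis
  from R(3) obtain r where r: "\<And>v c. v \<in> S \<Longrightarrow> r v c \<in> R v"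
      "\<And>v c. v \<in> S \<Longrightarrow> \<theta> c - r v c \<in> valuation_ring F v"
    by metis
  define \<rho> where "\<rho> c = restrict (\<lambda>v. r v c) S" for c
  \<comment> \<open>A fixed member of each class: only differences within a class are known to be
    integral everywhere, so coordinates are taken relative to it.\<close>
  define b where "b s = (SOME c. c \<in> T \<and> \<rho> c = s)" for s
  have b: "b (\<rho> c) \<in> T" "\<rho> (b (\<rho> c)) = \<rho> c" if "c \<in> T" for c
    using someI[of "\<lambda>c'. c' \<in> T \<and> \<rho> c' = \<rho> c" c] that by (auto simp: b_def)
  have int: "\<theta> c - \<theta> c' \<in> valuation_ring F v" if e: "\<rho> c = \<rho> c'" and v: "v \<in> finite_places F" for c c' v
  proof -
    interpret v: place F v using F v by unfold_locales
    note sub = valring_subring[OF v.valring_place]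
    show ?thesis
    proof (cases "v \<in> S")
      case True
      have "r v c = r v c'" using fun_cong[OF e, of v] True by (simp add: \<rho>_def)
      thus ?thesis using subring_diff[OF sub r(2)[OF True, of c] r(2)[OF True, of c']] by simp
    next
      case False
      hence "\<gamma> \<in> valuation_ring F v" using v generator_in_F by (auto simp: S_def valuation_ring_def)
      thus ?thesis
        unfolding \<theta>_def by (intro subring_diff[OF sub] subring_sum[OF sub] subring_mult[OF sub]
            subring_of_int[OF sub] subring_power[OF sub])
    qed
  qed
  have "\<exists>e::nat \<Rightarrow> int. of_int D * (\<theta> c - \<theta> (b (\<rho> c))) = (\<Sum>i<d. of_int (e i) * \<gamma> ^ i)" if "c \<in> T" for c
    using b[OF that] by (intro D(2) subring_diff[OF F_subring] \<theta>F int) auto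
  then obtain e :: "(nat \<Rightarrow> int) \<Rightarrow> nat \<Rightarrow> int"
    where e: "\<And>c. c \<in> T \<Longrightarrow> of_int D * (\<theta> c - \<theta> (b (\<rho> c))) = (\<Sum>i<d. of_int (e c i) * \<gamma> ^ i)"
    by metis
  define \<kappa> where "\<kappa> c = restrict (\<lambda>i. e c i mod D) {..<d}" for c
  have "inj_on (\<lambda>c. (\<rho> c, \<kappa> c)) T"
  proof (rule inj_onI)
    fix c c' assume c: "c \<in> T" "c' \<in> T" "(\<rho> c, \<kappa> c) = (\<rho> c', \<kappa> c')"
    define k where "k i = (e c i - e c' i) div D" for i
    have k: "e c i - e c' i = D * k i" if "i < d" for i
    proof -
      have "e c i mod D = e c' i mod D" using c(3) that by (auto simp: \<kappa>_def dest: fun_cong[of _ _ i])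
      hence "D dvd e c i - e c' i" by (simp add: mod_eq_dvd_iff)
      thus ?thesis by (simp add: k_def)
    qed
    have "of_int D * (\<theta> c - \<theta> c') = of_int D * (\<theta> c - \<theta> (b (\<rho> c))) - of_int D * (\<theta> c' - \<theta> (b (\<rho> c')))"
      using c(3) by (simp add: algebra_simps)
    also have "\<dots> = (\<Sum>i<d. of_int (e c i - e c' i) * \<gamma> ^ i)"
      by (simp add: e c sum_subtractf left_diff_distrib)
    also have "\<dots> = (\<Sum>i<d. of_int D * (of_int (k i) * \<gamma> ^ i))"
      by (intro sum.cong refl) (simp add: k del: of_int_diff)
    finally have "\<theta> c - \<theta> c' = (\<Sum>i<d. of_int (k i) * \<gamma> ^ i)"
      using D(1) by (simp add: sum_distrib_left[symmetric])
    hence "c j = c' j" if "j < N" for j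
      using high_coefficients_unique[of N c c' k j] c that unfolding \<theta>_def T_def by (auto simp: PiE_iff)
    thus "c = c'" using c(1,2) by (intro extensionalityI[of _ "{..<N}"]) (auto simp: T_def PiE_def)
  qed
  moreover have "(\<lambda>c. (\<rho> c, \<kappa> c)) ` T \<subseteq> PiE S R \<times> PiE {..<d} (\<lambda>_. {0..<D})"
  proof (rule image_subsetI)
    fix c
    show "(\<rho> c, \<kappa> c) \<in> PiE S R \<times> PiE {..<d} (\<lambda>_. {0..<D})"
      unfolding \<rho>_def \<kappa>_def mem_Times_iff fst_conv snd_conv restrict_PiE_iff using r(1) D(1) by simp
  qed
  moreover have fin: "finite (PiE S R \<times> PiE {..<d} (\<lambda>_. {0..<D}))"
    using finite_S R(1) by (intro finite_cartesian_product finite_PiE) auto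
  ultimately have "card T \<le> card (PiE S R \<times> PiE {..<d} (\<lambda>_. {0..<D}))"
    by (rule card_inj_on_le)
  also have "\<dots> = (\<Prod>v\<in>S. card (R v)) * nat D ^ d"
    by (simp add: card_cartesian_product card_PiE finite_S)
  also have "(\<Prod>v\<in>S. card (R v)) \<le> (\<Prod>v\<in>S. (res_card v ^ nat (- v \<gamma>)) ^ (d + N))"
    using R(2) by (intro prod_mono) (auto simp: power_mult[symmetric])
  also have "\<dots> = denom ^ (d + N)" by (simp add: denom_def prod_power_distrib)
  finally show ?thesis by (simp add: T_def card_PiE)
qed

text \<open>In \<open>counting_bound\<close> the factor \<open>denom ^ d * nat D ^ d\<close> does
  not depend on \<open>N\<close>, so letting \<open>N\<close> grow excludes
  \<open>denom < a\<close>.\<close>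

lemma lead_coeff_le_denom: "nat (lead_coeff f) \<le> denom"
proof (rule ccontr)
  define a where "a = nat (lead_coeff f)"
  assume "\<not> ?thesis"
  hence gt: "real denom < real a" by (simp add: a_def)
  obtain D :: int where D: "D > 0" "\<And>x. x \<in> F \<Longrightarrow> (\<And>v. v \<in> finite_places F \<Longrightarrow> x \<in> valuation_ring F v) \<Longrightarrow>
      \<exists>e::nat \<Rightarrow> int. of_int D * x = (\<Sum>i<d. of_int (e i) * \<gamma> ^ i)"
    using common_denominator by blast
  have dp: "real denom > 0" using denom_pos by simp
  have "1 < real a / real denom" using gt dp by simp
  then obtain N where N: "real (denom ^ d * nat D ^ d) < (real a / real denom) ^ N"
    using real_arch_pow by blast
  have "a ^ N \<le> denom ^ (d + N) * nat D ^ d" unfolding a_def by (rule counting_bound[OF D])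
  hence "real (a ^ N) \<le> real (denom ^ (d + N) * nat D ^ d)" by (simp only: of_nat_le_iff)
  also have "\<dots> = real (denom ^ d * nat D ^ d) * real denom ^ N" by (simp add: power_add)
  also have "\<dots> < (real a / real denom) ^ N * real denom ^ N" using N dp by (intro mult_strict_right_mono) auto
  also have "\<dots> = real (a ^ N)" using dp by (simp add: power_divide)
  finally show False by simp
qed

lemma weil_height_ge_mahler_height: "mahler_height f \<le> weil_height \<gamma>"
proof -
  define A where "A = (\<Sum>z\<in>croots f. log_plus (norm z))"
  have arch: "(\<Sum>\<sigma>\<in>embeddings F. log_plus (norm (\<sigma> \<gamma>))) = A"
    unfolding A_def by (rule sum.reindex_bij_betw[OF embeddings_bij])
  have zero: "log_plus (place_abs F v \<gamma>) = 0" if v: "v \<in> finite_places F - S" for v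
  proof -
    have q: "real (res_card v) \<ge> 1" using res_card_pos[of v] v by simp
    have "v \<gamma> \<ge> 0" using v by (auto simp: S_def)
    hence "place_abs F v \<gamma> = inverse (real (res_card v) ^ nat (v \<gamma>))"
      using \<gamma> by (simp add: place_abs_def res_card_def power_int_def power_inverse)
    also have "\<dots> \<le> 1" using one_le_power[OF q] by (simp add: inverse_le_1_iff)
    finally show ?thesis by (simp add: log_plus_def)
  qed
  have nonzero: "log_plus (place_abs F v \<gamma>) = ln (res_card v ^ nat (- v \<gamma>))" if v: "v \<in> S" for v
  proof -
    have q: "real (res_card v) \<ge> 1" using res_card_pos[of v] v by (simp add: S_def)
    have "place_abs F v \<gamma> = real (res_card v) ^ nat (- v \<gamma>)"
      using \<gamma> v by (simp add: place_abs_def res_card_def power_int_def S_def)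
    thus ?thesis using one_le_power[OF q] by (simp add: log_plus_def)
  qed
  \<comment> \<open>Only poles of \<gamma> contribute, which turns the infinite sum into a finite
    one.\<close>
  have "(\<Sum>\<^sub>\<infinity>v\<in>finite_places F. log_plus (place_abs F v \<gamma>)) = (\<Sum>\<^sub>\<infinity>v\<in>S. log_plus (place_abs F v \<gamma>))"
    using zero by (intro infsum_cong_neutral) (auto simp: S_def)
  also have "\<dots> = (\<Sum>v\<in>S. log_plus (place_abs F v \<gamma>))" using finite_S by simp
  also have "\<dots> = (\<Sum>v\<in>S. ln (real (res_card v ^ nat (- v \<gamma>))))" by (intro sum.cong refl) (simp add: nonzero)
  also have "\<dots> = ln (\<Prod>v\<in>S. real (res_card v ^ nat (- v \<gamma>)))"
    using finite_S res_card_pos by (intro ln_prod[symmetric]) (auto simp: S_def)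
  also have "\<dots> = ln (real denom)" by (simp add: denom_def)
  finally have fin: "(\<Sum>\<^sub>\<infinity>v\<in>finite_places F. log_plus (place_abs F v \<gamma>)) = ln (real denom)" .
  have l: "lead_coeff f \<ge> 1" using minpol_lead[OF f] by linarith
  have "real_of_int (lead_coeff f) \<le> real denom" using lead_coeff_le_denom by linarith
  hence "ln (lead_coeff f) \<le> ln (real denom)" using l by (intro ln_mono) auto
  moreover have "A \<ge> 0" unfolding A_def by (intro sum_nonneg log_plus_nonneg)
  moreover have "ln (lead_coeff f) \<ge> 0" using l by simp
  \<comment> \<open>From left to right the numerator does not decrease and the denominator does not
    increase.\<close>
  ultimately have "(ln (lead_coeff f) + A) / degree f \<le> (A + ln (real denom)) / degree_over_rat F"
    using degree_over_rat_adjoin[OF f] by (intro frac_le) (auto simp: F_def)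
  thus ?thesis
    unfolding mahler_height_def weil_height_def Let_def F_def[symmetric] arch fin A_def by simp
qed

end

section \<open>Descent to the subfield\<close>

lemma pcompose_in_subring:
  assumes R: "is_subring R" and p: "\<And>i. coeff p i \<in> R" and q: "\<And>i. coeff q i \<in> R"
  shows "coeff (pcompose p q) i \<in> R"
  using p
proof (induction p arbitrary: i)
  case (pCons a p)
  have "a \<in> R" using pCons.prems[of 0] by simp
  hence 1: "coeff [:a:] i \<in> R" by (simp add: coeff_pCons subring_zero[OF R] split: nat.splits)
  have "coeff p i \<in> R" for i using pCons.prems[of "Suc i"] by simp
  hence 2: "coeff (q * pcompose p q) i \<in> R"
    unfolding coeff_mult by (intro subring_sum[OF R] subring_mult[OF R] q pCons.IH)
  show ?case unfolding pcompose_pCons coeff_add by (rule subring_add[OF R 1 2])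
qed (use R in \<open>simp add: subring_zero\<close>)

theorem corollary1p2:
  fixes K :: "complex set" and \<alpha> :: complex
  assumes "is_subfield K" and "K \<subseteq> Qbar"
    and "\<alpha> \<in> Qbar - {0}"
    and "\<forall>\<epsilon>>0. \<exists>m::int. m \<noteq> 0 \<and>
           (\<exists>\<beta>\<in>K - {0}. weil_height (\<alpha> powi m / \<beta>) < \<epsilon> * \<bar>real_of_int m\<bar>)"
  shows "\<exists>n::int. n \<noteq> 0 \<and> \<alpha> powi n \<in> K - {0}"
proof -
  note K = \<open>is_subfield K\<close>
  note Ksub = subfield_subring[OF K]
  note Q = is_subfield_Qbar
  have \<alpha>: "\<alpha> \<in> Qbar" "\<alpha> \<noteq> 0" using assms(3) by auto
  obtain f0 where f0: "minpol f0 \<alpha>" using \<alpha> minpol_exists by (auto simp: Qbar_def)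
  have intK: "coeff (cpoly h) i \<in> K" for h i by (simp add: coeff_cpoly subring_of_int[OF Ksub])
  \<comment> \<open>A polynomial \<open>p\<close> of least degree with this property is, up to a
    factor in \<open>K\<close>, the minimal polynomial of \<alpha> over \<open>K\<close>, and its
    roots are the conjugates over \<open>K\<close>.\<close>
  define P where "P q \<longleftrightarrow> (\<forall>i. coeff q i \<in> K) \<and> q \<noteq> 0 \<and> poly q \<alpha> = 0" for q
  have "P (cpoly f0)" using f0 intK by (simp add: P_def minpol_eval cpoly_eq_0 minpol_nz)
  then obtain p where p: "P p" "\<And>q. P q \<Longrightarrow> degree p \<le> degree q"
    using ex_has_least_nat[of P "cpoly f0" degree] by blast
  have pK: "\<And>i. coeff p i \<in> K" "p \<noteq> 0" "poly p \<alpha> = 0" using p(1) by (auto simp: P_def)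
  \<comment> \<open>Division by \<open>p\<close> over \<open>K\<close>, obtained from the
    pseudo-division along the identity homomorphism on \<open>K\<close>.\<close>
  have conj: "poly q \<alpha>' = 0" if "\<And>i. coeff q i \<in> K" "poly q \<alpha> = 0" "poly p \<alpha>' = 0" for q \<alpha>'
  proof -
    have "hom_graph (Id_on K)"
      using assms(2) by (auto simp: hom_graph_def subring_closed[OF Ksub])
    moreover have "coeffs_related (Id_on K) q q' \<longleftrightarrow> (\<forall>i. coeff q i \<in> K) \<and> q' = q" for q q'
      by (auto simp: coeffs_related_def poly_eq_iff)
    ultimately show ?thesis
      using hom_graph_common_root[of "Id_on K" p p \<alpha> \<alpha>' q q] pK p(2) that by (auto simp: P_def)
  qed
  have unity: "\<exists>n>0. \<alpha>' ^ n = \<alpha> ^ n" if a': "poly p \<alpha>' = 0" for \<alpha>'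
  proof -
    have "\<alpha>' \<in> croots f0" using conj[OF intK minpol_eval[OF f0] a'] by (simp add: croots_def)
    hence f0': "minpol f0 \<alpha>'" by (rule minpol_root[OF f0])
    have \<alpha>': "\<alpha>' \<in> Qbar" "\<alpha>' \<noteq> 0"
      using minpol_algebraic[OF f0'] minpol_eval[OF f0'] minpol_coeff_0[OF f0 \<alpha>(2)]
      by (auto simp: Qbar_def poly_0_coeff_0 coeff_cpoly)
    define x where "x = \<alpha>' / \<alpha>"
    have "x \<in> Qbar" using \<alpha> \<alpha>' by (auto simp: x_def intro: subfield_divide[OF Q])
    then obtain g where g: "minpol g x" using minpol_exists by (auto simp: Qbar_def)
    have small: "mahler_height g \<le> \<epsilon>" if eps: "\<epsilon> > 0" for \<epsilon>
    proof -
      \<comment> \<open>Half of \<epsilon> makes up for the factor 2 in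
        \<open>height_conjugate_quotient\<close>.\<close>
      obtain m \<beta> where m: "m \<noteq> 0" "\<beta> \<in> K - {0}" "weil_height (\<alpha> powi m / \<beta>) < (\<epsilon> / 2) * \<bar>real_of_int m\<bar>"
        using assms(4) eps by (metis half_gt_zero)
      define \<gamma> \<gamma>' where "\<gamma> = \<alpha> powi m / \<beta>" and "\<gamma>' = \<alpha>' powi m / \<beta>"
      have bQ: "\<beta> \<in> Qbar" "\<beta> \<in> K" "\<beta> \<noteq> 0" using m assms(2) by auto
      have \<gamma>: "\<gamma> \<in> Qbar" "\<gamma> \<noteq> 0" "\<gamma>' \<noteq> 0"
        using bQ \<alpha> \<alpha>' by (auto simp: \<gamma>_def \<gamma>'_def intro: subfield_divide[OF Q] subfield_powi[OF Q])
      obtain f where f: "minpol f \<gamma>" using \<gamma> minpol_exists by (auto simp: Qbar_def)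
      define k where "k = nat \<bar>m\<bar>"
      have k: "k > 0" using m by (simp add: k_def)
      have "\<gamma>' \<in> croots f \<and> (x ^ k = \<gamma>' / \<gamma> \<or> x ^ k = \<gamma> / \<gamma>')"
      proof (cases "m > 0")
        case True
        hence pw: "z powi m = z ^ k" for z :: complex by (simp add: power_int_def k_def)
        \<comment> \<open>Composing the minimal polynomial of \<gamma> with this monomial gives a
          polynomial over \<open>K\<close> with root \<alpha>; it vanishes at \<alpha>' too, so
          \<gamma>' is a root of \<open>f\<close>.\<close>
        have "coeff (monom (inverse \<beta>) k) i \<in> K" for i
          using bQ by (auto simp: subring_zero[OF Ksub] intro: subfield_inverse[OF K])
        hence "coeff (pcompose (cpoly f) (monom (inverse \<beta>) k)) i \<in> K" for i
          by (intro pcompose_in_subring[OF Ksub intK])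
        moreover have e: "poly (pcompose (cpoly f) (monom (inverse \<beta>) k)) z = poly (cpoly f) (z powi m / \<beta>)" for z
          by (simp add: poly_pcompose poly_monom pw field_simps)
        moreover have "poly (cpoly f) (\<alpha> powi m / \<beta>) = 0" using minpol_eval[OF f] by (simp add: \<gamma>_def)
        ultimately have "poly (cpoly f) (\<alpha>' powi m / \<beta>) = 0" using conj[OF _ _ a'] by metis
        moreover have "x ^ k = \<gamma>' / \<gamma>"
          using bQ by (simp add: x_def \<gamma>_def \<gamma>'_def pw power_divide)
        ultimately show ?thesis by (simp add: croots_def \<gamma>'_def)
      next
        case False
        hence pw: "z powi m = inverse (z ^ k)" for z :: complex
          by (simp add: power_int_def k_def power_inverse)
        \<comment> \<open>For negative \<open>m\<close> the argument
          \<open>z powi m / \<beta>\<close> is the inverse of \<open>\<beta> * z ^ k\<close>, so the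
          reversed polynomial is composed instead.\<close>
        have "coeff (monom \<beta> k) i \<in> K" for i
          using bQ by (auto simp: subring_zero[OF Ksub])
        moreover have "coeff (reflect_poly (cpoly f)) i \<in> K" for i
          using intK[of f] by (auto simp: coeff_reflect_poly subring_zero[OF Ksub])
        ultimately have "coeff (pcompose (reflect_poly (cpoly f)) (monom \<beta> k)) i \<in> K" for i
          by (intro pcompose_in_subring[OF Ksub])
        moreover have e: "poly (pcompose (reflect_poly (cpoly f)) (monom \<beta> k)) z = 0 \<longleftrightarrow>
            poly (cpoly f) (z powi m / \<beta>) = 0" if "z \<noteq> 0" for z
        proof -
          have "\<beta> * z ^ k \<noteq> 0" using that bQ by simp
          moreover have "inverse (\<beta> * z ^ k) = z powi m / \<beta>" using that bQ by (simp add: pw field_simps)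
          ultimately show ?thesis
            using that by (simp add: poly_pcompose poly_monom poly_reflect_poly_nz)
        qed
        moreover have "poly (cpoly f) (\<alpha> powi m / \<beta>) = 0" using minpol_eval[OF f] by (simp add: \<gamma>_def)
        ultimately have "poly (cpoly f) (\<alpha>' powi m / \<beta>) = 0"
          using conj[OF _ _ a'] e[OF \<alpha>(2)] e[OF \<alpha>'(2)] by metis
        moreover have "x ^ k = \<gamma> / \<gamma>'"
          using bQ by (simp add: x_def \<gamma>_def \<gamma>'_def pw power_divide field_simps)
        ultimately show ?thesis by (simp add: croots_def \<gamma>'_def)
      qed
      \<comment> \<open>A negative \<open>m\<close> inverts the quotient; then \<gamma> and
        \<gamma>' exchange roles, both having minimal polynomial \<open>f\<close>.\<close>
      hence root: "\<gamma>' \<in> croots f" and rel: "x ^ k = \<gamma>' / \<gamma> \<or> x ^ k = \<gamma> / \<gamma>'" by auto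
      have "k * mahler_height g \<le> 2 * mahler_height f"
        using rel
      proof
        assume "x ^ k = \<gamma>' / \<gamma>"
        thus ?thesis by (rule height_conjugate_quotient[OF f root \<gamma>(2) g k])
      next
        assume "x ^ k = \<gamma> / \<gamma>'"
        thus ?thesis
          by (rule height_conjugate_quotient[OF minpol_root[OF f root] minpol_croots[OF f] \<gamma>(3) g k])
      qed
      also have "mahler_height f \<le> weil_height \<gamma>"
        using f \<gamma>(2) by (intro simple_field.weil_height_ge_mahler_height) (simp add: simple_field_def)
      also have "weil_height \<gamma> \<le> (\<epsilon> / 2) * \<bar>real_of_int m\<bar>" using m by (simp add: \<gamma>_def)
      also have "\<bar>real_of_int m\<bar> = k" by (simp add: k_def)
      finally have "k * mahler_height g \<le> k * \<epsilon>" by (simp add: mult.commute)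
      thus ?thesis using k by simp
    qed
    have "mahler_height g \<le> 0" by (rule field_le_epsilon) (use small in simp)
    moreover have "x \<noteq> 0" using \<alpha> \<alpha>' by (simp add: x_def)
    ultimately obtain n where "n > 0" "x ^ n = 1" using root_of_unity_if_height_le_0[OF g] by blast
    thus ?thesis using \<alpha> by (auto simp: x_def power_divide)
  qed
  then obtain N where N: "\<And>a. poly p a = 0 \<Longrightarrow> N a > 0 \<and> a ^ N a = \<alpha> ^ N a" by metis
  \<comment> \<open>A common multiple of the exponents, so that one power serves all
    conjugates.\<close>
  define n where "n = (\<Prod>a | poly p a = 0. N a)"
  have fin: "finite {a. poly p a = 0}" by (rule poly_roots_finite[OF pK(2)])
  have n: "n > 0" unfolding n_def using N by (intro prod_pos) auto
  have pw: "a ^ n = \<alpha> ^ n" if "poly p a = 0" for a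
  proof -
    have "N a dvd n" unfolding n_def using fin that by (intro dvd_prodI) auto
    then obtain r where "n = N a * r" by blast
    thus ?thesis using N[OF that] by (simp add: power_mult)
  qed
  obtain root where root: "smult (lead_coeff p) (\<Prod>i<degree p. [:-root i, 1:]) = p"
    using complex_poly_decompose' by blast
  have rt: "poly p (root i) = 0" if "i < degree p" for i
    using that by (subst root[symmetric]) (auto simp: poly_prod)
  have dp: "degree p > 0"
  proof (rule ccontr)
    assume "\<not> ?thesis"
    then obtain c where "p = [:c:]" by (auto elim: degree_eq_zeroE)
    thus False using pK by auto
  qed
  \<comment> \<open>The norm of \<alpha> up to sign is a quotient of two coefficients of
    \<open>p\<close> and so lies in \<open>K\<close>.\<close>
  have "coeff p 0 = lead_coeff p * (\<Prod>i<degree p. - root i)"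
    by (subst (1) root[symmetric]) (simp add: poly_prod flip: poly_0_coeff_0)
  hence "(\<Prod>i<degree p. - root i) = coeff p 0 / lead_coeff p" using pK(2) by simp
  hence inK: "(\<Prod>i<degree p. - root i) \<in> K" using pK(1) by (auto intro: subfield_divide[OF K])
  \<comment> \<open>The even exponent removes the signs of the negated roots.\<close>
  have "(\<Prod>i<degree p. - root i) ^ (2 * n) = (\<Prod>i<degree p. ((root i) ^ n) ^ 2)"
    by (simp add: prod_power_distrib power_mult mult.commute[of 2] flip: power_mult)
  also have "\<dots> = (\<Prod>i<degree p. (\<alpha> ^ n) ^ 2)" by (intro prod.cong) (auto simp: pw rt)
  also have "\<dots> = \<alpha> ^ (n * 2 * degree p)" by (simp add: power_mult)
  finally have "\<alpha> ^ (n * 2 * degree p) \<in> K" using subring_power[OF Ksub inK, of "2 * n"] by simp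
  hence "\<alpha> powi int (n * 2 * degree p) \<in> K - {0}" using \<alpha> by (simp only: power_int_of_nat) simp
  moreover have "int (n * 2 * degree p) \<noteq> 0" using n dp by simp
  ultimately show ?thesis by blast
qed

end
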